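(* Let $Z=\{x\in M: v_x=0\}$ be the zero set of a conformal vector field $v$ on a pseudo-Riemannian manifold $(M,g)$ of dimension $n\ge 3$. For $x\in M$ let $\chi(\nabla v)(x)\in\mathcal{P}_n$ be the characteristic polynomial of the endomorphism $\nabla v_x:T_xM\to T_xM$, where $\nabla$ is the Levi-Civita connection of $g$. Then $\chi(\nabla v):M\to\mathcal{P}_n$ is constant on every connected component of $Z$ and, consequently, so is $\phi=(2/n)\,\mathrm{div}\,v:M\to\mathbb{R}$.
   Context: All manifolds, metrics and vector fields are of class $C^\infty$; $g$ may have any signature. Manifolds need not be connected, but all their connected components have the same dimension. A vector field $v$ on $(M,g)$ is called conformal if $\mathcal{L}_v g=\phi g$ for some function $\phi:M\to\mathbb{R}$; then $\phi=(2/n)\,\mathrm{div}\,v$. The covariant derivative $\nabla v$ is treated as the bundle morphism $TM\to TM$ sending a vector field $w$ to $\nabla_w v$, and $\mathrm{div}\,v=\mathrm{tr}\,\nabla v$. $\mathcal{P}_n$ is the vector space of all real polynomials in one variable of degree at most $n$. *)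

theory Defs
  imports "HOL-Analysis.Analysis" "HOL-Computational_Algebra.Polynomial"
begin

section \<open>Smooth maps between open subsets of Euclidean spaces\<close>

text \<open>Used for open \<open>S\<close> only; \<open>frechet_derivative f (at x) h\<close> is the derivative of
  \<open>f\<close> at \<open>x\<close> in the direction \<open>h\<close>.\<close>

primrec Ck_on :: "nat \<Rightarrow> ('a::euclidean_space \<Rightarrow> 'b::real_normed_vector) \<Rightarrow> 'a set \<Rightarrow> bool" where
  "Ck_on 0 f S \<longleftrightarrow> continuous_on S f"
| "Ck_on (Suc k) f S \<longleftrightarrow>
     (\<forall>x\<in>S. f differentiable (at x)) \<and> (\<forall>h. Ck_on k (\<lambda>x. frechet_derivative f (at x) h) S)"

definition smooth_on :: "('a::euclidean_space \<Rightarrow> 'b::real_normed_vector) \<Rightarrow> 'a set \<Rightarrow> bool" where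
  "smooth_on f S \<longleftrightarrow> (\<forall>k. Ck_on k f S)"


section \<open>Manifolds\<close>

text \<open>A chart is its domain together with its coordinate map.  The dimension is \<open>CARD('n)\<close>.\<close>

type_synonym ('a, 'n) chart = "'a set \<times> ('a \<Rightarrow> real ^ 'n)"

abbreviation cdom :: "('a, 'n::finite) chart \<Rightarrow> 'a set" where
  "cdom c \<equiv> fst c"

abbreviation cmap :: "('a, 'n::finite) chart \<Rightarrow> 'a \<Rightarrow> real ^ 'n" where
  "cmap c \<equiv> snd c"

definition cinv :: "('a, 'n::finite) chart \<Rightarrow> real ^ 'n \<Rightarrow> 'a" where
  "cinv c = inv_into (cdom c) (cmap c)"

definition transition :: "('a, 'n::finite) chart \<Rightarrow> ('a, 'n::finite) chart \<Rightarrow> real ^ 'n \<Rightarrow> real ^ 'n" where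
  "transition c d = cmap d \<circ> cinv c"

text \<open>\<open>smooth_manifold M A\<close>: the atlas \<open>A\<close>, not assumed maximal, turns the topological space
  \<open>M\<close> into a smooth manifold.\<close>

definition smooth_manifold :: "'a topology \<Rightarrow> ('a, 'n::finite) chart set \<Rightarrow> bool" where
  "smooth_manifold M A \<longleftrightarrow>
     Hausdorff_space M \<and> second_countable M \<and>
     (\<forall>c\<in>A. openin M (cdom c) \<and> open (cmap c ` cdom c) \<and>
        homeomorphic_map (subtopology M (cdom c)) (top_of_set (cmap c ` cdom c)) (cmap c)) \<and>
     (\<Union>c\<in>A. cdom c) = topspace M \<and>
     (\<forall>c\<in>A. \<forall>d\<in>A. smooth_on (transition c d) (cmap c ` (cdom c \<inter> cdom d)))"

text \<open>Some chart around a point, used to evaluate expressions that do not depend on the chart; see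
  the lemmas at the end of this theory.\<close>

definition chart_at :: "('a, 'n::finite) chart set \<Rightarrow> 'a \<Rightarrow> ('a, 'n::finite) chart" where
  "chart_at A x = (SOME c. c \<in> A \<and> x \<in> cdom c)"

definition smooth_function_on ::
  "('a, 'n::finite) chart set \<Rightarrow> 'a set \<Rightarrow> ('a \<Rightarrow> real) \<Rightarrow> bool" where
  "smooth_function_on A U f \<longleftrightarrow> (\<forall>c\<in>A. smooth_on (f \<circ> cinv c) (cmap c ` (U \<inter> cdom c)))"


section \<open>Tangent vectors and vector fields\<close>

text \<open>A tangent vector at \<open>x\<close> is the family of its component vectors with respect to the charts
  around \<open>x\<close>, related by the Jacobians of the transition maps.  The value 0 for all other
  charts is a convention which makes equality of tangent vectors equality of families.\<close>

type_synonym ('a, 'n) tangent = "('a, 'n) chart \<Rightarrow> real ^ 'n"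

definition tangent_space ::
  "('a, 'n::finite) chart set \<Rightarrow> 'a \<Rightarrow> ('a, 'n) tangent set" where
  "tangent_space A x = {\<xi>.
     (\<forall>c\<in>A. \<forall>d\<in>A. x \<in> cdom c \<inter> cdom d \<longrightarrow>
        \<xi> d = frechet_derivative (transition c d) (at (cmap c x)) (\<xi> c)) \<and>
     (\<forall>c. \<not> (c \<in> A \<and> x \<in> cdom c) \<longrightarrow> \<xi> c = 0)}"

definition tzero :: "('a, 'n::finite) tangent" where
  "tzero = (\<lambda>c. 0)"

definition tadd :: "('a, 'n::finite) tangent \<Rightarrow> ('a, 'n::finite) tangent \<Rightarrow> ('a, 'n::finite) tangent" where
  "tadd \<xi> \<eta> = (\<lambda>c. \<xi> c + \<eta> c)"

definition tscale :: "real \<Rightarrow> ('a, 'n::finite) tangent \<Rightarrow> ('a, 'n::finite) tangent" where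
  "tscale r \<xi> = (\<lambda>c. r *\<^sub>R \<xi> c)"

text \<open>The tangent vector at \<open>x\<close> with components \<open>u\<close> in the chart \<open>c\<close>.\<close>

definition coord_vector ::
  "('a, 'n::finite) chart set \<Rightarrow> ('a, 'n) chart \<Rightarrow> 'a \<Rightarrow> real ^ 'n \<Rightarrow> ('a, 'n) tangent" where
  "coord_vector A c x u = (\<lambda>d. if d \<in> A \<and> x \<in> cdom d
     then frechet_derivative (transition c d) (at (cmap c x)) u else 0)"

text \<open>Smooth vector fields on the open set \<open>U\<close>; values outside \<open>U\<close> are irrelevant.\<close>

definition vector_field_on ::
  "('a, 'n::finite) chart set \<Rightarrow> 'a set \<Rightarrow> ('a \<Rightarrow> ('a, 'n) tangent) \<Rightarrow> bool" where
  "vector_field_on A U X \<longleftrightarrow> (\<forall>x\<in>U. X x \<in> tangent_space A x) \<and>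
     (\<forall>c\<in>A. smooth_on (\<lambda>p. X (cinv c p) c) (cmap c ` (U \<inter> cdom c)))"

text \<open>The derivative \<open>\<xi> f\<close> of a function \<open>f\<close> along a tangent vector \<open>\<xi>\<close> at \<open>x\<close>.\<close>

definition dirderiv ::
  "('a, 'n::finite) chart set \<Rightarrow> ('a \<Rightarrow> real) \<Rightarrow> 'a \<Rightarrow> ('a, 'n) tangent \<Rightarrow> real" where
  "dirderiv A f x \<xi> = (let c = chart_at A x in
     frechet_derivative (f \<circ> cinv c) (at (cmap c x)) (\<xi> c))"

text \<open>In coordinates, \<open>[X, Y]\<^sup>i = X\<^sup>j \<partial>\<^sub>j Y\<^sup>i - Y\<^sup>j \<partial>\<^sub>j X\<^sup>i\<close>.\<close>

definition lie_bracket ::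
  "('a, 'n::finite) chart set \<Rightarrow> ('a \<Rightarrow> ('a, 'n) tangent) \<Rightarrow> ('a \<Rightarrow> ('a, 'n) tangent) \<Rightarrow>
    'a \<Rightarrow> ('a, 'n) tangent" where
  "lie_bracket A X Y x = (\<lambda>c. if c \<in> A \<and> x \<in> cdom c
     then frechet_derivative (\<lambda>p. Y (cinv c p) c) (at (cmap c x)) (X x c)
        - frechet_derivative (\<lambda>p. X (cinv c p) c) (at (cmap c x)) (Y x c)
     else 0)"


section \<open>Characteristic polynomial and trace of an endomorphism of a tangent space\<close>

definition tangent_endomorphism ::
  "('a, 'n::finite) chart set \<Rightarrow> 'a \<Rightarrow> (('a, 'n) tangent \<Rightarrow> ('a, 'n) tangent) \<Rightarrow> bool" where
  "tangent_endomorphism A x F \<longleftrightarrow>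
     (\<forall>\<xi>\<in>tangent_space A x. F \<xi> \<in> tangent_space A x) \<and>
     (\<forall>\<xi>\<in>tangent_space A x. \<forall>\<eta>\<in>tangent_space A x. F (tadd \<xi> \<eta>) = tadd (F \<xi>) (F \<eta>)) \<and>
     (\<forall>r. \<forall>\<xi>\<in>tangent_space A x. F (tscale r \<xi>) = tscale r (F \<xi>))"

text \<open>The matrix of \<open>F\<close> in the basis of the tangent space at \<open>x\<close> formed by the coordinate vectors
  of the chart \<open>c\<close>.\<close>

definition endo_matrix ::
  "('a, 'n::finite) chart set \<Rightarrow> ('a, 'n) chart \<Rightarrow> 'a \<Rightarrow>
    (('a, 'n) tangent \<Rightarrow> ('a, 'n) tangent) \<Rightarrow> real ^ 'n ^ 'n" where
  "endo_matrix A c x F = matrix (\<lambda>u. F (coord_vector A c x u) c)"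

definition matrix_charpoly :: "real ^ 'n::finite ^ 'n::finite \<Rightarrow> real poly" where
  "matrix_charpoly B = det ((\<chi> i j. (if i = j then [:0, 1:] else 0) - [:B $ i $ j:]) :: real poly ^ 'n ^ 'n)"

definition endo_charpoly ::
  "('a, 'n::finite) chart set \<Rightarrow> 'a \<Rightarrow> (('a, 'n) tangent \<Rightarrow> ('a, 'n) tangent) \<Rightarrow> real poly" where
  "endo_charpoly A x F = matrix_charpoly (endo_matrix A (chart_at A x) x F)"

definition endo_trace ::
  "('a, 'n::finite) chart set \<Rightarrow> 'a \<Rightarrow> (('a, 'n) tangent \<Rightarrow> ('a, 'n) tangent) \<Rightarrow> real" where
  "endo_trace A x F = trace (endo_matrix A (chart_at A x) x F)"


section \<open>Pseudo-Riemannian metrics, Levi-Civita connection, conformal vector fields\<close>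

text \<open>There is no condition on the signature.\<close>

definition pseudo_riemannian_metric ::
  "'a topology \<Rightarrow> ('a, 'n::finite) chart set \<Rightarrow>
    ('a \<Rightarrow> ('a, 'n) tangent \<Rightarrow> ('a, 'n) tangent \<Rightarrow> real) \<Rightarrow> bool" where
  "pseudo_riemannian_metric M A g \<longleftrightarrow>
     (\<forall>x\<in>topspace M.
        (\<forall>\<xi>\<in>tangent_space A x. \<forall>\<eta>\<in>tangent_space A x. g x \<xi> \<eta> = g x \<eta> \<xi>) \<and>
        (\<forall>\<xi>\<in>tangent_space A x. \<forall>\<eta>\<in>tangent_space A x. \<forall>\<zeta>\<in>tangent_space A x.
           g x (tadd \<xi> \<eta>) \<zeta> = g x \<xi> \<zeta> + g x \<eta> \<zeta>) \<and>
        (\<forall>r. \<forall>\<xi>\<in>tangent_space A x. \<forall>\<eta>\<in>tangent_space A x. g x (tscale r \<xi>) \<eta> = r * g x \<xi> \<eta>) \<and>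
        (\<forall>\<xi>\<in>tangent_space A x. (\<forall>\<eta>\<in>tangent_space A x. g x \<xi> \<eta> = 0) \<longrightarrow> \<xi> = tzero)) \<and>
     (\<forall>U X Y. openin M U \<longrightarrow> vector_field_on A U X \<longrightarrow> vector_field_on A U Y \<longrightarrow>
        smooth_function_on A U (\<lambda>x. g x (X x) (Y x)))"

text \<open>An affine connection is understood as acting on vector fields defined on open subsets of
  \<open>M\<close>: \<open>nabla Y x \<xi>\<close> is the covariant derivative at \<open>x\<close> of \<open>Y\<close> in the direction \<open>\<xi>\<close>, for any
  vector field \<open>Y\<close> on an open set containing \<open>x\<close>.  Thus \<open>nabla Y x\<close> is the value at \<open>x\<close> of the
  bundle morphism \<open>\<nabla> Y\<close>.  In the Leibniz rule, constant \<open>f\<close> gives homogeneity over the reals.\<close>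

definition affine_connection ::
  "'a topology \<Rightarrow> ('a, 'n::finite) chart set \<Rightarrow>
    (('a \<Rightarrow> ('a, 'n) tangent) \<Rightarrow> 'a \<Rightarrow> ('a, 'n) tangent \<Rightarrow> ('a, 'n) tangent) \<Rightarrow> bool" where
  "affine_connection M A nabla \<longleftrightarrow>
     (\<forall>U Y. openin M U \<longrightarrow> vector_field_on A U Y \<longrightarrow>
        (\<forall>x\<in>U. tangent_endomorphism A x (nabla Y x)) \<and>
        (\<forall>X. vector_field_on A U X \<longrightarrow> vector_field_on A U (\<lambda>x. nabla Y x (X x))) \<and>
        (\<forall>Y'. vector_field_on A U Y' \<longrightarrow>
           (\<forall>x\<in>U. \<forall>\<xi>\<in>tangent_space A x.
              nabla (\<lambda>y. tadd (Y y) (Y' y)) x \<xi> = tadd (nabla Y x \<xi>) (nabla Y' x \<xi>))) \<and>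
        (\<forall>f. smooth_function_on A U f \<longrightarrow>
           (\<forall>x\<in>U. \<forall>\<xi>\<in>tangent_space A x.
              nabla (\<lambda>y. tscale (f y) (Y y)) x \<xi> =
                tadd (tscale (dirderiv A f x \<xi>) (Y x)) (tscale (f x) (nabla Y x \<xi>)))) \<and>
        (\<forall>Y'. (\<forall>y\<in>U. Y' y = Y y) \<longrightarrow>
           (\<forall>x\<in>U. \<forall>\<xi>\<in>tangent_space A x. nabla Y' x \<xi> = nabla Y x \<xi>)))"

text \<open>The affine connection with \<open>\<nabla>\<^sub>X Y - \<nabla>\<^sub>Y X = [X, Y]\<close> and \<open>\<nabla> g = 0\<close>.\<close>

definition levi_civita_connection ::
  "'a topology \<Rightarrow> ('a, 'n::finite) chart set \<Rightarrow>
    ('a \<Rightarrow> ('a, 'n) tangent \<Rightarrow> ('a, 'n) tangent \<Rightarrow> real) \<Rightarrow>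
    (('a \<Rightarrow> ('a, 'n) tangent) \<Rightarrow> 'a \<Rightarrow> ('a, 'n) tangent \<Rightarrow> ('a, 'n) tangent) \<Rightarrow> bool" where
  "levi_civita_connection M A g nabla \<longleftrightarrow>
     affine_connection M A nabla \<and>
     (\<forall>U X Y. openin M U \<longrightarrow> vector_field_on A U X \<longrightarrow> vector_field_on A U Y \<longrightarrow>
        (\<forall>x\<in>U. nabla Y x (X x) = tadd (nabla X x (Y x)) (lie_bracket A X Y x))) \<and>
     (\<forall>U X Y. openin M U \<longrightarrow> vector_field_on A U X \<longrightarrow> vector_field_on A U Y \<longrightarrow>
        (\<forall>x\<in>U. \<forall>\<xi>\<in>tangent_space A x.
           dirderiv A (\<lambda>y. g y (X y) (Y y)) x \<xi> = g x (nabla X x \<xi>) (Y x) + g x (X x) (nabla Y x \<xi>)))"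

text \<open>\<open>(\<L>\<^sub>v g)(X, Y) = v (g(X, Y)) - g([v, X], Y) - g(X, [v, Y])\<close>\<close>

definition lie_derivative_metric ::
  "('a, 'n::finite) chart set \<Rightarrow> ('a \<Rightarrow> ('a, 'n) tangent) \<Rightarrow>
    ('a \<Rightarrow> ('a, 'n) tangent \<Rightarrow> ('a, 'n) tangent \<Rightarrow> real) \<Rightarrow>
    ('a \<Rightarrow> ('a, 'n) tangent) \<Rightarrow> ('a \<Rightarrow> ('a, 'n) tangent) \<Rightarrow> 'a \<Rightarrow> real" where
  "lie_derivative_metric A v g X Y x =
     dirderiv A (\<lambda>y. g y (X y) (Y y)) x (v x)
       - g x (lie_bracket A v X x) (Y x) - g x (X x) (lie_bracket A v Y x)"

text \<open>\<open>v\<close> is a conformal vector field on \<open>(M, g)\<close>, with \<open>\<L>\<^sub>v g = \<phi> g\<close>.\<close>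

definition conformal_vector_field ::
  "'a topology \<Rightarrow> ('a, 'n::finite) chart set \<Rightarrow>
    ('a \<Rightarrow> ('a, 'n) tangent \<Rightarrow> ('a, 'n) tangent \<Rightarrow> real) \<Rightarrow>
    ('a \<Rightarrow> ('a, 'n) tangent) \<Rightarrow> ('a \<Rightarrow> real) \<Rightarrow> bool" where
  "conformal_vector_field M A g v \<phi> \<longleftrightarrow>
     vector_field_on A (topspace M) v \<and>
     (\<forall>U X Y. openin M U \<longrightarrow> vector_field_on A U X \<longrightarrow> vector_field_on A U Y \<longrightarrow>
        (\<forall>x\<in>U. lie_derivative_metric A v g X Y x = \<phi> x * g x (X x) (Y x)))"

definition divergence ::
  "('a, 'n::finite) chart set \<Rightarrow>
    (('a \<Rightarrow> ('a, 'n) tangent) \<Rightarrow> 'a \<Rightarrow> ('a, 'n) tangent \<Rightarrow> ('a, 'n) tangent) \<Rightarrow>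
    ('a \<Rightarrow> ('a, 'n) tangent) \<Rightarrow> 'a \<Rightarrow> real" where
  "divergence A nabla v x = endo_trace A x (nabla v x)"

definition zero_set :: "'a topology \<Rightarrow> ('a \<Rightarrow> ('a, 'n::finite) tangent) \<Rightarrow> 'a set" where
  "zero_set M v = {x \<in> topspace M. v x = tzero}"


section \<open>Independence of the chart\<close>

lemma smooth_on_imp_differentiable:
  "smooth_on f S \<Longrightarrow> x \<in> S \<Longrightarrow> f differentiable (at x)"
proof -
  assume "smooth_on f S" "x \<in> S"
  then have "Ck_on (Suc 0) f S"
    unfolding smooth_on_def by blast
  then show "f differentiable (at x)"
    using \<open>x \<in> S\<close> by simp
qed

lemma matrix_charpoly_similar:
  fixes J K B :: "real ^ 'n ^ 'n"
  assumes "J ** K = mat 1"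
  shows "matrix_charpoly (J ** B ** K) = matrix_charpoly B"
proof -
  define P where "P B = ((\<chi> i j. [:B $ i $ j:]) :: real poly ^ 'n ^ 'n)" for B :: "real ^ 'n ^ 'n"
  define X where "X = (mat [:0, 1:] :: real poly ^ 'n ^ 'n)"
  have cp: "matrix_charpoly B = det (X - P B)" for B :: "real ^ 'n ^ 'n"
  proof -
    have "((\<chi> i j. (if i = j then [:0, 1:] else 0) - [:B $ i $ j:]) :: real poly ^ 'n ^ 'n) = X - P B"
      unfolding vec_eq_iff mat_def X_def P_def by simp
    then show ?thesis
      by (simp only: matrix_charpoly_def)
  qed
  have sum_const: "(\<Sum>k\<in>S. [:h k:]) = [:sum h S:]" for S and h :: "'n \<Rightarrow> real"
    by (induction S rule: infinite_finite_induct) auto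
  have mult: "P (B ** C) = P B ** P C" for B C :: "real ^ 'n ^ 'n"
    by (simp add: P_def vec_eq_iff matrix_matrix_mult_def sum_const mult.commute)
  have one: "P (mat 1) = mat 1"
    by (simp add: P_def vec_eq_iff mat_def)
  have JK: "P J ** P K = mat 1"
    by (metis mult assms one)
  have scal: "Q ** X = X ** Q" for Q :: "real poly ^ 'n ^ 'n"
    unfolding X_def
    by (simp add: vec_eq_iff matrix_matrix_mult_def mat_def if_distrib if_distribR
        mult.commute cong: if_cong)
  have diff: "Q ** (R - S) = Q ** R - Q ** S" "(R - S) ** Q = R ** Q - S ** Q"
    for Q R S :: "real poly ^ 'n ^ 'n"
    by (simp_all add: vec_eq_iff matrix_matrix_mult_def algebra_simps sum_subtractf)
  have "P J ** X ** P K = X"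
    by (metis scal JK matrix_mul_assoc matrix_mul_rid)
  then have "X - P (J ** B ** K) = P J ** (X - P B) ** P K"
    by (simp only: mult diff)
  then have "det (X - P (J ** B ** K)) = det (P J) * det (X - P B) * det (P K)"
    by (simp only: det_mul)
  also have "\<dots> = det (X - P B) * (det (P J) * det (P K))"
    by (simp only: ac_simps)
  also have "det (P J) * det (P K) = 1"
    by (metis JK det_mul det_I)
  finally show ?thesis
    by (simp only: cp mult_1_right)
qed

context
  fixes M :: "'a topology" and A :: "('a, 'n::finite) chart set"
  assumes man: "smooth_manifold M A"
begin

lemma chart_props:
  assumes "c \<in> A"
  shows chart_openin: "openin M (cdom c)"
    and chart_open: "open (cmap c ` cdom c)"
    and chart_homeo:
      "homeomorphic_map (subtopology M (cdom c)) (top_of_set (cmap c ` cdom c)) (cmap c)"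
proof -
  have *: "\<forall>c\<in>A. openin M (cdom c) \<and> open (cmap c ` cdom c) \<and>
      homeomorphic_map (subtopology M (cdom c)) (top_of_set (cmap c ` cdom c)) (cmap c)"
    using man unfolding smooth_manifold_def by (elim conjE)
  show "openin M (cdom c)" "open (cmap c ` cdom c)"
    "homeomorphic_map (subtopology M (cdom c)) (top_of_set (cmap c ` cdom c)) (cmap c)"
    using bspec[OF * assms] by - (elim conjE, assumption)+
qed

lemma transition_smooth:
  assumes "c \<in> A" "d \<in> A"
  shows "smooth_on (transition c d) (cmap c ` (cdom c \<inter> cdom d))"
proof -
  have *: "\<forall>c\<in>A. \<forall>d\<in>A. smooth_on (transition c d) (cmap c ` (cdom c \<inter> cdom d))"
    using man unfolding smooth_manifold_def by (elim conjE)
  show ?thesis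
    by (rule bspec[OF bspec[OF * assms(1)] assms(2)])
qed

lemma chart_open_image:
  assumes "c \<in> A" "openin M W" "W \<subseteq> cdom c"
  shows "open (cmap c ` W)"
proof -
  have c: "openin M (cdom c)" "open (cmap c ` cdom c)"
    "homeomorphic_map (subtopology M (cdom c)) (top_of_set (cmap c ` cdom c)) (cmap c)"
    by (rule chart_props[OF assms(1)])+
  have "openin (subtopology M (cdom c)) W"
    using assms c(1) by (simp add: openin_open_subtopology)
  then have "openin (top_of_set (cmap c ` cdom c)) (cmap c ` W)"
    using homeomorphic_map_openness_eq[OF c(3)] by blast
  then show ?thesis
    using c(2) openin_open_trans by blast
qed

lemma cinv_cmap:
  assumes "c \<in> A" "x \<in> cdom c"
  shows "cinv c (cmap c x) = x"
proof -
  have c: "openin M (cdom c)"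
    "homeomorphic_map (subtopology M (cdom c)) (top_of_set (cmap c ` cdom c)) (cmap c)"
    by (rule chart_props[OF assms(1)])+
  have "inj_on (cmap c) (cdom c)"
    using homeomorphic_imp_injective_map[OF c(2)] openin_subset[OF c(1)]
    by (simp add: inf.absorb2)
  then show ?thesis
    unfolding cinv_def using assms(2) by simp
qed

lemma chart_at_props:
  assumes "c \<in> A" "x \<in> cdom c"
  shows "chart_at A x \<in> A" "x \<in> cdom (chart_at A x)"
  unfolding chart_at_def using someI[of "\<lambda>c. c \<in> A \<and> x \<in> cdom c" c] assms by auto

lemma transition_has_derivative:
  assumes "c \<in> A" "d \<in> A" "x \<in> cdom c" "x \<in> cdom d"
  shows "(transition c d has_derivative frechet_derivative (transition c d) (at (cmap c x)))
    (at (cmap c x))"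
  unfolding frechet_derivative_works[symmetric]
  by (rule smooth_on_imp_differentiable[OF transition_smooth[OF assms(1,2)]]) (use assms in simp)

lemma open_overlap:
  assumes "c \<in> A" "openin M U" "d \<in> A"
  shows "open (cmap c ` (U \<inter> cdom c \<inter> cdom d))"
proof (rule chart_open_image[OF assms(1)])
  have "openin M (cdom c)" "openin M (cdom d)"
    using assms by (simp_all add: chart_openin)
  then show "openin M (U \<inter> cdom c \<inter> cdom d)"
    using assms(2) by (simp add: openin_Int)
qed auto

lemma transition_derivative_compose:
  assumes "c \<in> A" "d \<in> A" "e \<in> A" "x \<in> cdom c" "x \<in> cdom d" "x \<in> cdom e"
  shows "frechet_derivative (transition d e) (at (cmap d x))
      (frechet_derivative (transition c d) (at (cmap c x)) u) =
    frechet_derivative (transition c e) (at (cmap c x)) u"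
proof -
  let ?S = "cmap c ` (cdom e \<inter> cdom c \<inter> cdom d)"
  have eM: "openin M (cdom e)"
    using assms by (simp add: chart_openin)
  have op: "open ?S"
    using open_overlap[OF assms(1) eM assms(2)] .
  have x: "cmap c x \<in> ?S"
    using assms by auto
  have tx: "transition c d (cmap c x) = cmap d x"
    using assms by (simp add: transition_def cinv_cmap)
  have "(transition d e \<circ> transition c d has_derivative
      frechet_derivative (transition d e) (at (cmap d x)) \<circ>
      frechet_derivative (transition c d) (at (cmap c x))) (at (cmap c x))"
    using diff_chain_at[OF transition_has_derivative[OF assms(1,2,4,5)]]
      transition_has_derivative[OF assms(2,3,5,6)]
    by (simp only: tx)
  moreover have "(transition d e \<circ> transition c d) p = transition c e p" if "p \<in> ?S" for p
    using that assms by (auto simp: transition_def cinv_cmap)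
  ultimately have "(transition c e has_derivative
      frechet_derivative (transition d e) (at (cmap d x)) \<circ>
      frechet_derivative (transition c d) (at (cmap c x))) (at (cmap c x))"
    by (rule has_derivative_transform_within_open[OF _ op x])
  from fun_cong[OF frechet_derivative_at[OF this]] show ?thesis
    by (simp only: comp_apply)
qed

lemma transition_derivative_self:
  assumes "c \<in> A" "x \<in> cdom c"
  shows "frechet_derivative (transition c c) (at (cmap c x)) u = u"
proof -
  have cM: "openin M (cdom c)"
    using assms by (simp add: chart_openin)
  have op: "open (cmap c ` (cdom c))"
    using open_overlap[OF assms(1) cM assms(1)] by simp
  have "(transition c c has_derivative (\<lambda>u. u)) (at (cmap c x))"
  proof (rule has_derivative_transform_within_open[OF _ op])
    show "((\<lambda>p. p) has_derivative (\<lambda>u. u)) (at (cmap c x))"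
      by (rule has_derivative_ident)
  qed (use assms in \<open>auto simp: transition_def cinv_cmap\<close>)
  from fun_cong[OF frechet_derivative_at[OF this]] show ?thesis
    by (rule sym)
qed

lemma tangent_space_transition:
  assumes "\<xi> \<in> tangent_space A x" "c \<in> A" "x \<in> cdom c" "d \<in> A" "x \<in> cdom d"
  shows "frechet_derivative (transition c d) (at (cmap c x)) (\<xi> c) = \<xi> d"
proof -
  have "\<forall>c\<in>A. \<forall>d\<in>A. x \<in> cdom c \<inter> cdom d \<longrightarrow>
      \<xi> d = frechet_derivative (transition c d) (at (cmap c x)) (\<xi> c)"
    using assms(1)[unfolded tangent_space_def mem_Collect_eq] by (rule conjunct1)
  then have "\<xi> d = frechet_derivative (transition c d) (at (cmap c x)) (\<xi> c)"
    using assms(2-5) by blast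
  then show ?thesis by (rule sym)
qed

lemma coord_vector_in_tangent_space:
  assumes "c \<in> A" "x \<in> cdom c"
  shows "coord_vector A c x u \<in> tangent_space A x"
  using assms by (auto simp: tangent_space_def coord_vector_def transition_derivative_compose)

lemma coord_vector_self:
  assumes "c \<in> A" "x \<in> cdom c"
  shows "coord_vector A c x u c = u"
  using assms by (simp add: coord_vector_def transition_derivative_self)

lemma coord_vector_component:
  assumes "c \<in> A" "x \<in> cdom c" "\<xi> \<in> tangent_space A x"
  shows "coord_vector A c x (\<xi> c) = \<xi>"
proof
  fix d
  show "coord_vector A c x (\<xi> c) d = \<xi> d"
  proof (cases "d \<in> A \<and> x \<in> cdom d")
    case True
    then show ?thesis
      using tangent_space_transition[OF assms(3,1,2)] by (simp add: coord_vector_def)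
  next
    case False
    have "\<forall>c. \<not> (c \<in> A \<and> x \<in> cdom c) \<longrightarrow> \<xi> c = 0"
      using assms(3)[unfolded tangent_space_def mem_Collect_eq] by (rule conjunct2)
    from spec[OF this, of d] False have "\<xi> d = 0"
      by (rule mp)
    then show ?thesis
      using False by (simp only: coord_vector_def if_False)
  qed
qed

lemma coord_vector_linear:
  assumes "c \<in> A" "x \<in> cdom c"
  shows "coord_vector A c x (u + w) = tadd (coord_vector A c x u) (coord_vector A c x w)"
    and "coord_vector A c x (r *\<^sub>R u) = tscale r (coord_vector A c x u)"
proof -
  have "linear (frechet_derivative (transition c d) (at (cmap c x)))"
    if "d \<in> A" "x \<in> cdom d" for d
    using transition_has_derivative[OF assms(1) that(1) assms(2) that(2)] has_derivative_linear
    by blast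
  then show "coord_vector A c x (u + w) = tadd (coord_vector A c x u) (coord_vector A c x w)"
    and "coord_vector A c x (r *\<^sub>R u) = tscale r (coord_vector A c x u)"
    by (auto simp: fun_eq_iff coord_vector_def tadd_def tscale_def linear_add linear_cmul)
qed

lemma endo_matrix_change:
  assumes F: "tangent_endomorphism A x F"
    and c: "c \<in> A" "x \<in> cdom c" and d: "d \<in> A" "x \<in> cdom d"
  obtains J K :: "real ^ 'n ^ 'n"
  where "J ** K = mat 1" "K ** J = mat 1" "endo_matrix A d x F = J ** endo_matrix A c x F ** K"
proof -
  let ?j = "frechet_derivative (transition c d) (at (cmap c x))"
  let ?k = "frechet_derivative (transition d c) (at (cmap d x))"
  let ?f = "\<lambda>u. F (coord_vector A c x u) c"
  let ?g = "\<lambda>u. F (coord_vector A d x u) d"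
  have lj: "linear ?j" and lk: "linear ?k"
    using transition_has_derivative[OF c(1) d(1) c(2) d(2)]
      transition_has_derivative[OF d(1) c(1) d(2) c(2)] has_derivative_linear by blast+
  have lf: "linear ?f"
  proof (rule linearI)
    fix u w r
    show "?f (u + w) = ?f u + ?f w"
      using F coord_vector_in_tangent_space[OF c]
      by (simp add: coord_vector_linear[OF c] tangent_endomorphism_def) (simp add: tadd_def)
    show "?f (r *\<^sub>R u) = r *\<^sub>R ?f u"
      using F coord_vector_in_tangent_space[OF c]
      by (simp add: coord_vector_linear[OF c] tangent_endomorphism_def) (simp add: tscale_def)
  qed
  have "?g u = ?j (?f (?k u))" for u
  proof -
    have "?k u = coord_vector A d x u c"
      using c by (simp add: coord_vector_def)
    then have "coord_vector A c x (?k u) = coord_vector A d x u"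
      using coord_vector_component[OF c coord_vector_in_tangent_space[OF d]] by simp
    moreover have "F (coord_vector A d x u) \<in> tangent_space A x"
      using F coord_vector_in_tangent_space[OF d] by (simp add: tangent_endomorphism_def)
    ultimately show ?thesis
      using tangent_space_transition[OF _ c d] by metis
  qed
  then have "?g = ?j \<circ> (?f \<circ> ?k)"
    by (simp add: fun_eq_iff)
  then have "endo_matrix A d x F = matrix ?j ** endo_matrix A c x F ** matrix ?k"
    unfolding endo_matrix_def
    using lj lk lf by (simp add: matrix_compose linear_compose matrix_mul_assoc)
  moreover have jk: "?j \<circ> ?k = id" "?k \<circ> ?j = id"
    using c d by (simp_all add: fun_eq_iff transition_derivative_compose transition_derivative_self)
  have "matrix ?j ** matrix ?k = mat 1" "matrix ?k ** matrix ?j = mat 1"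
    unfolding matrix_compose[OF lk lj, symmetric] matrix_compose[OF lj lk, symmetric] jk
    by (rule matrix_id_mat_1)+
  ultimately show ?thesis
    by (intro that)
qed

lemma endo_charpoly_chart:
  assumes "tangent_endomorphism A x F" "c \<in> A" "x \<in> cdom c"
  shows "endo_charpoly A x F = matrix_charpoly (endo_matrix A c x F)"
proof (rule endo_matrix_change[OF assms chart_at_props[OF assms(2,3)]])
  fix J K :: "real ^ 'n ^ 'n"
  assume JK: "J ** K = mat 1"
    and e: "endo_matrix A (chart_at A x) x F = J ** endo_matrix A c x F ** K"
  show ?thesis
    unfolding endo_charpoly_def e by (rule matrix_charpoly_similar[OF JK])
qed

lemma endo_trace_chart:
  assumes "tangent_endomorphism A x F" "c \<in> A" "x \<in> cdom c"
  shows "endo_trace A x F = trace (endo_matrix A c x F)"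
proof (rule endo_matrix_change[OF assms chart_at_props[OF assms(2,3)]])
  fix J K :: "real ^ 'n ^ 'n"
  let ?B = "endo_matrix A c x F"
  assume "J ** K = mat 1" and KJ: "K ** J = mat 1"
    and e: "endo_matrix A (chart_at A x) x F = J ** ?B ** K"
  have "trace (J ** ?B ** K) = trace (K ** (J ** ?B))"
    by (rule trace_mul_sym)
  also have "\<dots> = trace ?B"
    by (simp add: matrix_mul_assoc KJ)
  finally show ?thesis
    by (simp add: endo_trace_def e)
qed

lemma dirderiv_chart:
  assumes f: "smooth_function_on A U f" and U: "openin M U" "x \<in> U"
    and \<xi>: "\<xi> \<in> tangent_space A x" and c: "c \<in> A" "x \<in> cdom c"
  shows "dirderiv A f x \<xi> = frechet_derivative (f \<circ> cinv c) (at (cmap c x)) (\<xi> c)"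
proof -
  define d where "d = chart_at A x"
  have d: "d \<in> A" "x \<in> cdom d"
    unfolding d_def by (rule chart_at_props[OF c])+
  let ?S = "cmap d ` (U \<inter> cdom d \<inter> cdom c)"
  have op: "open ?S"
    using open_overlap[OF d(1) U(1) c(1)] .
  have x: "cmap d x \<in> ?S"
    using U(2) c(2) d(2) by blast
  have tx: "transition d c (cmap d x) = cmap c x"
    using c d by (simp add: transition_def cinv_cmap)
  have "smooth_on (f \<circ> cinv c) (cmap c ` (U \<inter> cdom c))"
    using f c(1) unfolding smooth_function_on_def by auto
  then have "(f \<circ> cinv c) differentiable (at (cmap c x))"
    by (rule smooth_on_imp_differentiable) (use U c in auto)
  then have "((f \<circ> cinv c) has_derivative frechet_derivative (f \<circ> cinv c) (at (cmap c x)))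
      (at (transition d c (cmap d x)))"
    by (simp add: tx frechet_derivative_works)
  then have "((f \<circ> cinv c) \<circ> transition d c has_derivative
      frechet_derivative (f \<circ> cinv c) (at (cmap c x)) \<circ>
      frechet_derivative (transition d c) (at (cmap d x))) (at (cmap d x))"
    by (rule diff_chain_at[OF transition_has_derivative[OF d(1) c(1) d(2) c(2)]])
  moreover have "((f \<circ> cinv c) \<circ> transition d c) p = (f \<circ> cinv d) p" if "p \<in> ?S" for p
    using that c d by (auto simp: transition_def cinv_cmap)
  ultimately have "(f \<circ> cinv d has_derivative
      frechet_derivative (f \<circ> cinv c) (at (cmap c x)) \<circ>
      frechet_derivative (transition d c) (at (cmap d x))) (at (cmap d x))"
    by (rule has_derivative_transform_within_open[OF _ op x])
  from fun_cong[OF frechet_derivative_at[OF this]] have "frechet_derivative (f \<circ> cinv d) (at (cmap d x)) (\<xi> d) =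
      frechet_derivative (f \<circ> cinv c) (at (cmap c x))
        (frechet_derivative (transition d c) (at (cmap d x)) (\<xi> d))"
    by (simp only: comp_apply)
  also have "frechet_derivative (transition d c) (at (cmap d x)) (\<xi> d) = \<xi> c"
    by (rule tangent_space_transition[OF \<xi> d c])
  finally show ?thesis
    by (simp only: dirderiv_def Let_def d_def)
qed

end

end

theory Submission
  imports Defs
begin

text \<open>
No regularity of the zero set \<open>Z\<close> is available: its components need not be manifolds, and a function whose
derivative vanishes in all directions tangent to a connected set need not be constant on it, unless it
is smooth enough.  The proof therefore shows that \<open>\<phi>\<close> and each coefficient of the characteristic
polynomial map \<open>Z\<close> to a set of real numbers of measure zero.  Being continuous, they map a connected
subset of \<open>Z\<close> to a connected set of measure zero, that is, to a point
(\<open>constant_on_component_of_negligible\<close>).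

Measure zero comes from a Sard theorem for a function \<open>F\<close> on an arbitrary subset \<open>E\<close> of \<open>\<real>\<^sup>n\<close>
(\<open>negligible_critical_values\<close>): it is enough that at each point of \<open>E\<close> the differential of \<open>F\<close>
vanishes on the common kernel of the differentials of all smooth functions that vanish on \<open>E\<close>.

The geometric input is the second derivative of \<open>v\<close> at a zero \<open>x\<close>.  Write \<open>A = \<nabla>v\<close>, so that
\<open>A + A\<^sup>* = \<phi>\<close>.  Where \<open>v = 0\<close>, the tensor \<open>\<nabla>\<^sub>u A w\<close> is symmetric in \<open>u\<close> and \<open>w\<close>, since the curvature
term contains \<open>v\<close>, and its symmetric part as an endomorphism is \<open>d\<phi> u / 2\<close>.  As in the Koszul
formula this determines it (\<open>covariant_second_derivative\<close>):
\<open>2 \<nabla>\<^sub>u A w = d\<phi>(u) w + d\<phi>(w) u - g(u, w) \<nabla>\<phi>\<close>.  For a vector \<open>u\<close> with \<open>A u = 0\<close>, taking the trace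
against the resolvent of \<open>A\<close> gives, for the characteristic polynomial \<open>X\<close> in the variable \<open>t\<close>,
\<open>2 t (t - \<phi>) dX(u) = - d\<phi>(u) (t (t - \<phi>) X' - \<phi> X)\<close>
(\<open>trace_resolvent_conformal\<close>, \<open>trace_resolvent_second_derivative\<close>).

In general \<open>d\<phi>(u)\<close> is not zero here: for the special conformal fields of a flat indefinite metric
there are points of \<open>Z\<close> where \<open>A = 0\<close> and \<open>d\<phi> \<noteq> 0\<close>.  The remedy is to cut \<open>Z\<close> into the strata on which
the multiplicity \<open>m\<close> of the root \<open>0\<close> of \<open>X\<close> is constant.  On such a stratum the \<open>m\<close> lowest coefficients
of \<open>X\<close> vanish in addition to \<open>v\<close>, so the Sard theorem only asks about directions \<open>u\<close> in which these
coefficients do not vary either.  For them the displayed identity, compared at the lowest relevant power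
of \<open>t\<close>, reads \<open>(m + 1) \<phi> d\<phi>(u) = 0\<close> if \<open>\<phi> \<noteq> 0\<close> and \<open>m d\<phi>(u) = 0\<close> if \<open>\<phi> = 0\<close>.  Hence
\<open>d\<phi>(u) = 0\<close>, and then \<open>dX(u) = 0\<close> (\<open>charpoly_variation_zero\<close>, \<open>dird_zero_on_stratum\<close>).
\<close>

section \<open>Calculus of smooth functions\<close>

abbreviation dird :: "('a::real_normed_vector \<Rightarrow> 'b::real_normed_vector) \<Rightarrow> 'a \<Rightarrow> 'a \<Rightarrow> 'b" where
  "dird f x u \<equiv> frechet_derivative f (at x) u"

lemma dird_eqI: "(f has_derivative f') (at x) \<Longrightarrow> dird f x u = f' u"
  by (drule frechet_derivative_at) (rule fun_cong[OF sym])

lemma dird_has_derivative: "f differentiable at x \<Longrightarrow> (f has_derivative dird f x) (at x)"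
  by (simp add: frechet_derivative_works)

lemma dird_linear: "f differentiable at x \<Longrightarrow> linear (dird f x)"
  by (rule has_derivative_linear[OF dird_has_derivative])

lemma dird_transform:
  assumes "open S" "x \<in> S" "\<And>y. y \<in> S \<Longrightarrow> f y = g y" "f differentiable at x"
  shows "g differentiable at x" "dird g x u = dird f x u"
proof -
  have "(g has_derivative dird f x) (at x)"
    using has_derivative_transform_within_open[OF dird_has_derivative[OF assms(4)] assms(1,2)] assms(3)
    by blast
  then show "g differentiable at x" "dird g x u = dird f x u"
    by (auto simp: differentiable_def dird_eqI)
qed

lemma Ck_on_Suc_imp: "Ck_on (Suc k) f S \<Longrightarrow> Ck_on k f S"
proof (induction k arbitrary: f)
  case 0
  then show ?case
    by (auto intro!: differentiable_imp_continuous_on differentiable_at_imp_differentiable_on)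
next
  case (Suc k)
  then show ?case
    by (metis Ck_on.simps(2))
qed

lemma Ck_on_cong:
  assumes "open S" "\<And>x. x \<in> S \<Longrightarrow> f x = g x" "Ck_on k f S"
  shows "Ck_on k g S"
  using assms(2,3)
proof (induction k arbitrary: f g)
  case 0
  then show ?case by (simp cong: continuous_on_cong)
next
  case (Suc k)
  have d: "f differentiable at x" if "x \<in> S" for x
    using Suc.prems(2) that by simp
  have "Ck_on k (\<lambda>x. dird g x h) S" for h
  proof (rule Suc.IH)
    show "Ck_on k (\<lambda>x. dird f x h) S" using Suc.prems(2) by simp
    show "dird f x h = dird g x h" if "x \<in> S" for x
      using dird_transform(2)[OF assms(1) that Suc.prems(1) d[OF that]] by simp
  qed
  moreover have "g differentiable at x" if "x \<in> S" for x
    by (rule dird_transform(1)[OF assms(1) that Suc.prems(1) d[OF that]])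
  ultimately show ?case by simp
qed

lemma Ck_on_subset: "Ck_on k f S \<Longrightarrow> T \<subseteq> S \<Longrightarrow> Ck_on k f T"
  by (induction k arbitrary: f) (auto intro: continuous_on_subset)

lemma Ck_on_const: "Ck_on k (\<lambda>x. c) S"
  by (induction k arbitrary: c) (auto simp: frechet_derivative_const)

lemma Ck_on_linear:
  assumes "bounded_linear f" shows "Ck_on k f S"
proof (cases k)
  case 0
  then show ?thesis
    using assms by (simp add: linear_continuous_on)
next
  case (Suc k)
  have "(\<lambda>x. dird f x h) = (\<lambda>x. f h)" for h
    using bounded_linear_imp_has_derivative[OF assms] by (auto simp: dird_eqI)
  then show ?thesis
    using assms by (simp add: Suc Ck_on_const bounded_linear_imp_differentiable)
qed

lemma Ck_on_bounded_linear_compose: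
  assumes "open S" "bounded_linear l" "Ck_on k f S" shows "Ck_on k (\<lambda>x. l (f x)) S"
  using assms(3)
proof (induction k arbitrary: f)
  case 0
  then show ?case using assms(2)
    by (simp add: bounded_linear.continuous_on)
next
  case (Suc k)
  have d: "f differentiable at x" if "x \<in> S" for x
    using Suc.prems that by simp
  have D: "((\<lambda>x. l (f x)) has_derivative (\<lambda>h. l (dird f x h))) (at x)" if "x \<in> S" for x
    using bounded_linear.has_derivative[OF assms(2) dird_has_derivative[OF d[OF that]]] .
  have "Ck_on k (\<lambda>x. dird (\<lambda>x. l (f x)) x h) S" for h
    by (rule Ck_on_cong[OF assms(1) _ Suc.IH[of "\<lambda>x. dird f x h"]])
      (use Suc.prems in \<open>auto simp: dird_eqI[OF D]\<close>)
  then show ?case using D by (auto simp: differentiable_def)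
qed

lemma Ck_on_add:
  assumes "open S" "Ck_on k f S" "Ck_on k g S" shows "Ck_on k (\<lambda>x. f x + g x) S"
  using assms(2,3)
proof (induction k arbitrary: f g)
  case 0
  then show ?case by (simp add: continuous_on_add)
next
  case (Suc k)
  have D: "((\<lambda>x. f x + g x) has_derivative (\<lambda>h. dird f x h + dird g x h)) (at x)" if "x \<in> S" for x
    by (rule has_derivative_add) (use Suc.prems that in \<open>auto intro: dird_has_derivative\<close>)
  have "Ck_on k (\<lambda>x. dird (\<lambda>x. f x + g x) x h) S" for h
    by (rule Ck_on_cong[OF assms(1) _ Suc.IH[of "\<lambda>x. dird f x h" "\<lambda>x. dird g x h"]])
      (use Suc.prems in \<open>auto simp: dird_eqI[OF D]\<close>)
  then show ?case using D by (auto simp: differentiable_def)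
qed

lemma Ck_on_mult:
  fixes f g :: "'a::euclidean_space \<Rightarrow> real"
  assumes "open S" "Ck_on k f S" "Ck_on k g S" shows "Ck_on k (\<lambda>x. f x * g x) S"
  using assms(2,3)
proof (induction k arbitrary: f g)
  case 0
  then show ?case by (simp add: continuous_on_mult)
next
  case (Suc k)
  have D: "((\<lambda>x. f x * g x) has_derivative (\<lambda>h. f x * dird g x h + dird f x h * g x)) (at x)"
    if "x \<in> S" for x
    by (rule has_derivative_mult) (use Suc.prems that in \<open>auto intro: dird_has_derivative\<close>)
  have "Ck_on k (\<lambda>x. dird (\<lambda>x. f x * g x) x h) S" for h
  proof (rule Ck_on_cong[OF assms(1)])
    show "Ck_on k (\<lambda>x. f x * dird g x h + dird f x h * g x) S"
      by (rule Ck_on_add[OF assms(1) Suc.IH Suc.IH])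
        (use Suc.prems in \<open>auto dest: Ck_on_Suc_imp simp del: Ck_on.simps\<close>, (simp)+)
  qed (simp add: dird_eqI[OF D])
  then show ?case using D by (auto simp: differentiable_def)
qed

lemma Ck_on_inverse:
  fixes f :: "'a::euclidean_space \<Rightarrow> real"
  assumes "open S" "Ck_on k f S" "\<And>x. x \<in> S \<Longrightarrow> f x \<noteq> 0" shows "Ck_on k (\<lambda>x. inverse (f x)) S"
  using assms(2)
proof (induction k)
  case 0
  then show ?case using assms by (simp add: continuous_on_inverse)
next
  case (Suc k)
  note IH = Suc.IH[OF Ck_on_Suc_imp[OF Suc.prems]]
  have D: "((\<lambda>x. inverse (f x)) has_derivative (\<lambda>h. - (inverse (f x) * dird f x h * inverse (f x)))) (at x)"
    if "x \<in> S" for x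
    by (rule Deriv.has_derivative_inverse) (use Suc.prems assms that in \<open>auto intro: dird_has_derivative\<close>)
  have "Ck_on k (\<lambda>x. dird (\<lambda>x. inverse (f x)) x h) S" for h
  proof (rule Ck_on_cong[OF assms(1)])
    show "Ck_on k (\<lambda>x. - (inverse (f x) * dird f x h * inverse (f x))) S"
      by (rule Ck_on_bounded_linear_compose[OF assms(1)])
       (use Suc.prems IH in \<open>auto intro!: Ck_on_mult[OF assms(1)] bounded_linear_minus bounded_linear_ident\<close>)
  qed (simp add: dird_eqI[OF D])
  then show ?case using D by (auto simp: differentiable_def)
qed

lemma Ck_on_sum:
  assumes "open S" "\<And>i. i \<in> I \<Longrightarrow> Ck_on k (f i) S"
  shows "Ck_on k (\<lambda>x. \<Sum>i\<in>I. f i x) S"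
  using assms(2)
  by (induction I rule: infinite_finite_induct) (auto intro: Ck_on_const Ck_on_add[OF assms(1)])

lemma Ck_on_components:
  fixes f :: "'a::euclidean_space \<Rightarrow> real ^ 'n"
  assumes "open S"
  shows "Ck_on k f S \<longleftrightarrow> (\<forall>i. Ck_on k (\<lambda>x. f x $ i) S)"
proof
  assume "Ck_on k f S"
  then show "\<forall>i. Ck_on k (\<lambda>x. f x $ i) S"
    using Ck_on_bounded_linear_compose[OF assms bounded_linear_vec_nth] by blast
next
  assume *: "\<forall>i. Ck_on k (\<lambda>x. f x $ i) S"
  have "Ck_on k (\<lambda>x. \<Sum>i\<in>UNIV. f x $ i *\<^sub>R axis i (1::real)) S"
    by (intro Ck_on_sum Ck_on_bounded_linear_compose[OF assms bounded_linear_scaleR_left] assms)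
      (use * in simp)
  moreover have "(\<Sum>i\<in>UNIV. f x $ i *\<^sub>R axis i (1::real)) = f x" for x
    by (simp add: vec_eq_iff axis_def if_distrib cong: if_cong)
  ultimately show "Ck_on k f S" by simp
qed

lemma vec_axis_sum: "u = (\<Sum>i\<in>UNIV. u $ i *\<^sub>R axis i (1::real))"
  by (simp add: vec_eq_iff axis_def if_distrib cong: if_cong)

lemma dird_axis_sum:
  assumes "f differentiable at x"
  shows "dird f x u = (\<Sum>i\<in>UNIV. u $ i *\<^sub>R dird f x (axis i 1))"
proof -
  have "dird f x (\<Sum>i\<in>UNIV. u $ i *\<^sub>R axis i 1) = (\<Sum>i\<in>UNIV. u $ i *\<^sub>R dird f x (axis i 1))"
    using dird_linear[OF assms] by (simp add: linear_sum linear_scale)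
  then show ?thesis
    using vec_axis_sum[of u] by simp
qed

lemma Ck_on_compose:
  fixes f :: "real ^ 'n \<Rightarrow> real" and g :: "'a::euclidean_space \<Rightarrow> real ^ 'n"
  assumes "open S" "Ck_on k g S" "Ck_on k f T" "g ` S \<subseteq> T"
  shows "Ck_on k (\<lambda>x. f (g x)) S"
  using assms(2,3)
proof (induction k arbitrary: f)
  case 0
  then show ?case
    using assms by (auto intro: continuous_on_compose2)
next
  case (Suc k)
  have df: "f differentiable at (g x)" if "x \<in> S" for x
    using Suc.prems assms(4) that by auto
  have dg: "g differentiable at x" if "x \<in> S" for x
    using Suc.prems that by auto
  have D: "((\<lambda>x. f (g x)) has_derivative (\<lambda>h. dird f (g x) (dird g x h))) (at x)" if "x \<in> S" for x
    using diff_chain_at[OF dird_has_derivative[OF dg[OF that]] dird_has_derivative[OF df[OF that]]]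
    by (simp add: o_def)
  have "Ck_on k (\<lambda>x. dird (\<lambda>x. f (g x)) x h) S" for h
  proof (rule Ck_on_cong[OF assms(1)])
    show "Ck_on k (\<lambda>x. \<Sum>i\<in>UNIV. dird g x h $ i * dird f (g x) (axis i 1)) S"
    proof (intro Ck_on_sum Ck_on_mult assms)
      show "Ck_on k (\<lambda>x. dird g x h $ i) S" for i
        using Suc.prems(1) Ck_on_components[OF assms(1), of k "\<lambda>x. dird g x h"] by simp
      show "Ck_on k (\<lambda>x. dird f (g x) (axis i 1)) S" for i
        using Suc.IH[OF Ck_on_Suc_imp[OF Suc.prems(1)], of "\<lambda>y. dird f y (axis i 1)"] Suc.prems(2)
        by simp
    qed
    show "(\<Sum>i\<in>UNIV. dird g x h $ i * dird f (g x) (axis i 1)) = dird (\<lambda>x. f (g x)) x h"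
      if "x \<in> S" for x
      using dird_eqI[OF D[OF that]] dird_axis_sum[OF df[OF that], of "dird g x h"] by simp
  qed
  then show ?case using D by (auto simp: differentiable_def)
qed

lemma smooth_on_subset: "smooth_on f S \<Longrightarrow> T \<subseteq> S \<Longrightarrow> smooth_on f T"
  unfolding smooth_on_def using Ck_on_subset by blast

lemma smooth_on_cong:
  "open S \<Longrightarrow> smooth_on f S \<Longrightarrow> (\<And>x. x \<in> S \<Longrightarrow> f x = g x) \<Longrightarrow> smooth_on g S"
  unfolding smooth_on_def using Ck_on_cong by blast

lemma smooth_on_const: "smooth_on (\<lambda>x. c) S"
  by (simp add: smooth_on_def Ck_on_const)

lemma smooth_on_linear: "bounded_linear f \<Longrightarrow> smooth_on f S"
  by (simp add: smooth_on_def Ck_on_linear)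

lemma smooth_on_add:
  "open S \<Longrightarrow> smooth_on f S \<Longrightarrow> smooth_on g S \<Longrightarrow> smooth_on (\<lambda>x. f x + g x) S"
  by (simp add: smooth_on_def Ck_on_add)

lemma smooth_on_mult:
  fixes f g :: "'a::euclidean_space \<Rightarrow> real"
  shows "open S \<Longrightarrow> smooth_on f S \<Longrightarrow> smooth_on g S \<Longrightarrow> smooth_on (\<lambda>x. f x * g x) S"
  by (simp add: smooth_on_def Ck_on_mult)

lemma smooth_on_inverse:
  fixes f :: "'a::euclidean_space \<Rightarrow> real"
  shows "open S \<Longrightarrow> smooth_on f S \<Longrightarrow> (\<And>x. x \<in> S \<Longrightarrow> f x \<noteq> 0) \<Longrightarrow> smooth_on (\<lambda>x. inverse (f x)) S"
  by (simp add: smooth_on_def Ck_on_inverse)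

lemma smooth_on_divide:
  fixes f :: "'a::euclidean_space \<Rightarrow> real"
  shows "open S \<Longrightarrow> smooth_on f S \<Longrightarrow> smooth_on g S \<Longrightarrow> (\<And>x. x \<in> S \<Longrightarrow> g x \<noteq> 0) \<Longrightarrow>
    smooth_on (\<lambda>x. f x / g x) S"
  unfolding divide_inverse by (intro smooth_on_mult smooth_on_inverse)

lemma smooth_on_sum:
  "open S \<Longrightarrow> (\<And>i. i \<in> I \<Longrightarrow> smooth_on (f i) S) \<Longrightarrow> smooth_on (\<lambda>x. \<Sum>i\<in>I. f i x) S"
  by (simp add: smooth_on_def Ck_on_sum)

lemma smooth_on_prod:
  fixes f :: "'i \<Rightarrow> 'a::euclidean_space \<Rightarrow> real"
  shows "open S \<Longrightarrow> (\<And>i. i \<in> I \<Longrightarrow> smooth_on (f i) S) \<Longrightarrow> smooth_on (\<lambda>x. \<Prod>i\<in>I. f i x) S"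
  by (induction I rule: infinite_finite_induct) (auto intro: smooth_on_const smooth_on_mult)

lemma smooth_on_components:
  fixes f :: "'a::euclidean_space \<Rightarrow> real ^ 'n"
  shows "open S \<Longrightarrow> smooth_on f S \<longleftrightarrow> (\<forall>i. smooth_on (\<lambda>x. f x $ i) S)"
  unfolding smooth_on_def using Ck_on_components by blast

lemma smooth_on_compose:
  fixes f :: "real ^ 'n \<Rightarrow> real" and g :: "'a::euclidean_space \<Rightarrow> real ^ 'n"
  shows "open S \<Longrightarrow> smooth_on g S \<Longrightarrow> smooth_on f T \<Longrightarrow> g ` S \<subseteq> T \<Longrightarrow> smooth_on (\<lambda>x. f (g x)) S"
  unfolding smooth_on_def using Ck_on_compose by blast

lemma smooth_on_dird: "smooth_on f S \<Longrightarrow> smooth_on (\<lambda>x. dird f x u) S"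
  unfolding smooth_on_def by (metis Ck_on.simps(2))

lemma smooth_on_continuous_on: "smooth_on f S \<Longrightarrow> continuous_on S f"
  unfolding smooth_on_def by (metis Ck_on.simps(1))

lemma smooth_on_det:
  fixes B :: "'a::euclidean_space \<Rightarrow> real ^ 'n ^ 'n"
  assumes "open S" "\<And>i j. smooth_on (\<lambda>x. B x $ i $ j) S"
  shows "smooth_on (\<lambda>x. det (B x)) S"
  unfolding det_def by (intro smooth_on_sum smooth_on_mult smooth_on_prod smooth_on_const assms)

lemma smooth_on_dird_field:
  fixes f :: "real ^ 'n \<Rightarrow> real" and X :: "real ^ 'n \<Rightarrow> real ^ 'n"
  assumes "open S" "smooth_on f S" "\<And>i. smooth_on (\<lambda>x. X x $ i) S"
  shows "smooth_on (\<lambda>x. dird f x (X x)) S"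
proof (rule smooth_on_cong[OF assms(1)])
  show "smooth_on (\<lambda>x. \<Sum>i\<in>UNIV. X x $ i * dird f x (axis i 1)) S"
    by (intro smooth_on_sum smooth_on_mult smooth_on_dird assms)
  show "(\<Sum>i\<in>UNIV. X x $ i * dird f x (axis i 1)) = dird f x (X x)" if "x \<in> S" for x
    using dird_axis_sum[OF smooth_on_imp_differentiable[OF assms(2) that], of "X x"] by simp
qed

lemma has_real_derivative_along_line:
  fixes f :: "'a::real_normed_vector \<Rightarrow> real"
  assumes "f differentiable at (x + t *\<^sub>R u)"
  shows "((\<lambda>s. f (x + s *\<^sub>R u)) has_real_derivative dird f (x + t *\<^sub>R u) u) (at t)"
proof -
  have "((\<lambda>s. x + s *\<^sub>R u) has_derivative (\<lambda>h. h *\<^sub>R u)) (at t)"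
    by (auto intro!: derivative_eq_intros)
  from diff_chain_at[OF this dird_has_derivative[OF assms]]
  have "((\<lambda>s. f (x + s *\<^sub>R u)) has_derivative (\<lambda>h. dird f (x + t *\<^sub>R u) (h *\<^sub>R u))) (at t)"
    by (simp add: o_def)
  then show ?thesis
    unfolding has_field_derivative_def using dird_linear[OF assms]
    by (simp add: linear_scale mult.commute[of _ "dird f (x + t *\<^sub>R u) u"] )
qed

text \<open>The mixed second difference of \<open>f\<close> in the directions \<open>u\<close> and \<open>w\<close> is symmetric in \<open>u\<close> and
  \<open>w\<close>; applying the mean value theorem in either order turns it into a mixed second derivative at
  a nearby point.\<close>

lemma mixed_difference:
  fixes f :: "'a::euclidean_space \<Rightarrow> real"
  assumes sm: "smooth_on f (ball x e)" and small: "\<And>s t. \<bar>s\<bar> \<le> a \<Longrightarrow> \<bar>t\<bar> \<le> a \<Longrightarrow> x + s *\<^sub>R u + t *\<^sub>R w \<in> ball x e"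
    and a: "a > 0"
  obtains s t where "\<bar>s\<bar> \<le> a" "\<bar>t\<bar> \<le> a"
    "f (x + a *\<^sub>R u + a *\<^sub>R w) - f (x + a *\<^sub>R u) - f (x + a *\<^sub>R w) + f x
      = a * a * dird (\<lambda>y. dird f y u) (x + s *\<^sub>R u + t *\<^sub>R w) w"
proof -
  have df: "f differentiable at y" if "y \<in> ball x e" for y
    by (rule smooth_on_imp_differentiable[OF sm that])
  have dg: "(\<lambda>y. dird f y u) differentiable at y" if "y \<in> ball x e" for y
    by (rule smooth_on_imp_differentiable[OF smooth_on_dird[OF sm] that])
  have "\<exists>s. 0 < s \<and> s < a \<and>
    (f (x + a *\<^sub>R w + a *\<^sub>R u) - f (x + a *\<^sub>R u)) - (f (x + a *\<^sub>R w + 0 *\<^sub>R u) - f (x + 0 *\<^sub>R u)) = (a - 0) * (dird f (x + a *\<^sub>R w + s *\<^sub>R u) u - dird f (x + s *\<^sub>R u) u)"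
  proof (rule MVT2[OF a])
    fix s assume "0 \<le> s" "s \<le> a"
    then have "x + a *\<^sub>R w + s *\<^sub>R u \<in> ball x e" "x + s *\<^sub>R u \<in> ball x e"
      using small[of s a] small[of s 0] a by (simp_all add: algebra_simps)
    then show "((\<lambda>s. f (x + a *\<^sub>R w + s *\<^sub>R u) - f (x + s *\<^sub>R u)) has_real_derivative
        dird f (x + a *\<^sub>R w + s *\<^sub>R u) u - dird f (x + s *\<^sub>R u) u) (at s)"
      by (intro DERIV_diff has_real_derivative_along_line df)
  qed
  then obtain s where s: "0 < s" "s < a" and 1: "f (x + a *\<^sub>R u + a *\<^sub>R w) - f (x + a *\<^sub>R u) - f (x + a *\<^sub>R w) + f x
      = a * (dird f (x + s *\<^sub>R u + a *\<^sub>R w) u - dird f (x + s *\<^sub>R u) u)"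
    by (auto simp: algebra_simps)
  have "\<exists>t. 0 < t \<and> t < a \<and>
     dird f (x + s *\<^sub>R u + a *\<^sub>R w) u - dird f (x + s *\<^sub>R u + 0 *\<^sub>R w) u =
       (a - 0) * dird (\<lambda>y. dird f y u) (x + s *\<^sub>R u + t *\<^sub>R w) w"
  proof (rule MVT2[OF a])
    fix t assume "0 \<le> t" "t \<le> a"
    then have "x + s *\<^sub>R u + t *\<^sub>R w \<in> ball x e"
      using small[of s t] s by simp
    then show "((\<lambda>t. dird f (x + s *\<^sub>R u + t *\<^sub>R w) u) has_real_derivative
        dird (\<lambda>y. dird f y u) (x + s *\<^sub>R u + t *\<^sub>R w) w) (at t)"
      by (intro has_real_derivative_along_line dg)
  qed
  then obtain t where t: "0 < t" "t < a" "dird f (x + s *\<^sub>R u + a *\<^sub>R w) u - dird f (x + s *\<^sub>R u) u =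
       a * dird (\<lambda>y. dird f y u) (x + s *\<^sub>R u + t *\<^sub>R w) w"
    by auto
  show thesis
    by (rule that[of s t]) (use s t 1 in auto)
qed

lemma symmetric_second_dird:
  fixes f :: "'a::euclidean_space \<Rightarrow> real"
  assumes S: "open S" "x \<in> S" and sm: "smooth_on f S"
  shows "dird (\<lambda>y. dird f y u) x w = dird (\<lambda>y. dird f y w) x u"
proof (rule ccontr)
  define P where "P = (\<lambda>y. dird (\<lambda>y. dird f y u) y w)"
  define Q where "Q = (\<lambda>y. dird (\<lambda>y. dird f y w) y u)"
  assume "\<not> ?thesis"
  then have ne: "\<bar>P x - Q x\<bar> > 0"
    by (simp add: P_def Q_def)
  have cont: "continuous_on S P" "continuous_on S Q"
    unfolding P_def Q_def by (intro smooth_on_continuous_on smooth_on_dird sm)+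
  then have "isCont P x" "isCont Q x"
    using S continuous_on_eq_continuous_at by blast+
  then obtain d1 d2 where d: "d1 > 0" "\<And>y. dist y x < d1 \<Longrightarrow> dist (P y) (P x) < \<bar>P x - Q x\<bar> / 2"
    "d2 > 0" "\<And>y. dist y x < d2 \<Longrightarrow> dist (Q y) (Q x) < \<bar>P x - Q x\<bar> / 2"
    unfolding continuous_at_eps_delta using ne half_gt_zero by (metis dist_norm)
  obtain e0 where e0: "e0 > 0" "ball x e0 \<subseteq> S"
    using S open_contains_ball by blast
  define e where "e = min e0 (min d1 d2)"
  have e: "e > 0" "ball x e \<subseteq> S" "e \<le> d1" "e \<le> d2"
    using d e0 by (auto simp: e_def)
  define a where "a = e / (2 * (1 + norm u + norm w))"
  have pos: "1 + norm u + norm w > 0"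
    by (smt (verit) norm_ge_zero)
  then have a: "a > 0"
    using e by (simp add: a_def)
  have small: "x + s *\<^sub>R u + t *\<^sub>R w \<in> ball x e" if "\<bar>s\<bar> \<le> a" "\<bar>t\<bar> \<le> a" for s t
  proof -
    have "norm (s *\<^sub>R u + t *\<^sub>R w) \<le> a * norm u + a * norm w"
      using norm_triangle_ineq[of "s *\<^sub>R u" "t *\<^sub>R w"] that
      by (smt (verit) mult_right_mono norm_ge_zero norm_scaleR)
    also have "\<dots> \<le> a * (1 + norm u + norm w)"
      using a by (simp add: algebra_simps)
    also have "\<dots> = e / 2"
      using pos unfolding a_def by (simp add: field_simps)
    also have "\<dots> < e" using e by simp
    finally have "dist (x + (s *\<^sub>R u + t *\<^sub>R w)) x < e"
      by (simp only: dist_norm add_diff_cancel_left')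
    then show ?thesis
      by (simp only: mem_ball dist_commute add.assoc)
  qed
  have sm': "smooth_on f (ball x e)"
    by (rule smooth_on_subset[OF sm e(2)])
  obtain s t where st: "\<bar>s\<bar> \<le> a" "\<bar>t\<bar> \<le> a"
    "f (x + a *\<^sub>R u + a *\<^sub>R w) - f (x + a *\<^sub>R u) - f (x + a *\<^sub>R w) + f x = a * a * P (x + s *\<^sub>R u + t *\<^sub>R w)"
    unfolding P_def by (rule mixed_difference[OF sm' small a])
  have small': "x + s *\<^sub>R w + t *\<^sub>R u \<in> ball x e" if "\<bar>s\<bar> \<le> a" "\<bar>t\<bar> \<le> a" for s t
    using small[OF that(2,1)] by (simp add: algebra_simps)
  obtain s' t' where st': "\<bar>s'\<bar> \<le> a" "\<bar>t'\<bar> \<le> a"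
    "f (x + a *\<^sub>R w + a *\<^sub>R u) - f (x + a *\<^sub>R w) - f (x + a *\<^sub>R u) + f x = a * a * Q (x + s' *\<^sub>R w + t' *\<^sub>R u)"
    unfolding Q_def by (rule mixed_difference[OF sm' small' a])
  have "a * a * P (x + s *\<^sub>R u + t *\<^sub>R w) = a * a * Q (x + s' *\<^sub>R w + t' *\<^sub>R u)"
    using st(3) st'(3) by (simp add: algebra_simps)
  then have "P (x + s *\<^sub>R u + t *\<^sub>R w) = Q (x + s' *\<^sub>R w + t' *\<^sub>R u)"
    using a by simp
  moreover have "dist (P (x + s *\<^sub>R u + t *\<^sub>R w)) (P x) < \<bar>P x - Q x\<bar> / 2"
    using small[OF st(1,2)] e by (intro d) (simp add: dist_commute)
  moreover have "dist (Q (x + s' *\<^sub>R w + t' *\<^sub>R u)) (Q x) < \<bar>P x - Q x\<bar> / 2"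
    using small'[OF st'(1,2)] e by (intro d) (simp add: dist_commute)
  ultimately show False
    by (simp add: dist_real_def) (smt (verit) field_sum_of_halves)
qed


section \<open>A Sard theorem for functions restricted to zero sets\<close>

lemma negligible_image_locally:
  fixes F :: "'a::euclidean_space \<Rightarrow> real"
  assumes "\<And>x. x \<in> E \<Longrightarrow> \<exists>W. open W \<and> x \<in> W \<and> negligible (F ` (E \<inter> W))"
  shows "negligible (F ` E)"
proof -
  obtain W where W: "\<And>x. x \<in> E \<Longrightarrow> open (W x) \<and> x \<in> W x \<and> negligible (F ` (E \<inter> W x))"
    using assms by metis
  obtain \<F> where \<F>: "\<F> \<subseteq> W ` E" "countable \<F>" "\<Union>\<F> = \<Union>(W ` E)"
    by (rule Lindelof[of "W ` E"]) (use W in auto)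
  have "F ` E \<subseteq> (\<Union>V\<in>\<F>. F ` (E \<inter> V))"
    using \<F>(3) W by fastforce
  moreover have "negligible (\<Union>V\<in>\<F>. F ` (E \<inter> V))"
    by (rule negligible_countable_Union) (use \<F> W in \<open>auto\<close>)
  ultimately show ?thesis
    using negligible_subset by blast
qed

text \<open>Cut a cube containing the coordinates into \<open>N\<^sup>n\<close> small cubes: the image of each has
  length of the order of \<open>N\<close> to the power \<open>- (n + 1)\<close>, so all of them together have length of
  the order of \<open>1 / N\<close>.\<close>

lemma negligible_image_Hoelder:
  fixes a :: "'x \<Rightarrow> real ^ 'n::finite" and F :: "'x \<Rightarrow> real"
  assumes bdd: "bounded (a ` E)"
    and F: "\<And>x y. x \<in> E \<Longrightarrow> y \<in> E \<Longrightarrow> \<bar>F x - F y\<bar> \<le> C * norm (a x - a y) ^ Suc CARD('n)"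
  shows "negligible (F ` E)"
proof (cases "E = {}")
  case False
  let ?n = "CARD('n)"
  define D where "D = max C 1"
  have D: "D > 0" "\<And>x y. x \<in> E \<Longrightarrow> y \<in> E \<Longrightarrow> \<bar>F x - F y\<bar> \<le> D * norm (a x - a y) ^ Suc ?n"
  proof -
    show "\<bar>F x - F y\<bar> \<le> D * norm (a x - a y) ^ Suc ?n" if "x \<in> E" "y \<in> E" for x y
    proof -
      have "C * norm (a x - a y) ^ Suc ?n \<le> D * norm (a x - a y) ^ Suc ?n"
        unfolding D_def by (intro mult_right_mono) auto
      then show ?thesis using F[OF that] by linarith
    qed
  qed (simp add: D_def)
  obtain R where R: "\<And>x. x \<in> E \<Longrightarrow> norm (a x) \<le> R"
    using bdd by (auto simp: bounded_iff)
  obtain K :: nat where K: "real K > R" using reals_Archimedean2 by blast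
  have K0: "K > 0"
    using K R False norm_ge_zero by (metis all_not_in_conv gr0I of_nat_0 order_le_less_trans order_less_irrefl order_trans)
  have aK: "\<bar>a x $ i\<bar> < real K" if "x \<in> E" for x i
    using R[OF that] K component_le_norm_cart[of "a x" i] by linarith
  show ?thesis
  proof (subst negligible_outer_le, intro allI impI)
    fix e :: real assume e: "e > 0"
    define B where "B = (2 * real K) ^ ?n * (2 * (D * real ?n ^ Suc ?n))"
    obtain N :: nat where N: "real N > B / e" "N > 0"
      using reals_Archimedean2[of "max (B / e) 1"] by (metis max_less_iff_conj of_nat_0_less_iff less_trans zero_less_one)
    define \<delta> where "\<delta> = D * (real ?n / real N) ^ Suc ?n"
    have \<delta>: "\<delta> \<ge> 0" using D by (simp add: \<delta>_def)
    define G where "G = (PiE UNIV (\<lambda>_. {- int (K * N)..<int (K * N)}) :: ('n \<Rightarrow> int) set)"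
    have finG: "finite G" unfolding G_def by (intro finite_PiE) auto
    have cardG: "real (card G) = (2 * real K * real N) ^ ?n"
      unfolding G_def by (simp add: card_PiE power_mult_distrib)
    define idx where "idx x = (\<lambda>i. \<lfloor>a x $ i * real N\<rfloor>)" for x
    have idxG: "idx x \<in> G" if "x \<in> E" for x
    proof -
      have "- int (K * N) \<le> \<lfloor>a x $ i * real N\<rfloor>" "\<lfloor>a x $ i * real N\<rfloor> < int (K * N)" for i
      proof -
        have "\<bar>a x $ i * real N\<bar> < real (K * N)"
          using aK[OF that, of i] N by (simp add: abs_mult)
        then show "- int (K * N) \<le> \<lfloor>a x $ i * real N\<rfloor>" "\<lfloor>a x $ i * real N\<rfloor> < int (K * N)"
          by (simp_all add: le_floor_iff floor_less_iff abs_less_iff)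
      qed
      then show ?thesis by (auto simp: G_def idx_def)
    qed
    define T where "T k = (let b = F (SOME x. x \<in> E \<and> idx x = k) in {b - \<delta>..b + \<delta>})" for k
    have Tm: "T k \<in> lmeasurable" "measure lebesgue (T k) = 2 * \<delta>" for k
      using \<delta> by (auto simp: T_def Let_def)
    have cover: "F ` E \<subseteq> (\<Union>k\<in>G. T k)"
    proof
      fix t assume "t \<in> F ` E"
      then obtain x where x: "x \<in> E" "t = F x" by blast
      define y where "y = (SOME y. y \<in> E \<and> idx y = idx x)"
      have y: "y \<in> E" "idx y = idx x"
        using someI[of "\<lambda>y. y \<in> E \<and> idx y = idx x" x] x by (auto simp: y_def)
      have "\<bar>(a x - a y) $ i\<bar> \<le> 1 / real N" for i
      proof -
        have "\<lfloor>a y $ i * real N\<rfloor> = \<lfloor>a x $ i * real N\<rfloor>"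
          using y(2) by (simp add: idx_def fun_eq_iff)
        then have "\<bar>a x $ i * real N - a y $ i * real N\<bar> \<le> 1" by linarith
        then have "\<bar>a x $ i - a y $ i\<bar> * real N \<le> 1"
          by (simp add: left_diff_distrib[symmetric] abs_mult)
        then show ?thesis using N by (simp add: field_simps)
      qed
      then have "norm (a x - a y) \<le> (\<Sum>i\<in>(UNIV::'n set). 1 / real N)"
        by (intro order_trans[OF norm_le_l1_cart] sum_mono)
      then have nm: "norm (a x - a y) \<le> real ?n / real N" by simp
      have "\<bar>F x - F y\<bar> \<le> D * norm (a x - a y) ^ Suc ?n" by (rule D(2)[OF x(1) y(1)])
      also have "\<dots> \<le> \<delta>" unfolding \<delta>_def
        using D nm by (intro mult_left_mono power_mono) auto
      finally have "F x \<in> T (idx x)"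
        by (auto simp: T_def y_def[symmetric] Let_def)
      then show "t \<in> (\<Union>k\<in>G. T k)" using idxG x by blast
    qed
    have "measure lebesgue (\<Union>k\<in>G. T k) \<le> (\<Sum>k\<in>G. measure lebesgue (T k))"
      by (rule measure_UNION_le[OF finG]) (use Tm in blast)
    also have "\<dots> = (2 * real K * real N) ^ ?n * (2 * \<delta>)"
      by (simp add: Tm cardG)
    also have "\<dots> = B / real N"
    proof -
      have "P * Q * (2 * (D * (S / (real N * Q)))) = P * (2 * (D * S)) / real N" if "Q \<noteq> 0" for P Q S
        using N that by (simp add: field_simps)
      from this[of "real N ^ ?n"] N show ?thesis
        by (simp add: B_def \<delta>_def power_mult_distrib power_divide)
    qed
    also have "\<dots> \<le> e"
      using N e by (simp add: field_simps)
    finally have "measure lebesgue (\<Union>k\<in>G. T k) \<le> e" .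
    then show "\<exists>T. F ` E \<subseteq> T \<and> T \<in> lmeasurable \<and> measure lebesgue T \<le> e"
      using cover Tm finG by (intro exI[of _ "\<Union>k\<in>G. T k"]) (auto intro: fmeasurable.finite_UN)
  qed
qed simp

definition jac_matrix :: "('n::finite \<Rightarrow> real ^ 'n \<Rightarrow> real) \<Rightarrow> real ^ 'n \<Rightarrow> real ^ 'n ^ 'n" where
  "jac_matrix \<psi> x = (\<chi> i k. dird (\<psi> i) x (axis k 1))"

text \<open>The vector fields dual to the differentials of the coordinate functions \<open>\<psi>\<close>, written with
  Cramer's rule so that their smoothness is evident.\<close>

definition frame :: "('n::finite \<Rightarrow> real ^ 'n \<Rightarrow> real) \<Rightarrow> 'n \<Rightarrow> real ^ 'n \<Rightarrow> real ^ 'n" where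
  "frame \<psi> j x =
     (\<chi> k. det (\<chi> i l. if l = k then axis j 1 $ i else jac_matrix \<psi> x $ i $ l) / det (jac_matrix \<psi> x))"

text \<open>The derivative along the field of the frame with index \<open>j\<close>; for the iterated derivatives below
  it has to be a function again.\<close>

definition along :: "('n::finite \<Rightarrow> real ^ 'n \<Rightarrow> real) \<Rightarrow> 'n \<Rightarrow> (real ^ 'n \<Rightarrow> real) \<Rightarrow> real ^ 'n \<Rightarrow> real" where
  "along \<psi> j f x = dird f x (frame \<psi> j x)"

text \<open>Vanishing at \<open>x\<close> of the restriction of \<open>f - f x\<close> to a slice, to order \<open>k\<close>.  The slices are the
  sets on which the functions \<open>\<psi> i\<close> with \<open>i \<in> I\<close> are constant; the remaining fields of the frame are
  tangent to them.\<close>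

primrec flat :: "('n::finite \<Rightarrow> real ^ 'n \<Rightarrow> real) \<Rightarrow> 'n set \<Rightarrow> nat \<Rightarrow> (real ^ 'n \<Rightarrow> real) \<Rightarrow> real ^ 'n \<Rightarrow> bool" where
  "flat \<psi> I 0 f x \<longleftrightarrow> True"
| "flat \<psi> I (Suc k) f x \<longleftrightarrow> (\<forall>j\<in>- I. along \<psi> j f x = 0 \<and> flat \<psi> I k (along \<psi> j f) x)"

definition coordinates_on :: "('n::finite \<Rightarrow> real ^ 'n \<Rightarrow> real) \<Rightarrow> (real ^ 'n) set \<Rightarrow> bool" where
  "coordinates_on \<psi> U \<longleftrightarrow> open U \<and> (\<forall>i. smooth_on (\<psi> i) U) \<and> (\<forall>x\<in>U. det (jac_matrix \<psi> x) \<noteq> 0)"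

lemma jac_matrix_mult:
  assumes "\<And>i. \<psi> i differentiable at x"
  shows "(jac_matrix \<psi> x *v u) $ i = dird (\<psi> i) x u"
  using dird_axis_sum[OF assms, of i u]
  by (simp add: jac_matrix_def matrix_vector_mult_def mult.commute)

lemma jac_matrix_frame:
  assumes "det (jac_matrix \<psi> x) \<noteq> 0"
  shows "jac_matrix \<psi> x *v frame \<psi> j x = axis j 1"
  unfolding cramer[OF assms] frame_def by simp

context
  fixes \<psi> :: "'n::finite \<Rightarrow> real ^ 'n \<Rightarrow> real" and U
  assumes coords: "coordinates_on \<psi> U"
begin

lemma coordinates_differentiable: "x \<in> U \<Longrightarrow> \<psi> i differentiable at x"
  using coords smooth_on_imp_differentiable unfolding coordinates_on_def by blast

lemma jac_matrix_dird: "x \<in> U \<Longrightarrow> (jac_matrix \<psi> x *v u) $ i = dird (\<psi> i) x u"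
  by (simp add: jac_matrix_mult coordinates_differentiable)

lemma dird_frame:
  assumes "x \<in> U" shows "dird (\<psi> i) x (frame \<psi> j x) = (if i = j then 1 else 0)"
proof -
  have "det (jac_matrix \<psi> x) \<noteq> 0" using coords assms by (auto simp: coordinates_on_def)
  from jac_matrix_frame[OF this, of j] show ?thesis
    using jac_matrix_dird[OF assms, of "frame \<psi> j x" i]
    by (auto simp: axis_def)
qed

lemma coordinates_vec_eqI:
  assumes "x \<in> U" "\<And>i. dird (\<psi> i) x u = dird (\<psi> i) x w" shows "u = w"
proof -
  have "det (jac_matrix \<psi> x) \<noteq> 0" using coords assms by (auto simp: coordinates_on_def)
  then have "inj ((*v) (jac_matrix \<psi> x))"
    by (metis invertible_det_nz invertible_left_inverse matrix_left_invertible_injective)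
  moreover have "jac_matrix \<psi> x *v u = jac_matrix \<psi> x *v w"
    by (simp add: vec_eq_iff jac_matrix_dird assms)
  ultimately show ?thesis by (simp add: inj_eq)
qed

lemma frame_expansion:
  assumes "x \<in> U" shows "u = (\<Sum>j\<in>UNIV. dird (\<psi> j) x u *\<^sub>R frame \<psi> j x)"
proof (rule coordinates_vec_eqI[OF assms])
  fix i
  show "dird (\<psi> i) x u = dird (\<psi> i) x (\<Sum>j\<in>UNIV. dird (\<psi> j) x u *\<^sub>R frame \<psi> j x)"
    using dird_linear[OF coordinates_differentiable[OF assms]]
    by (simp add: linear_sum linear_scale dird_frame[OF assms] if_distrib cong: if_cong)
qed

lemma smooth_on_along:
  assumes "smooth_on f U" shows "smooth_on (along \<psi> j f) U"
proof -
  have o: "open U" and sm: "\<And>i. smooth_on (\<psi> i) U" and nz: "\<And>x. x \<in> U \<Longrightarrow> det (jac_matrix \<psi> x) \<noteq> 0"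
    using coords by (auto simp: coordinates_on_def)
  have J: "smooth_on (\<lambda>x. jac_matrix \<psi> x $ i $ l) U" for i l
    by (simp add: jac_matrix_def smooth_on_dird[OF sm])
  have 1: "smooth_on (\<lambda>x. if l = k then axis j 1 $ i else jac_matrix \<psi> x $ i $ l) U" for i k l
    using J by (cases "l = k") (auto intro: smooth_on_const)
  have "smooth_on (\<lambda>x. frame \<psi> j x $ k) U" for k
    unfolding frame_def vec_lambda_beta
    by (intro smooth_on_divide o smooth_on_det J nz) (use 1 in auto)
  then show ?thesis
    unfolding along_def[abs_def] by (intro smooth_on_dird_field o assms)
qed

lemma coordinates_local_inverse:
  assumes x0: "x0 \<in> U"
  obtains W V g g' where "open W" "x0 \<in> W" "W \<subseteq> U" "open V"
    "homeomorphism W V (\<lambda>x. \<chi> i. \<psi> i x) g"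
    "\<And>z. z \<in> V \<Longrightarrow> (g has_derivative g' z) (at z)"
    "\<And>z h. z \<in> V \<Longrightarrow> g' z h = (\<Sum>j\<in>UNIV. h $ j *\<^sub>R frame \<psi> j (g z))"
proof -
  define f where "f = (\<lambda>x. (\<chi> i. \<psi> i x))"
  define f' where "f' x = Blinfun ((*v) (jac_matrix \<psi> x))" for x
  have o: "open U" and sm: "\<And>i. smooth_on (\<psi> i) U"
    using coords by (auto simp: coordinates_on_def)
  have f': "blinfun_apply (f' x) = (*v) (jac_matrix \<psi> x)" for x
    unfolding f'_def by (rule bounded_linear_Blinfun_apply) (rule matrix_vector_mul_bounded_linear)
  have df: "(f has_derivative f' x) (at x)" if "x \<in> U" for x
  proof (subst has_derivative_componentwise_within, intro ballI)
    fix b :: "real ^ 'n" assume "b \<in> Basis"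
    then obtain i where b: "b = axis i 1" by (auto simp: Basis_vec_def)
    have "(\<lambda>x. f' x' x \<bullet> b) = dird (\<psi> i) x'" if "x' \<in> U" for x'
      by (auto simp: b f' inner_axis jac_matrix_dird that)
    then show "((\<lambda>x. f x \<bullet> b) has_derivative (\<lambda>h. f' x h \<bullet> b)) (at x)"
      using dird_has_derivative[OF coordinates_differentiable[OF that]] that
      by (simp add: b f_def inner_axis)
  qed
  have cont: "continuous_on U f'"
  proof (rule continuous_on_blinfun_componentwise)
    fix b :: "real ^ 'n" assume "b \<in> Basis"
    then obtain k where b: "b = axis k 1" by (auto simp: Basis_vec_def)
    have "continuous_on U (\<lambda>x. \<chi> i. dird (\<psi> i) x (axis k 1))"
      by (intro continuous_on_vec_lambda smooth_on_continuous_on smooth_on_dird sm)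
    moreover have "f' x b = (\<chi> i. dird (\<psi> i) x (axis k 1))" if "x \<in> U" for x
      by (simp add: vec_eq_iff f' b jac_matrix_dird that)
    ultimately show "continuous_on U (\<lambda>x. f' x b)"
      by (simp cong: continuous_on_cong)
  qed
  have "invertible (jac_matrix \<psi> x0)"
    using coords x0 by (auto simp: coordinates_on_def invertible_det_nz)
  then obtain B where B: "B ** jac_matrix \<psi> x0 = mat 1" by (auto simp: invertible_def)
  have "Blinfun ((*v) B) o\<^sub>L f' x0 = id_blinfun"
    by (rule blinfun_eqI)
      (simp add: f' bounded_linear_Blinfun_apply matrix_vector_mul_bounded_linear
        matrix_vector_mul_assoc B)
  from inverse_function_theorem[OF o df cont x0 this]
  obtain W V g g' where *: "open W" "W \<subseteq> U" "x0 \<in> W" "open V" "f x0 \<in> V" "homeomorphism W V f g"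
    "\<And>z. z \<in> V \<Longrightarrow> (g has_derivative g' z) (at z)"
    "\<And>z. z \<in> V \<Longrightarrow> g' z = inv (blinfun_apply (f' (g z)))"
    "\<And>z. z \<in> V \<Longrightarrow> bij (blinfun_apply (f' (g z)))"
    by metis
  have "g' z h = (\<Sum>j\<in>UNIV. h $ j *\<^sub>R frame \<psi> j (g z))" if z: "z \<in> V" for z h
  proof -
    have gz: "g z \<in> U"
      using *(2,6) z unfolding homeomorphism_def by blast
    have "f' (g z) (g' z h) = h"
      using *(8,9)[OF z] by (simp add: bij_is_surj surj_f_inv_f)
    then have "dird (\<psi> j) (g z) (g' z h) = h $ j" for j
      by (metis f' jac_matrix_dird[OF gz])
    then show ?thesis
      using frame_expansion[OF gz, of "g' z h"] by simp
  qed
  then show thesis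
    using that[OF *(1,3,2,4)] *(6,7) unfolding f_def by blast
qed

text \<open>Along a segment inside a slice the derivative of \<open>f\<close> is a combination of the functions
  \<open>along \<psi> j f\<close> with \<open>j \<notin> I\<close>, which are themselves flat of one order less and vanish at the starting
  point.  So the mean value theorem gains one power of the distance at each step, starting from the
  boundedness of \<open>f\<close> on a compact ball.\<close>

lemma flat_estimate:
  assumes V: "open V" "g ` V \<subseteq> U" and r: "cball z0 r \<subseteq> V"
    and dg: "\<And>z. z \<in> V \<Longrightarrow> (g has_derivative g' z) (at z)"
      "\<And>z h. z \<in> V \<Longrightarrow> g' z h = (\<Sum>j\<in>UNIV. h $ j *\<^sub>R frame \<psi> j (g z))"
    and f: "smooth_on f U"
  shows "\<exists>C. \<forall>p\<in>cball z0 r. \<forall>z\<in>cball z0 r. (\<forall>i\<in>I. p $ i = z $ i) \<longrightarrow> flat \<psi> I k f (g p) \<longrightarrow>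
    \<bar>f (g z) - f (g p)\<bar> \<le> C * norm (z - p) ^ k"
  using f
proof (induction k arbitrary: f)
  case 0
  have "continuous_on V g"
    using dg(1) has_derivative_continuous continuous_at_imp_continuous_on by blast
  then have "continuous_on (cball z0 r) g"
    using r continuous_on_subset by blast
  then have "continuous_on (cball z0 r) (\<lambda>z. f (g z))"
    by (rule continuous_on_compose2[OF smooth_on_continuous_on[OF 0]]) (use r V(2) in blast)
  then have "bounded ((\<lambda>z. f (g z)) ` cball z0 r)"
    by (intro compact_imp_bounded compact_continuous_image compact_cball)
  then obtain B where B: "\<And>z. z \<in> cball z0 r \<Longrightarrow> \<bar>f (g z)\<bar> \<le> B"
    unfolding bounded_iff by (auto simp del: mem_cball)
  have "\<bar>f (g z) - f (g p)\<bar> \<le> 2 * B" if "p \<in> cball z0 r" "z \<in> cball z0 r" for p z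
    using B[OF that(1)] B[OF that(2)] by linarith
  then show ?case by (intro exI[of _ "2 * B"]) (simp del: mem_cball)
next
  case (Suc k)
  have "\<exists>C. \<forall>p\<in>cball z0 r. \<forall>z\<in>cball z0 r. (\<forall>i\<in>I. p $ i = z $ i) \<longrightarrow> flat \<psi> I k (along \<psi> j f) (g p) \<longrightarrow>
    \<bar>along \<psi> j f (g z) - along \<psi> j f (g p)\<bar> \<le> C * norm (z - p) ^ k" for j
    by (rule Suc.IH[OF smooth_on_along[OF Suc.prems]])
  then obtain C where C: "\<And>j p z. p\<in>cball z0 r \<Longrightarrow> z\<in>cball z0 r \<Longrightarrow> (\<forall>i\<in>I. p $ i = z $ i) \<Longrightarrow>
      flat \<psi> I k (along \<psi> j f) (g p) \<Longrightarrow>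
      \<bar>along \<psi> j f (g z) - along \<psi> j f (g p)\<bar> \<le> C j * norm (z - p) ^ k"
    by metis
  show ?case
  proof (intro exI[of _ "\<Sum>j\<in>UNIV. \<bar>C j\<bar>"] ballI impI)
    fix p z assume p: "p \<in> cball z0 r" and z: "z \<in> cball z0 r" and eq: "\<forall>i\<in>I. p $ i = z $ i"
      and flat: "flat \<psi> I (Suc k) f (g p)"
    define w where "w = z - p"
    define c where "c t = p + t *\<^sub>R w" for t
    have cc: "c t \<in> cball z0 r" if "0 \<le> t" "t \<le> 1" for t
    proof -
      have "c t = (1 - t) *\<^sub>R p + t *\<^sub>R z"
        by (simp add: c_def w_def algebra_simps)
      then show ?thesis
        using convexD_alt[OF convex_cball p z that] by simp
    qed
    have der: "((\<lambda>t. f (g (c t))) has_real_derivative (\<Sum>j\<in>UNIV. w $ j * along \<psi> j f (g (c t)))) (at t)"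
      if "0 \<le> t" "t \<le> 1" for t
    proof -
      have cV: "c t \<in> V" and gU: "g (c t) \<in> U"
        using cc[OF that] r V(2) by (blast, blast)
      have dc: "(c has_derivative (\<lambda>h. h *\<^sub>R w)) (at t)"
        unfolding c_def by (auto intro!: derivative_eq_intros)
      note df = smooth_on_imp_differentiable[OF Suc.prems gU]
      have "((\<lambda>t. f (g (c t))) has_derivative (\<lambda>h. dird f (g (c t)) (g' (c t) (h *\<^sub>R w)))) (at t)"
        using diff_chain_at[OF diff_chain_at[OF dc dg(1)[OF cV]], of f] dird_has_derivative[OF df]
        by (simp add: o_def)
      moreover have "dird f (g (c t)) (g' (c t) (h *\<^sub>R w)) = (\<Sum>j\<in>UNIV. w $ j * along \<psi> j f (g (c t))) * h" for h
        using dird_linear[OF df]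
        by (simp add: dg(2)[OF cV] along_def linear_sum linear_scale sum_distrib_left sum_distrib_right mult_ac)
      ultimately show ?thesis
        by (simp add: has_field_derivative_def)
    qed
    have bound: "\<bar>\<Sum>j\<in>UNIV. w $ j * along \<psi> j f (g (c t))\<bar> \<le> (\<Sum>j\<in>UNIV. \<bar>C j\<bar>) * norm w ^ Suc k"
      if t: "0 \<le> t" "t \<le> 1" for t
    proof -
      have "\<bar>w $ j * along \<psi> j f (g (c t))\<bar> \<le> \<bar>C j\<bar> * norm w ^ Suc k" for j
      proof (cases "j \<in> I")
        case True
        then show ?thesis using eq by (simp add: w_def)
      next
        case False
        then have fl: "along \<psi> j f (g p) = 0" "flat \<psi> I k (along \<psi> j f) (g p)"
          using flat by auto
        have "\<forall>i\<in>I. p $ i = c t $ i" using eq by (simp add: c_def w_def)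
        from C[OF p cc[OF t] this fl(2)] have "\<bar>along \<psi> j f (g (c t))\<bar> \<le> C j * norm (c t - p) ^ k"
          by (simp add: fl(1))
        also have "\<dots> \<le> \<bar>C j\<bar> * norm w ^ k"
          using t by (intro mult_mono power_mono) (auto simp: c_def mult_left_le_one_le)
        finally have "\<bar>w $ j\<bar> * \<bar>along \<psi> j f (g (c t))\<bar> \<le> norm w * (\<bar>C j\<bar> * norm w ^ k)"
          by (intro mult_mono component_le_norm_cart) auto
        then show ?thesis by (simp add: abs_mult mult_ac)
      qed
      then show ?thesis
        unfolding sum_distrib_right by (intro order_trans[OF sum_abs] sum_mono)
    qed
    obtain t where t: "0 < t" "t < 1"
      "f (g (c 1)) - f (g (c 0)) = (1 - 0) * (\<Sum>j\<in>UNIV. w $ j * along \<psi> j f (g (c t)))"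
      using MVT2[of 0 1 "\<lambda>t. f (g (c t))", OF _ der] by auto
    then show "\<bar>f (g z) - f (g p)\<bar> \<le> (\<Sum>j\<in>UNIV. \<bar>C j\<bar>) * norm (z - p) ^ Suc k"
      using bound[of t] by (simp add: c_def w_def)
  qed
qed

lemma negligible_image_flat:
  assumes E: "E \<subseteq> U" "\<And>x i. x \<in> E \<Longrightarrow> i \<in> I \<Longrightarrow> \<psi> i x = 0" and F: "smooth_on F U"
    and flat: "\<And>x. x \<in> E \<Longrightarrow> flat \<psi> I (Suc CARD('n)) F x"
  shows "negligible (F ` E)"
proof (rule negligible_image_locally)
  fix x0 assume "x0 \<in> E"
  then have x0: "x0 \<in> U" using E by blast
  obtain W V g g' where *: "open W" "x0 \<in> W" "W \<subseteq> U" "open V" "homeomorphism W V (\<lambda>x. \<chi> i. \<psi> i x) g"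
    "\<And>z. z \<in> V \<Longrightarrow> (g has_derivative g' z) (at z)"
    "\<And>z h. z \<in> V \<Longrightarrow> g' z h = (\<Sum>j\<in>UNIV. h $ j *\<^sub>R frame \<psi> j (g z))"
    by (rule coordinates_local_inverse[OF x0]) (rule that)
  define a where "a = (\<lambda>x. \<chi> i. \<psi> i x)"
  have hom: "homeomorphism W V a g" using *(5) by (simp add: a_def)
  have "a x0 \<in> V" using hom *(2) by (auto simp: homeomorphism_def)
  then obtain r where r: "r > 0" "cball (a x0) r \<subseteq> V"
    using *(4) open_contains_cball by blast
  have gV: "g ` V \<subseteq> U" using hom *(3) by (auto simp: homeomorphism_def)
  obtain C where C: "\<And>p z. p\<in>cball (a x0) r \<Longrightarrow> z\<in>cball (a x0) r \<Longrightarrow> (\<forall>i\<in>I. p $ i = z $ i) \<Longrightarrow>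
      flat \<psi> I (Suc CARD('n)) F (g p) \<Longrightarrow> \<bar>F (g z) - F (g p)\<bar> \<le> C * norm (z - p) ^ Suc CARD('n)"
    using flat_estimate[OF *(4) gV r(2) *(6,7) F, of I "Suc CARD('n)"] by blast
  define W' where "W' = W \<inter> a -` ball (a x0) r"
  have "open W'" unfolding W'_def
    using hom *(1) by (intro continuous_open_preimage) (auto simp: homeomorphism_def)
  moreover have "x0 \<in> W'" using *(2) r by (simp add: W'_def)
  moreover have "negligible (F ` (E \<inter> W'))"
  proof (rule negligible_image_Hoelder)
    show "bounded (a ` (E \<inter> W'))"
      by (rule bounded_subset[OF bounded_ball[of "a x0" r]]) (auto simp: W'_def)
    fix x y assume x: "x \<in> E \<inter> W'" and y: "y \<in> E \<inter> W'"
    then have "g (a x) = x" "g (a y) = y"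
      using hom by (auto simp: homeomorphism_def W'_def)
    moreover have "\<forall>i\<in>I. a y $ i = a x $ i"
      using x y E(2) by (auto simp: a_def)
    ultimately show "\<bar>F x - F y\<bar> \<le> C * norm (a x - a y) ^ Suc CARD('n)"
      using C[of "a y" "a x"] x y flat by (auto simp: W'_def simp del: flat.simps)
  qed
  ultimately show "\<exists>W. open W \<and> x0 \<in> W \<and> negligible (F ` (E \<inter> W))" by blast
qed

end

text \<open>The condition under which \<open>E\<close> consists of critical points of \<open>F\<close> restricted to \<open>E\<close>.  The
  constraints are all the functions vanishing on \<open>E\<close>, not only some given equations for \<open>E\<close>: this
  makes the condition stable under shrinking \<open>E\<close>, and it lets a constraint discovered later (a
  derivative of \<open>F\<close> that vanishes on a part of \<open>E\<close>) be treated like the original ones.\<close>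

definition critical_along :: "'a::euclidean_space set \<Rightarrow> 'a set \<Rightarrow> ('a \<Rightarrow> real) \<Rightarrow> bool" where
  "critical_along U E F \<longleftrightarrow>
     (\<forall>x\<in>E. \<forall>u. (\<forall>h :: 'a \<Rightarrow> real. smooth_on h U \<longrightarrow> (\<forall>y\<in>E. h y = 0) \<longrightarrow> dird h x u = 0) \<longrightarrow> dird F x u = 0)"

lemma critical_along_subset:
  assumes "critical_along U E F" "E' \<subseteq> E" "U' \<subseteq> U"
  shows "critical_along U' E' F"
  using assms smooth_on_subset[OF _ assms(3)] unfolding critical_along_def by (meson subset_iff)

text \<open>The points of \<open>E\<close> at which the functions \<open>\<psi> i\<close>, \<open>i \<in> I\<close>, do not yet account for all first order
  constraints.\<close>

definition transversal :: "('n::finite \<Rightarrow> real ^ 'n \<Rightarrow> real) \<Rightarrow> 'n set \<Rightarrow> (real ^ 'n) set \<Rightarrow> (real ^ 'n) set \<Rightarrow> (real ^ 'n) set" where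
  "transversal \<psi> I U E =
     {x\<in>E. \<exists>h j. smooth_on h U \<and> (\<forall>y\<in>E. h y = 0) \<and> j \<notin> I \<and> along \<psi> j h x \<noteq> 0}"

text \<open>A vector annihilated by the differentials of all coordinates except the one with index \<open>j\<close> is
  a multiple of the \<open>j\<close>-th field of the frame, on which \<open>h\<close> has a nonzero derivative.\<close>

lemma coordinates_replace:
  assumes \<psi>: "coordinates_on \<psi> U" and h: "smooth_on h U" and x: "x \<in> U" "along \<psi> j h x \<noteq> 0"
  obtains W where "open W" "x \<in> W" "W \<subseteq> U" "coordinates_on (\<psi>(j := h)) W"
proof -
  define \<psi>' where "\<psi>' = \<psi>(j := h)"
  have o: "open U" and sm: "\<And>i. smooth_on (\<psi>' i) U"
    using \<psi> h by (auto simp: coordinates_on_def \<psi>'_def)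
  have d: "\<psi>' i differentiable at y" if "y \<in> U" for i y
    by (rule smooth_on_imp_differentiable[OF sm that])
  have "det (jac_matrix \<psi>' x) \<noteq> 0"
  proof -
    have "u = 0" if "jac_matrix \<psi>' x *v u = 0" for u
    proof -
      have z: "dird (\<psi>' i) x u = 0" for i
        using that jac_matrix_mult[of \<psi>' x u i] d[OF x(1)] by simp
      then have z': "dird (\<psi> i) x u = 0" if "i \<noteq> j" for i
        using that by (metis \<psi>'_def fun_upd_other)
      have "u = (\<Sum>i\<in>UNIV. dird (\<psi> i) x u *\<^sub>R frame \<psi> i x)"
        by (rule frame_expansion[OF \<psi> x(1)])
      also have "\<dots> = (\<Sum>i\<in>UNIV. if i = j then dird (\<psi> j) x u *\<^sub>R frame \<psi> j x else 0)"
        by (intro sum.cong) (auto simp: z')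
      finally have u: "u = dird (\<psi> j) x u *\<^sub>R frame \<psi> j x" by simp
      have "0 = dird h x u"
        using z[of j] by (simp add: \<psi>'_def)
      also have "\<dots> = dird (\<psi> j) x u * along \<psi> j h x"
        using dird_linear[OF smooth_on_imp_differentiable[OF h x(1)]]
        by (subst u) (simp add: linear_scale along_def)
      finally show "u = 0" using x(2) u by simp
    qed
    then show ?thesis
      by (metis invertible_det_nz invertible_left_inverse matrix_left_invertible_ker)
  qed
  moreover have "continuous_on U (\<lambda>y. det (jac_matrix \<psi>' y))"
    by (intro smooth_on_continuous_on smooth_on_det o) (simp add: jac_matrix_def smooth_on_dird[OF sm])
  moreover define W where "W = U \<inter> (\<lambda>y. det (jac_matrix \<psi>' y)) -` (- {0})"
  ultimately have W: "open W" "x \<in> W" "W \<subseteq> U"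
    using o x(1) by (auto intro: continuous_open_preimage)
  moreover have "coordinates_on \<psi>' W"
    using W sm smooth_on_subset[OF sm W(3)] by (auto simp: coordinates_on_def W_def)
  ultimately show thesis using that unfolding \<psi>'_def by blast
qed

text \<open>Induction on the number of coordinates that are not yet constraints.  Near a point where some
  function vanishing on \<open>E\<close> has a nonzero derivative along a slice, that function replaces a
  coordinate and the number drops.  Removing all such points leaves a smaller set, to which the same
  step applies, because the derivatives of \<open>F\<close> along the slices vanish there and are themselves
  functions vanishing on it.  After \<open>n + 1\<close> removals \<open>F\<close> is flat of order \<open>n + 1\<close>.\<close>

lemma negligible_critical_values_coordinates:
  fixes F :: "real ^ 'n::finite \<Rightarrow> real"
  assumes "coordinates_on \<psi> U" "E \<subseteq> U" "\<And>x i. x \<in> E \<Longrightarrow> i \<in> I \<Longrightarrow> \<psi> i x = 0"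
    and "smooth_on F U" "critical_along U E F"
  shows "negligible (F ` E)"
  using assms
proof (induction "card (- I)" arbitrary: I \<psi> U E rule: less_induct)
  case less
  note \<psi> = less.prems(1) and sF = less.prems(4)
  have trans: "negligible (F ` transversal \<psi> I U D)" if D: "D \<subseteq> E" for D
  proof (rule negligible_image_locally)
    fix x assume "x \<in> transversal \<psi> I U D"
    then obtain h j where h: "x \<in> D" "smooth_on h U" "\<And>y. y \<in> D \<Longrightarrow> h y = 0" "j \<notin> I" "along \<psi> j h x \<noteq> 0"
      unfolding transversal_def by blast
    then have x: "x \<in> U" using D less.prems(2) by blast
    obtain W where W: "open W" "x \<in> W" "W \<subseteq> U" "coordinates_on (\<psi>(j := h)) W"
      by (rule coordinates_replace[OF \<psi> h(2) x h(5)])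
    have "negligible (F ` (D \<inter> W))"
    proof (rule less.hyps[OF _ W(4)])
      show "card (- insert j I) < card (- I)"
        using h(4) by (intro psubset_card_mono) auto
      show "(\<psi>(j := h)) i y = 0" if "y \<in> D \<inter> W" "i \<in> insert j I" for y i
        using that h(3) less.prems(3) D by auto
      show "critical_along W (D \<inter> W) F"
        using critical_along_subset[OF less.prems(5)] D W(3) by blast
    qed (use smooth_on_subset[OF sF W(3)] in auto)
    then have "negligible (F ` (transversal \<psi> I U D \<inter> W))"
      by (rule negligible_subset) (auto simp: transversal_def)
    then show "\<exists>W. open W \<and> x \<in> W \<and> negligible (F ` (transversal \<psi> I U D \<inter> W))"
      using W by blast
  qed
  \<comment> \<open>The set that is left after \<open>k\<close> removals.\<close>
  define D where "D k = ((\<lambda>D. D - transversal \<psi> I U D) ^^ k) E" for k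
  have D0: "D 0 = E" and DS: "D (Suc k) = D k - transversal \<psi> I U (D k)" for k
    by (simp_all add: D_def)
  have DE: "D k \<subseteq> E" for k
    by (induction k) (auto simp: D0 DS)
  have along0: "along \<psi> j h x = 0" if "smooth_on h U" "\<And>y. y \<in> D i \<Longrightarrow> h y = 0" "x \<in> D (Suc i)" "j \<notin> I"
    for h :: "real ^ 'n \<Rightarrow> real" and x i j
    using that unfolding DS transversal_def by blast
  have flat: "flat \<psi> I k h x" if "smooth_on h U" "\<And>y. y \<in> D i \<Longrightarrow> h y = 0" "x \<in> D (i + k)"
    for h :: "real ^ 'n \<Rightarrow> real" and x i k
    using that
  proof (induction k arbitrary: h i)
    case (Suc k)
    have sub: "D (i + m) \<subseteq> D i" for i m
      by (induction m) (auto simp: DS)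
    have "flat \<psi> I k (along \<psi> j h) x \<and> along \<psi> j h x = 0" if "j \<notin> I" for j
    proof
      have a: "along \<psi> j h y = 0" if "y \<in> D (Suc i)" for y
        by (rule along0[OF Suc.prems(1,2) that \<open>j \<notin> I\<close>])
      show "flat \<psi> I k (along \<psi> j h) x"
      proof (rule Suc.IH[where i = "Suc i"])
        show "x \<in> D (Suc i + k)" using Suc.prems(3) by simp
      qed (use a smooth_on_along[OF \<psi> Suc.prems(1)] in auto)
      show "along \<psi> j h x = 0"
        using a sub[of "Suc i" k] Suc.prems(3) by auto
    qed
    then show ?case by auto
  qed simp
  have aF: "along \<psi> j F x = 0" if x: "x \<in> D 1" and j: "j \<notin> I" for x j
  proof -
    have "dird h x (frame \<psi> j x) = 0" if "smooth_on h U" "\<forall>y\<in>E. h y = 0"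
      for h :: "real ^ 'n \<Rightarrow> real"
      using along0[of h 0 x j] that x j by (simp add: D0 along_def)
    moreover have "x \<in> E" using x DE by blast
    ultimately show ?thesis
      using less.prems(5) unfolding critical_along_def along_def by blast
  qed
  have "negligible (F ` D (Suc CARD('n)))"
  proof (rule negligible_image_flat[OF \<psi> _ _ sF])
    fix x assume x: "x \<in> D (Suc CARD('n))"
    have "flat \<psi> I CARD('n) (along \<psi> j F) x" if "j \<notin> I" for j
      by (rule flat[OF smooth_on_along[OF \<psi> sF], of 1]) (use aF that x in auto)
    moreover have "along \<psi> j F x = 0" if "j \<notin> I" for j
    proof (rule aF[OF _ that])
      have "D (Suc k) \<subseteq> D 1" for k
        by (induction k) (auto simp: DS)
      then show "x \<in> D 1" using x by blast
    qed
    ultimately show "flat \<psi> I (Suc CARD('n)) F x" by auto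
  qed (use DE less.prems(2,3) in blast)+
  then have "negligible (F ` D 0)"
  proof (rule inc_induct[rotated])
    fix k assume "negligible (F ` D (Suc k))"
    then have "negligible (F ` D (Suc k) \<union> F ` transversal \<psi> I U (D k))"
      using trans[OF DE] by (rule negligible_Un)
    then show "negligible (F ` D k)"
      by (rule negligible_subset) (auto simp: DS)
  qed simp
  then show ?case by (simp add: D0)
qed

text \<open>If \<open>E\<close> is the set of critical points of \<open>F\<close>, the hypothesis holds trivially and this is the Sard
  theorem for real functions; the same is true for the critical points of the restriction of \<open>F\<close> to a
  submanifold, whose equations are among the functions vanishing on \<open>E\<close>.  The induction starts with no constraints, in linear coordinates.\<close>

theorem negligible_critical_values:
  fixes F :: "real ^ 'n::finite \<Rightarrow> real"
  assumes "open U" "E \<subseteq> U" "smooth_on F U" "critical_along U E F"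
  shows "negligible (F ` E)"
proof (rule negligible_critical_values_coordinates[where I = "{}" and \<psi> = "\<lambda>i x. x $ i"])
  have "jac_matrix (\<lambda>i x. x $ i) x = (mat 1 :: real ^ 'n ^ 'n)" for x
    by (simp add: jac_matrix_def vec_eq_iff mat_def axis_def
        dird_eqI[OF bounded_linear_imp_has_derivative[OF bounded_linear_vec_nth]])
  then show "coordinates_on (\<lambda>i x. x $ i) U"
    using assms(1) by (simp add: coordinates_on_def smooth_on_linear bounded_linear_vec_nth)
qed (use assms in auto)


section \<open>Derivative of the characteristic polynomial\<close>

lemma has_derivative_det:
  fixes N :: "'a::real_normed_vector \<Rightarrow> real ^ 'n ^ 'n"
  assumes "\<And>i j. ((\<lambda>x. N x $ i $ j) has_derivative (\<lambda>u. N' u $ i $ j)) (at x)"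
  shows "((\<lambda>x. det (N x)) has_derivative
    (\<lambda>u. \<Sum>i\<in>UNIV. det (\<chi> k. if k = i then N' u $ k else N x $ k))) (at x)"
proof -
  have "((\<lambda>x. det (N x)) has_derivative
      (\<lambda>u. \<Sum>p | p permutes UNIV. of_int (sign p) * (\<Sum>i\<in>UNIV. N' u $ i $ p i * (\<Prod>j\<in>UNIV - {i}. N x $ j $ p j)))) (at x)"
    unfolding det_def by (intro has_derivative_sum has_derivative_mult_right has_derivative_prod assms)
  moreover have "(\<Sum>p | p permutes UNIV. of_int (sign p) * (\<Sum>i\<in>UNIV. N' u $ i $ p i * (\<Prod>j\<in>UNIV - {i}. N x $ j $ p j)))
    = (\<Sum>i\<in>UNIV. det (\<chi> k. if k = i then N' u $ k else N x $ k))" for u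
  proof -
    have "(\<Prod>j\<in>UNIV. (\<chi> k. if k = i then N' u $ k else N x $ k) $ j $ p j) =
        N' u $ i $ p i * (\<Prod>j\<in>UNIV - {i}. N x $ j $ p j)" for p i
      by (subst prod.remove[of UNIV i]) (auto intro!: prod.cong)
    then show ?thesis
      unfolding det_def by (simp add: sum_distrib_left) (rule sum.swap)
  qed
  ultimately show ?thesis by simp
qed

text \<open>Jacobi's formula.  The rows of \<open>H\<close> are combinations of the rows of \<open>N\<close>, with coefficients
  \<open>K = H N\<^sup>-\<^sup>1\<close>, and a determinant in which row \<open>i\<close> is replaced by another row of \<open>N\<close> vanishes.\<close>

lemma sum_det_replaced_rows:
  fixes N R H :: "real ^ 'n ^ 'n"
  assumes "R ** N = mat 1"
  shows "(\<Sum>i\<in>UNIV. det (\<chi> k. if k = i then H $ k else N $ k)) = trace (R ** H) * det N"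
proof -
  define K where "K = H ** R"
  have "H = K ** N"
    unfolding K_def by (simp add: assms matrix_mul_assoc[symmetric])
  then have H: "H $ i = (\<Sum>j\<in>UNIV. K $ i $ j *s N $ j)" for i
    by (simp add: vec_eq_iff matrix_matrix_mult_def)
  have "det (\<chi> k. if k = i then H $ k else N $ k) = K $ i $ i * det N" for i
  proof -
    have "(\<chi> k. if k = i then H $ k else N $ k) = (\<chi> k. if k = i then (\<Sum>j\<in>UNIV. K $ i $ j *s N $ j) else N $ k)"
      by (simp add: vec_eq_iff H)
    then have "det (\<chi> k. if k = i then H $ k else N $ k) =
        (\<Sum>j\<in>UNIV. det (\<chi> k. if k = i then K $ i $ j *s N $ j else N $ k))"
      using det_linear_row_sum[of UNIV i "\<lambda>k j. K $ i $ j *s N $ j" "\<lambda>k. N $ k"] by simp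
    also have "\<dots> = (\<Sum>j\<in>UNIV. K $ i $ j * det (\<chi> k. if k = i then N $ j else N $ k))"
      using det_row_mul[of i _ "\<lambda>k. N $ _" "\<lambda>k. N $ k"] by (intro sum.cong) (simp_all add: det_row_mul)
    also have "\<dots> = (\<Sum>j\<in>UNIV. if j = i then K $ i $ i * det N else 0)"
    proof (intro sum.cong refl)
      fix j
      show "K $ i $ j * det (\<chi> k. if k = i then N $ j else N $ k) = (if j = i then K $ i $ i * det N else 0)"
      proof (cases "j = i")
        case True
        then have "(\<chi> k. if k = i then N $ j else N $ k) = N" by (simp add: vec_eq_iff)
        then show ?thesis using True by simp
      next
        case False
        have "det (\<chi> k. if k = i then N $ j else N $ k) = 0"
          by (rule det_identical_rows[OF False]) (use False in \<open>simp add: row_def vec_eq_iff\<close>)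
        then show ?thesis using False by simp
      qed
    qed
    finally show ?thesis by simp
  qed
  then have "(\<Sum>i\<in>UNIV. det (\<chi> k. if k = i then H $ k else N $ k)) = trace K * det N"
    by (simp add: trace_def sum_distrib_right)
  also have "trace K = trace (R ** H)"
    unfolding K_def by (rule trace_mul_sym)
  finally show ?thesis .
qed

lemma poly_matrix_charpoly: "poly (matrix_charpoly B) t = det (mat t - B)"
  unfolding matrix_charpoly_def det_def
  by (simp add: poly_sum poly_prod mat_def) (auto intro!: sum.cong prod.cong)

lemma degree_matrix_charpoly: "degree (matrix_charpoly (B :: real ^ 'n ^ 'n)) \<le> CARD('n)"
  unfolding matrix_charpoly_def det_def
proof (rule degree_sum_le)
  fix p :: "'n \<Rightarrow> 'n"
  let ?e = "\<lambda>i. ((\<chi> i j. (if i = j then [:0, 1:] else 0) - [:B $ i $ j:]) :: real poly ^ 'n ^ 'n) $ i $ p i"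
  have "degree (of_int (sign p) * (\<Prod>i\<in>UNIV. ?e i)) \<le> degree (\<Prod>i\<in>UNIV. ?e i)"
    using degree_mult_le[of "of_int (sign p)" "\<Prod>i\<in>UNIV. ?e i"] by simp
  also have "\<dots> \<le> (\<Sum>i\<in>UNIV. degree (?e i))"
    by (rule order_trans[OF degree_prod_sum_le]) auto
  also have "\<dots> \<le> (\<Sum>i\<in>(UNIV :: 'n set). 1)"
    by (intro sum_mono) auto
  finally show "degree (of_int (sign p) * (\<Prod>i\<in>UNIV. ?e i)) \<le> CARD('n)" by simp
qed simp

lemma poly_eq_sum_coeff:
  fixes p :: "'a::comm_semiring_1 poly"
  assumes "degree p \<le> n"
  shows "poly p x = (\<Sum>k\<le>n. coeff p k * x ^ k)"
  by (subst poly_as_sum_of_monoms'[OF assms, symmetric]) (simp add: poly_sum poly_monom)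

lemma matrix_diff_ldistrib: "A ** (B - C) = A ** B - A ** (C :: real ^ 'n ^ 'm)"
  and matrix_diff_rdistrib: "(B - C) ** D = B ** D - C ** (D :: real ^ 'k ^ 'n)"
  by (simp_all add: vec_eq_iff matrix_matrix_mult_def algebra_simps sum_subtractf)

lemma mat_mult_vec: "mat t *v u = t *\<^sub>R (u :: real ^ 'n)"
  by (simp add: vec_eq_iff mat_def matrix_vector_mult_def if_distrib if_distribR cong: if_cong)

text \<open>A number larger than the operator norm of \<open>B\<close> is not an eigenvalue.\<close>

lemma matrix_charpoly_nonzero:
  fixes B :: "real ^ 'n ^ 'n"
  shows "matrix_charpoly B \<noteq> 0"
proof -
  obtain K where K: "\<And>u. norm (B *v u) \<le> K * norm u"
    using linear_bounded[OF matrix_vector_mul_linear[of B]] by blast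
  have "u = 0" if "(mat (K + 1) - B) *v u = 0" for u
  proof -
    have "(K + 1) *\<^sub>R u = B *v u"
      using that by (simp add: matrix_vector_mult_diff_rdistrib mat_mult_vec)
    then have "\<bar>K + 1\<bar> * norm u \<le> K * norm u"
      using K[of u] by (metis norm_scaleR)
    moreover have "(K + 1) * norm u \<le> \<bar>K + 1\<bar> * norm u"
      by (intro mult_right_mono) auto
    ultimately have "K * norm u + norm u \<le> K * norm u"
      by (simp only: distrib_right mult_1)
    then show ?thesis by simp
  qed
  then have "poly (matrix_charpoly B) (K + 1) \<noteq> 0"
    unfolding poly_matrix_charpoly
    by (metis invertible_det_nz invertible_left_inverse matrix_left_invertible_ker)
  then show ?thesis by auto
qed

lemma smooth_on_coeff_matrix_charpoly:
  fixes N :: "'a::euclidean_space \<Rightarrow> real ^ 'n ^ 'n"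
  assumes "open S" "\<And>i j. smooth_on (\<lambda>x. N x $ i $ j) S"
  shows "smooth_on (\<lambda>x. coeff (matrix_charpoly (N x)) k) S"
proof -
  have prod: "smooth_on (\<lambda>x. coeff (\<Prod>i\<in>I. P i x) k) S"
    if "\<And>i k. i \<in> I \<Longrightarrow> smooth_on (\<lambda>x. coeff (P i x) k) S" for I :: "'i set" and P :: "'i \<Rightarrow> 'a \<Rightarrow> real poly" and k
    using that
    by (induction I arbitrary: k rule: infinite_finite_induct)
      (auto simp: coeff_mult intro!: smooth_on_const smooth_on_sum smooth_on_mult assms(1))
  have "smooth_on (\<lambda>x. coeff ((if i = j then [:0, 1:] else 0) - [:N x $ i $ j:]) k) S" for i j :: 'n and k
  proof -
    have "smooth_on (\<lambda>x. coeff (if i = j then [:0, 1:] else 0) k + (if k = 0 then - 1 else 0) * N x $ i $ j) S"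
      by (intro smooth_on_add smooth_on_mult smooth_on_const assms)
    then show ?thesis
      by (rule smooth_on_cong[OF assms(1)]) (simp add: coeff_pCons split: nat.split)
  qed
  then have 1: "smooth_on (\<lambda>x. coeff (\<Prod>i\<in>UNIV. (if i = p i then [:0, 1:] else 0) - [:N x $ i $ p i:]) k) S" for p k
    by (intro prod)
  have 2: "coeff (of_int m * p) k = of_int m * coeff p k" for m k and p :: "real poly"
    by (simp add: of_int_poly)
  show ?thesis
    unfolding matrix_charpoly_def det_def coeff_sum 2
    by (intro smooth_on_sum smooth_on_mult smooth_on_const assms(1)) (use 1 in simp)
qed

text \<open>In a direction \<open>u\<close> with \<open>A u = 0\<close>, a conformal \<open>A\<close> (that is, \<open>A + A\<^sup>* = \<phi>\<close> for the
  adjoint with respect to \<open>b\<close>) has \<open>R u = u / t\<close> and \<open>R\<^sup>* u = u / (t - \<phi>)\<close>, where \<open>R\<close> is the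
  resolvent of \<open>A\<close> at \<open>t\<close>.  This evaluates the trace of \<open>R\<close> times the covariant derivative
  \<open>H + [\<Gamma>, A]\<close>, and the commutator does not contribute because \<open>R\<close> commutes with \<open>A\<close>.\<close>

lemma trace_resolvent_conformal:
  fixes A H G R :: "real ^ 'n ^ 'n" and b :: "real ^ 'n \<Rightarrow> real ^ 'n \<Rightarrow> real" and \<alpha> :: "real ^ 'n \<Rightarrow> real"
  assumes b: "\<And>w. linear (b w)" "\<And>w t. b w t = b t w" "\<And>w. (\<And>t. b w t = 0) \<Longrightarrow> w = 0"
    and \<alpha>: "linear \<alpha>"
    and A: "\<And>w t. b (A *v w) t + b w (A *v t) = \<phi> * b w t"
    and H: "\<And>w t. 2 * b ((H + G ** A - A ** G) *v w) t = \<alpha> u * b w t + \<alpha> w * b u t - \<alpha> t * b u w"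
    and u: "A *v u = 0"
    and R: "R ** (mat \<tau> - A) = mat 1" and \<tau>: "\<tau> \<noteq> 0" "\<tau> \<noteq> \<phi>"
  shows "2 * trace (R ** H) = \<alpha> u * (trace R + 1 / \<tau> - 1 / (\<tau> - \<phi>))"
proof -
  have lin1: "linear (\<lambda>w. b w t)" for t
  proof -
    have "(\<lambda>w. b w t) = b t" by (rule ext) (rule b(2))
    then show ?thesis using b(1) by simp
  qed
  have "linear (\<lambda>w. \<chi> i. b w (axis i 1))"
    by (intro linearI) (simp_all add: vec_eq_iff linear_add[OF lin1] linear_scale[OF lin1])
  moreover have "inj (\<lambda>w. \<chi> i. b w (axis i 1))"
  proof (subst linear_injective_0[OF calculation], intro allI impI)
    fix w assume "(\<chi> i. b w (axis i 1)) = 0"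
    then have *: "b w (axis i 1) = 0" for i by (simp add: vec_eq_iff)
    have "b w t = 0" for t
      by (subst vec_axis_sum[of t]) (simp add: linear_sum[OF b(1)] linear_scale[OF b(1)] *)
    then show "w = 0" by (rule b(3))
  qed
  ultimately have "surj (\<lambda>w. \<chi> i. b w (axis i 1))"
    using linear_injective_imp_surjective by blast
  from surjD[OF this, of "\<chi> i. \<alpha> (axis i 1)"]
  obtain \<nu> where \<nu>: "(\<chi> i. \<alpha> (axis i 1)) = (\<chi> i. b \<nu> (axis i 1))"
    by (rule exE)
  \<comment> \<open>\<open>\<nu>\<close> is the gradient of \<open>\<alpha>\<close> with respect to \<open>b\<close>.\<close>
  have grad: "b \<nu> t = \<alpha> t" for t
  proof -
    have "b \<nu> (axis i 1) = \<alpha> (axis i 1)" for i using \<nu> by (simp add: vec_eq_iff)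
    then show ?thesis
      by (subst (1 2) vec_axis_sum[of t])
        (simp add: linear_sum[OF b(1)] linear_scale[OF b(1)] linear_sum[OF \<alpha>] linear_scale[OF \<alpha>])
  qed
  define T where "T = H + G ** A - A ** G"
  have T: "2 *\<^sub>R (T *v w) = \<alpha> u *\<^sub>R w + \<alpha> w *\<^sub>R u - b u w *\<^sub>R \<nu>" for w
  proof -
    have "b (2 *\<^sub>R (T *v w) - (\<alpha> u *\<^sub>R w + \<alpha> w *\<^sub>R u - b u w *\<^sub>R \<nu>)) t = 0" for t
      using H[of w t] by (simp add: linear_diff[OF lin1] linear_add[OF lin1] linear_scale[OF lin1] T_def grad mult.commute)
    from b(3)[OF this] show ?thesis by simp
  qed
  define s where "s = R *v \<nu>"
  have Rinv: "(mat \<tau> - A) ** R = mat 1"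
    using R matrix_left_right_inverse by blast
  have s: "\<nu> = \<tau> *\<^sub>R s - A *v s"
    using arg_cong[OF Rinv, of "\<lambda>M. M *v \<nu>"]
    by (simp add: s_def matrix_vector_mul_assoc[symmetric] matrix_vector_mult_diff_rdistrib mat_mult_vec)
  have Ru: "R *v u = (1 / \<tau>) *\<^sub>R u"
  proof -
    have "u = R *v ((mat \<tau> - A) *v u)"
      by (simp add: matrix_vector_mul_assoc R)
    also have "(mat \<tau> - A) *v u = \<tau> *\<^sub>R u"
      by (simp add: matrix_vector_mult_diff_rdistrib mat_mult_vec u)
    finally have "u = \<tau> *\<^sub>R (R *v u)"
      by (simp add: matrix_vector_mult_scaleR)
    then show ?thesis
      using \<tau>(1) by (metis divide_self_if inverse_eq_divide scaleR_one scaleR_scaleR times_divide_eq_left mult_1)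
  qed
  have bus: "b u s = \<alpha> u / (\<tau> - \<phi>)"
  proof -
    have "\<alpha> u = b u \<nu>" using grad b(2) by metis
    also have "\<dots> = \<tau> * b u s - b u (A *v s)"
      by (subst s) (simp add: linear_diff[OF b(1)] linear_scale[OF b(1)])
    also have "b u (A *v s) = \<phi> * b u s"
      using A[of u s] linear_0[OF lin1] by (simp add: u)
    finally show ?thesis using \<tau>(2) by (simp add: field_simps)
  qed
  have RT: "2 *\<^sub>R ((R ** T) *v w) = \<alpha> u *\<^sub>R (R *v w) + \<alpha> w *\<^sub>R (R *v u) - b u w *\<^sub>R s" for w
    using arg_cong[OF T[of w], of "\<lambda>x. R *v x"]
    by (simp add: matrix_vector_mul_assoc[symmetric] s_def matrix_vector_mult_scaleR
        matrix_vector_right_distrib matrix_vector_mult_diff_distrib)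
  have entry: "(M *v axis i 1) $ i = M $ i $ i" for M :: "real ^ 'n ^ 'n" and i
    by (simp add: matrix_vector_mult_basis column_def)
  have lsum: "(\<Sum>i\<in>UNIV. f (axis i 1) * x $ i) = f x" if "linear f" for f :: "real ^ 'n \<Rightarrow> real" and x
    by (subst (2) vec_axis_sum[of x]) (simp add: linear_sum[OF that] linear_scale[OF that] mult.commute)
  have "2 * trace (R ** T) = (\<Sum>i\<in>UNIV. (2 *\<^sub>R ((R ** T) *v axis i 1)) $ i)"
    by (simp add: trace_def entry sum_distrib_left)
  also have "\<dots> = \<alpha> u * trace R + \<alpha> (R *v u) - b u s"
    unfolding RT
    by (simp add: trace_def entry sum.distrib sum_subtractf sum_distrib_left[symmetric] lsum[OF \<alpha>] lsum[OF b(1)])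
  also have "\<dots> = \<alpha> u * (trace R + 1 / \<tau> - 1 / (\<tau> - \<phi>))"
    by (simp add: Ru linear_scale[OF \<alpha>] bus algebra_simps)
  finally have main: "2 * trace (R ** T) = \<alpha> u * (trace R + 1 / \<tau> - 1 / (\<tau> - \<phi>))" .
  have comm: "R ** A = A ** R"
  proof -
    have "R ** mat \<tau> = mat \<tau> ** R"
      by (simp add: vec_eq_iff matrix_matrix_mult_def mat_def if_distrib if_distribR cong: if_cong)
    moreover have "R ** (mat \<tau> - A) = (mat \<tau> - A) ** R" using R Rinv by simp
    ultimately show ?thesis
      by (simp add: matrix_diff_ldistrib matrix_diff_rdistrib)
  qed
  have "trace (R ** (G ** A)) = trace (R ** (A ** G))"
    by (metis comm matrix_mul_assoc trace_mul_sym)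
  then have "trace (R ** T) = trace (R ** H)"
    unfolding T_def by (simp add: matrix_diff_ldistrib matrix_add_ldistrib trace_add trace_sub)
  then show ?thesis using main by simp
qed

text \<open>The adjoint of \<open>A\<close> with respect to \<open>b\<close> is similar to the transpose, so it has the same trace,
  and \<open>A + A\<^sup>* = \<phi>\<close>.\<close>

lemma trace_conformal:
  fixes A :: "real ^ 'n ^ 'n" and b :: "real ^ 'n \<Rightarrow> real ^ 'n \<Rightarrow> real"
  assumes b: "\<And>w. linear (b w)" "\<And>w t. b w t = b t w" "\<And>w. (\<And>t. b w t = 0) \<Longrightarrow> w = 0"
    and A: "\<And>w t. b (A *v w) t + b w (A *v t) = \<phi> * b w t"
  shows "2 * trace A = real CARD('n) * \<phi>"
proof -
  define G :: "real ^ 'n ^ 'n" where "G = (\<chi> i j. b (axis i 1) (axis j 1))"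
  have bG: "b w t = w \<bullet> (G *v t)" for w t
  proof -
    have "b w t = (\<Sum>i\<in>UNIV. w $ i * b (axis i 1) t)"
      using b(2) by (subst b(2), subst vec_axis_sum[of w]) (simp add: linear_sum[OF b(1)] linear_scale[OF b(1)])
    also have "\<dots> = (\<Sum>i\<in>UNIV. w $ i * (G *v t) $ i)"
    proof (intro sum.cong refl)
      fix i
      have "b (axis i 1) t = (G *v t) $ i"
        by (subst vec_axis_sum[of t])
          (simp add: linear_sum[OF b(1)] linear_scale[OF b(1)] G_def matrix_vector_mult_def mult.commute)
      then show "w $ i * b (axis i 1) t = w $ i * (G *v t) $ i" by simp
    qed
    finally show ?thesis by (simp add: inner_vec_def)
  qed
  have "t = 0" if "G *v t = 0" for t
    using b(3)[of t] b(2) bG that by (metis inner_zero_right)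
  then obtain G' where G': "G' ** G = mat 1"
    using matrix_left_invertible_ker[of G] by blast
  then have G'': "G ** G' = mat 1"
    using matrix_left_right_inverse by blast
  have "(transpose A ** G + G ** A) *v t = (\<phi> *\<^sub>R G) *v t" for t
  proof (rule vector_eq_ldot[THEN iffD1], rule allI)
    fix w
    have "w \<bullet> ((transpose A ** G) *v t) = b (A *v w) t"
      unfolding bG
      by (simp only: matrix_vector_mul_assoc[symmetric] transpose_matrix_vector inner_commute[of w]
          dot_lmul_matrix) (rule inner_commute)
    then have "w \<bullet> ((transpose A ** G + G ** A) *v t) = b (A *v w) t + b w (A *v t)"
      by (simp add: bG matrix_vector_mult_add_rdistrib inner_add_right matrix_vector_mul_assoc[symmetric])
    also have "\<dots> = w \<bullet> ((\<phi> *\<^sub>R G) *v t)"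
      unfolding A by (simp add: bG scaleR_matrix_vector_assoc[symmetric])
    finally show "w \<bullet> ((transpose A ** G + G ** A) *v t) = w \<bullet> ((\<phi> *\<^sub>R G) *v t)" .
  qed
  then have "transpose A ** G + G ** A = \<phi> *\<^sub>R G"
    by (simp add: matrix_eq)
  then have "trace (G' ** (transpose A ** G + G ** A)) = trace (G' ** (\<phi> *\<^sub>R G))" by simp
  moreover have "trace (G' ** (transpose A ** G + G ** A)) = trace A + trace A"
  proof -
    have "trace (G' ** (transpose A ** G)) = trace (transpose A)"
      by (metis G'' matrix_mul_assoc matrix_mul_rid trace_mul_sym)
    moreover have "trace (G' ** (G ** A)) = trace A"
      by (simp add: matrix_mul_assoc G')
    moreover have "trace (transpose A) = trace A"
      by (simp add: trace_def transpose_def)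
    ultimately show ?thesis by (simp add: matrix_add_ldistrib trace_add)
  qed
  moreover have "trace (G' ** (\<phi> *\<^sub>R G)) = real CARD('n) * \<phi>"
    by (simp add: matrix_scalar_ac scalar_matrix_assoc[symmetric] G' trace_def mat_def)
  ultimately show ?thesis by simp
qed

text \<open>Comparison of the coefficients of order \<open>m\<close> (for \<open>\<phi> \<noteq> 0\<close>) or \<open>m + 1\<close> (for \<open>\<phi> = 0\<close>), where
  \<open>m\<close> is the multiplicity of the root \<open>0\<close> of \<open>X\<close>, forces \<open>\<alpha>\<close> to vanish, and then
  \<open>eq\<close> leaves nothing of \<open>D\<close>.\<close>

lemma charpoly_variation_zero:
  fixes X D :: "real poly"
  assumes eq: "[:0, - 2 * \<phi>, 2:] * D = - smult \<alpha> ([:0, - \<phi>, 1:] * pderiv X - smult \<phi> X)"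
    and X: "\<And>k. k < m \<Longrightarrow> coeff X k = 0" "coeff X m \<noteq> 0" and m: "m \<noteq> 0"
    and D: "\<And>k. k < m \<Longrightarrow> coeff D k = 0"
  shows "\<alpha> = 0" "D = 0"
proof -
  obtain l where l: "m = Suc l" using m not0_implies_Suc by blast
  show \<alpha>: "\<alpha> = 0"
  proof (cases "\<phi> = 0")
    case True
    have c1: "coeff ([:0, - 2 * \<phi>, 2:] * D) (Suc m) = 2 * coeff D l"
      by (simp add: True l coeff_pCons)
    have c2: "coeff (- smult \<alpha> ([:0, - \<phi>, 1:] * pderiv X - smult \<phi> X)) (Suc m) = - \<alpha> * (real m * coeff X m)"
      by (simp add: True l coeff_pCons coeff_pderiv)
    have "2 * coeff D l = - \<alpha> * (real m * coeff X m)"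
      using c1 unfolding eq c2 by simp
    then show ?thesis using X(2) D[of l] l by simp
  next
    case False
    have c1: "coeff ([:0, - 2 * \<phi>, 2:] * D) m = 0"
      using D by (cases l) (simp_all add: l coeff_pCons)
    have c2: "coeff (- smult \<alpha> ([:0, - \<phi>, 1:] * pderiv X - smult \<phi> X)) m = \<alpha> * \<phi> * (real m + 1) * coeff X m"
      using X(1) by (cases l) (simp_all add: l coeff_pCons coeff_pderiv algebra_simps)
    have "\<alpha> * \<phi> * (real m + 1) * coeff X m = 0"
      using c1 unfolding eq c2 .
    then show ?thesis using X(2) False by auto
  qed
  have "[:0, - 2 * \<phi>, 2:] * D = 0" unfolding eq \<alpha> by simp
  then show "D = 0" by (metis mult_eq_0_iff pCons_eq_0_iff zero_neq_numeral)
qed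


section \<open>Values at the zeros of a vector field\<close>

lemma det_nonzero_left_inverse:
  fixes B :: "real ^ 'n ^ 'n"
  assumes "det B \<noteq> 0"
  obtains R where "R ** B = mat 1"
  using assms by (metis invertible_det_nz invertible_left_inverse)

text \<open>Jacobi's formula twice: for the dependence on the variable of the polynomial, and for the
  dependence on the matrix.\<close>

lemma poly_pderiv_matrix_charpoly:
  fixes A R :: "real ^ 'n ^ 'n"
  assumes R: "R ** (mat t - A) = mat 1"
  shows "poly (pderiv (matrix_charpoly A)) t = trace R * poly (matrix_charpoly A) t"
proof -
  have "((\<lambda>t. det (mat t - A)) has_derivative
      (\<lambda>h. \<Sum>i\<in>UNIV. det (\<chi> k. if k = i then (mat h :: real ^ 'n ^ 'n) $ k else (mat t - A) $ k))) (at t)"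
  proof (rule has_derivative_det)
    show "((\<lambda>t. (mat t - A) $ i $ j) has_derivative (\<lambda>h. (mat h :: real ^ 'n ^ 'n) $ i $ j)) (at t)" for i j
      by (cases "i = j") (auto simp: mat_def intro!: derivative_eq_intros)
  qed
  then have "((\<lambda>t. det (mat t - A)) has_derivative (\<lambda>h. trace (R ** mat h) * det (mat t - A))) (at t)"
    by (simp only: sum_det_replaced_rows[OF R])
  moreover have "R ** mat h = h *\<^sub>R R" for h
    by (simp add: vec_eq_iff matrix_matrix_mult_def mat_def if_distrib if_distribR cong: if_cong)
  then have "trace (R ** mat h) * det (mat t - A) = (trace R * det (mat t - A)) * h" for h
    by (simp add: trace_def sum_distrib_left[symmetric])
  ultimately have "((\<lambda>t. poly (matrix_charpoly A) t) has_real_derivative trace R * poly (matrix_charpoly A) t) (at t)"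
    unfolding has_field_derivative_def poly_matrix_charpoly by simp
  then show ?thesis
    by (rule DERIV_unique[OF poly_DERIV])
qed

lemma dird_matrix_charpoly:
  fixes N :: "'a::euclidean_space \<Rightarrow> real ^ 'n ^ 'n"
  assumes N: "\<And>i j. (\<lambda>x. N x $ i $ j) differentiable at x"
    and c: "\<And>k. (\<lambda>x. coeff (matrix_charpoly (N x)) k) differentiable at x"
    and R: "R ** (mat t - N x) = mat 1"
  shows "(\<Sum>k\<le>CARD('n). dird (\<lambda>x. coeff (matrix_charpoly (N x)) k) x u * t ^ k) =
    - trace (R ** (\<chi> i j. dird (\<lambda>x. N x $ i $ j) x u)) * poly (matrix_charpoly (N x)) t"
proof -
  let ?H = "\<lambda>u. (\<chi> i j. dird (\<lambda>x. N x $ i $ j) x u) :: real ^ 'n ^ 'n"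
  have "((\<lambda>x. det (mat t - N x)) has_derivative
      (\<lambda>u. \<Sum>i\<in>UNIV. det (\<chi> k. if k = i then (- ?H u) $ k else (mat t - N x) $ k))) (at x)"
    by (rule has_derivative_det) (auto intro!: derivative_eq_intros dird_has_derivative N)
  then have 1: "((\<lambda>x. poly (matrix_charpoly (N x)) t) has_derivative
      (\<lambda>u. trace (R ** (- ?H u)) * poly (matrix_charpoly (N x)) t)) (at x)"
    by (simp only: sum_det_replaced_rows[OF R] poly_matrix_charpoly)
  have "((\<lambda>x. \<Sum>k\<le>CARD('n). coeff (matrix_charpoly (N x)) k * t ^ k) has_derivative
      (\<lambda>u. \<Sum>k\<le>CARD('n). dird (\<lambda>x. coeff (matrix_charpoly (N x)) k) x u * t ^ k)) (at x)"
    by (intro has_derivative_sum has_derivative_mult_left dird_has_derivative c)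
  then have "((\<lambda>x. poly (matrix_charpoly (N x)) t) has_derivative
      (\<lambda>u. \<Sum>k\<le>CARD('n). dird (\<lambda>x. coeff (matrix_charpoly (N x)) k) x u * t ^ k)) (at x)"
    by (simp add: poly_eq_sum_coeff[OF degree_matrix_charpoly])
  from has_derivative_unique[OF this 1]
  have "(\<Sum>k\<le>CARD('n). dird (\<lambda>x. coeff (matrix_charpoly (N x)) k) x u * t ^ k) =
      trace (R ** (- ?H u)) * poly (matrix_charpoly (N x)) t"
    by (rule fun_cong)
  also have "R ** (- ?H u) = - (R ** ?H u)"
    by (simp add: vec_eq_iff matrix_matrix_mult_def sum_negf)
  also have "trace (- (R ** ?H u)) = - trace (R ** ?H u)"
    by (simp add: trace_def sum_negf)
  finally show ?thesis .
qed

text \<open>The hypothesis \<open>variation\<close> is what a conformal field satisfies at its zeros.  Multiplied by the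
  characteristic polynomial \<open>X\<close> of the derivative of \<open>V\<close>, it says that in a direction \<open>u\<close> tangent to
  the zero set to first order, \<open>2 t (t - \<Phi>) dX u = - d\<Phi> u (t (t - \<Phi>) X' - \<Phi> X)\<close> at \<open>t\<close>.\<close>

context
  fixes V :: "real ^ 'n::finite \<Rightarrow> real ^ 'n" and \<Phi> :: "real ^ 'n \<Rightarrow> real" and S
  assumes S: "open S" and V: "smooth_on V S" and \<Phi>: "smooth_on \<Phi> S"
    and variation: "\<And>p u t R. p \<in> S \<Longrightarrow> V p = 0 \<Longrightarrow> jac_matrix (\<lambda>i q. V q $ i) p *v u = 0 \<Longrightarrow>
      R ** (mat t - jac_matrix (\<lambda>i q. V q $ i) p) = mat 1 \<Longrightarrow> t \<noteq> 0 \<Longrightarrow> t \<noteq> \<Phi> p \<Longrightarrow>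
      2 * trace (R ** (\<chi> i j. dird (\<lambda>q. jac_matrix (\<lambda>i q. V q $ i) q $ i $ j) p u)) =
        dird \<Phi> p u * (trace R + 1 / t - 1 / (t - \<Phi> p))"
begin

abbreviation (input) "J \<equiv> jac_matrix (\<lambda>i q. V q $ i)"
abbreviation (input) "cf k p \<equiv> coeff (matrix_charpoly (J p)) k"

lemma smooth_jac: "smooth_on (\<lambda>p. J p $ i $ j) S"
  using V by (simp add: jac_matrix_def smooth_on_components[OF S] smooth_on_dird)

lemma smooth_cf: "smooth_on (cf k) S"
  by (rule smooth_on_coeff_matrix_charpoly[OF S smooth_jac])

text \<open>On the zeros where \<open>0\<close> is a root of multiplicity \<open>m\<close> of the characteristic polynomial, the
  components of \<open>V\<close> and the \<open>m\<close> lowest coefficients vanish.  A direction annihilated by their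
  differentials is one in which neither \<open>\<Phi>\<close> nor any other coefficient varies.\<close>

lemma dird_zero_on_stratum:
  assumes p: "p \<in> S" "V p = 0" and m: "\<And>k. k < m \<Longrightarrow> cf k p = 0" "cf m p \<noteq> 0"
    and u: "J p *v u = 0" "\<And>k. k < m \<Longrightarrow> dird (cf k) p u = 0"
  shows "dird \<Phi> p u = 0 \<and> dird (cf k) p u = 0"
proof (cases "m = 0")
  case True
  have "poly (matrix_charpoly (J p)) 0 \<noteq> 0" using m(2) True by (simp add: poly_0_coeff_0)
  then have "det (mat 0 - J p) \<noteq> 0" unfolding poly_matrix_charpoly .
  then obtain R where "R ** (mat 0 - J p) = mat 1" by (rule det_nonzero_left_inverse)
  then have "u = R *v ((mat 0 - J p) *v u)"
    by (simp add: matrix_vector_mul_assoc del: mat_0)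
  also have "(mat 0 - J p) *v u = 0"
    unfolding matrix_vector_mult_diff_rdistrib mat_mult_vec u(1) by simp
  finally have "u = 0" by simp
  then show ?thesis
    using linear_0[OF dird_linear[OF smooth_on_imp_differentiable[OF \<Phi> p(1)]]]
      linear_0[OF dird_linear[OF smooth_on_imp_differentiable[OF smooth_cf p(1)]]] by simp
next
  case False
  define X where "X = matrix_charpoly (J p)"
  define \<phi> where "\<phi> = \<Phi> p"
  define \<alpha> where "\<alpha> = dird \<Phi> p u"
  define D where "D = (\<Sum>k\<le>CARD('n). monom (dird (cf k) p u) k)"
  have D: "coeff D k = dird (cf k) p u" for k
  proof (cases "k \<le> CARD('n)")
    case True
    then show ?thesis by (simp add: D_def coeff_sum)
  next
    case False
    have "cf k = (\<lambda>q. 0)"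
    proof
      fix q show "cf k q = 0"
        using False degree_matrix_charpoly[of "J q"] by (intro coeff_eq_0) simp
    qed
    then show ?thesis using False by (simp add: D_def coeff_sum frechet_derivative_const)
  qed
  have polyD: "poly D t = (\<Sum>k\<le>CARD('n). dird (cf k) p u * t ^ k)" for t
    by (simp add: D_def poly_sum poly_monom)
  define P where "P = [:0, - 2 * \<phi>, 2:] * D"
  define Q where "Q = - smult \<alpha> ([:0, - \<phi>, 1:] * pderiv X - smult \<phi> X)"
  have "poly P t = poly Q t" if t: "poly X t \<noteq> 0" "t \<noteq> 0" "t \<noteq> \<phi>" for t
  proof -
    have "det (mat t - J p) \<noteq> 0"
      using t(1) by (simp add: X_def poly_matrix_charpoly)
    then obtain R where R: "R ** (mat t - J p) = mat 1" by (rule det_nonzero_left_inverse)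
    let ?H = "\<chi> i j. dird (\<lambda>q. J q $ i $ j) p u"
    have 1: "poly D t = - trace (R ** ?H) * poly X t"
      unfolding polyD X_def
      by (rule dird_matrix_charpoly[where N = J, OF _ _ R])
        (intro smooth_on_imp_differentiable[OF _ p(1)] smooth_jac smooth_cf)+
    have 2: "poly (pderiv X) t = trace R * poly X t"
      unfolding X_def by (rule poly_pderiv_matrix_charpoly[OF R])
    have 3: "2 * trace (R ** ?H) = \<alpha> * (trace R + 1 / t - 1 / (t - \<phi>))"
      unfolding \<alpha>_def \<phi>_def by (rule variation[OF p u(1) R t(2)]) (use t(3) \<phi>_def in simp)
    have "poly P t = - (2 * trace (R ** ?H)) * (t * (t - \<phi>)) * poly X t"
      by (simp add: P_def 1 algebra_simps)
    also have "\<dots> = - \<alpha> * (trace R * (t * (t - \<phi>)) - \<phi>) * poly X t"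
      unfolding 3 using t(2,3) by (simp add: field_simps)
    also have "\<dots> = poly Q t"
      by (simp add: Q_def 2 algebra_simps)
    finally show ?thesis .
  qed
  \<comment> \<open>The extra factor covers the values of \<open>t\<close> excluded above.\<close>
  then have "poly ((P - Q) * (X * ([:0, 1:] * [:- \<phi>, 1:]))) t = 0" for t
    by (cases "poly X t = 0 \<or> t = 0 \<or> t = \<phi>") auto
  then have "(P - Q) * (X * ([:0, 1:] * [:- \<phi>, 1:])) = 0"
    using poly_all_0_iff_0 by blast
  moreover have "X \<noteq> 0" unfolding X_def by (rule matrix_charpoly_nonzero)
  ultimately have PQ: "P = Q"
    by (simp only: mult_eq_0_iff pCons_eq_0_iff right_minus_eq) simp
  have "\<alpha> = 0" "D = 0"
    by (rule charpoly_variation_zero[OF PQ[unfolded P_def Q_def] _ _ False],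
        use m u(2) D in \<open>simp_all add: X_def\<close>)+
  then show ?thesis
    using D[of k] by (simp add: \<alpha>_def)
qed

text \<open>Each stratum is a set to which the Sard theorem applies, and there are countably many.\<close>

lemma negligible_values_at_zeros:
  shows "negligible (\<Phi> ` {p\<in>S. V p = 0})" and "negligible (cf k ` {p\<in>S. V p = 0})"
proof -
  define Z where "Z m = {p\<in>S. V p = 0 \<and> (\<forall>k<m. cf k p = 0) \<and> cf m p \<noteq> 0}" for m
  have cover: "{p\<in>S. V p = 0} = (\<Union>m. Z m)"
  proof (intro set_eqI iffI)
    fix p assume p: "p \<in> {p\<in>S. V p = 0}"
    have ex: "\<exists>k. cf k p \<noteq> 0"
      using matrix_charpoly_nonzero[of "J p"] by (metis leading_coeff_0_iff)
    define m where "m = (LEAST k. cf k p \<noteq> 0)"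
    have "cf m p \<noteq> 0"
      unfolding m_def by (rule LeastI_ex[OF ex])
    moreover have "\<forall>k<m. cf k p = 0"
      using not_less_Least unfolding m_def by blast
    ultimately have "p \<in> Z m"
      using p by (simp add: Z_def)
    then show "p \<in> (\<Union>m. Z m)" by blast
  qed (auto simp: Z_def)
  have crit: "critical_along S (Z m) F" if F: "F = \<Phi> \<or> F = cf k" for F m
    unfolding critical_along_def
  proof (intro ballI allI impI)
    fix p u assume p: "p \<in> Z m"
      and h: "\<forall>h::real ^ 'n \<Rightarrow> real. smooth_on h S \<longrightarrow> (\<forall>y\<in>Z m. h y = 0) \<longrightarrow> dird h p u = 0"
    have pS: "p \<in> S" using p by (simp add: Z_def)
    have "dird (\<lambda>q. V q $ i) p u = 0" for i
      using h V by (auto simp: Z_def smooth_on_components[OF S])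
    then have "J p *v u = 0"
      using jac_matrix_mult[of "\<lambda>i q. V q $ i" p u] V
      by (simp add: vec_eq_iff smooth_on_components[OF S] smooth_on_imp_differentiable[OF _ pS])
    moreover have "dird (cf k) p u = 0" if "k < m" for k
      using h smooth_cf[of k] that by (auto simp: Z_def)
    ultimately have "dird \<Phi> p u = 0 \<and> dird (cf k) p u = 0"
      using p by (intro dird_zero_on_stratum[of p m]) (auto simp: Z_def)
    then show "dird F p u = 0" using F by auto
  qed
  have "negligible (F ` {p\<in>S. V p = 0})" if F: "F = \<Phi> \<or> F = cf k" for F
  proof -
    have "smooth_on F S" using F \<Phi> smooth_cf by auto
    then have "negligible (F ` Z m)" for m
      by (intro negligible_critical_values[OF S _ _ crit[OF F]]) (auto simp: Z_def)
    then have "negligible (\<Union>m. F ` Z m)"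
      by (intro negligible_countable_Union) auto
    then show ?thesis unfolding cover image_UN .
  qed
  then show "negligible (\<Phi> ` {p\<in>S. V p = 0})" and "negligible (cf k ` {p\<in>S. V p = 0})" by auto
qed

end


section \<open>The second derivative of a conformal field at a zero\<close>

lemma dird_component:
  fixes V :: "'a::real_normed_vector \<Rightarrow> real ^ 'n"
  assumes "V differentiable at p"
  shows "(\<lambda>q. V q $ i) differentiable at p" "dird (\<lambda>q. V q $ i) p u = dird V p u $ i"
proof -
  have "((\<lambda>q. V q $ i) has_derivative (\<lambda>u. dird V p u $ i)) (at p)"
    using bounded_linear.has_derivative[OF bounded_linear_vec_nth dird_has_derivative[OF assms]] .
  then show "(\<lambda>q. V q $ i) differentiable at p" "dird (\<lambda>q. V q $ i) p u = dird V p u $ i"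
    by (auto simp: differentiable_def dird_eqI)
qed

lemma jac_matrix_component_mult:
  fixes V :: "real ^ 'n \<Rightarrow> real ^ 'n"
  assumes "V differentiable at p"
  shows "jac_matrix (\<lambda>i q. V q $ i) p *v u = dird V p u"
  by (simp add: vec_eq_iff jac_matrix_mult dird_component[OF assms])

text \<open>A tensor \<open>T\<close> symmetric in its first two arguments is determined by its symmetrization in the
  last two, as in the Koszul formula.\<close>

lemma koszul_solve:
  fixes T :: "'v \<Rightarrow> 'v \<Rightarrow> 'v \<Rightarrow> real"
  assumes "\<And>u w t. T u w t = T w u t" "\<And>u w t. T u w t + T u t w = \<alpha> u * b w t" "\<And>w t. b w t = b t w"
  shows "2 * T u w t = \<alpha> u * b w t + \<alpha> w * b u t - \<alpha> t * b u w"
  using assms(1)[of u t w] assms(1)[of t w u] assms(1)[of w u t]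
    assms(2)[of u w t] assms(2)[of t u w] assms(2)[of w t u] assms(3)[of t u]
  by (simp add: assms(1)[of t w u])

text \<open>The metric has the coefficients \<open>b\<close> and the equation \<open>conformal\<close> is the coordinate form of
  \<open>\<L>\<^sub>V b = \<Phi> b\<close>.\<close>

context
  fixes S :: "(real ^ 'n::finite) set" and b :: "real ^ 'n \<Rightarrow> real ^ 'n \<Rightarrow> real ^ 'n \<Rightarrow> real"
    and V :: "real ^ 'n \<Rightarrow> real ^ 'n" and \<Phi> :: "real ^ 'n \<Rightarrow> real"
  assumes S: "open S" and V: "smooth_on V S" and \<Phi>: "smooth_on \<Phi> S"
    and b: "\<And>w t. smooth_on (\<lambda>q. b q w t) S" "\<And>q w. q \<in> S \<Longrightarrow> linear (b q w)"
      "\<And>q w t. q \<in> S \<Longrightarrow> b q w t = b q t w"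
    and conformal: "\<And>q w t. q \<in> S \<Longrightarrow>
      dird (\<lambda>r. b r w t) q (V q) + b q (dird V q w) t + b q w (dird V q t) = \<Phi> q * b q w t"
begin

lemma V_differentiable: "q \<in> S \<Longrightarrow> V differentiable at q"
  by (rule smooth_on_imp_differentiable[OF V])

lemma second_dird_symmetric:
  assumes "p \<in> S"
  shows "dird (\<lambda>q. dird V q w) p u = dird (\<lambda>q. dird V q u) p w"
proof -
  have sm: "smooth_on (\<lambda>q. V q $ i) S" for i
    using V by (simp add: smooth_on_components[OF S])
  have eq: "dird (\<lambda>q. dird V q w) p u $ i = dird (\<lambda>q. dird (\<lambda>r. V r $ i) q w) p u" for i w u
  proof -
    have "dird (\<lambda>q. dird V q w) p u $ i = dird (\<lambda>q. dird V q w $ i) p u"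
      by (rule dird_component(2)[symmetric]) (rule smooth_on_imp_differentiable[OF smooth_on_dird[OF V] assms])
    also have "\<dots> = dird (\<lambda>q. dird (\<lambda>r. V r $ i) q w) p u"
      by (rule dird_transform(2)[OF S assms])
        (simp_all add: dird_component(2) V_differentiable smooth_on_imp_differentiable[OF smooth_on_dird[OF sm] assms])
    finally show ?thesis .
  qed
  show ?thesis
    by (simp add: vec_eq_iff eq) (metis symmetric_second_dird[OF S assms sm])
qed

text \<open>The derivative of the conformal equation in the direction \<open>u\<close>.  The second derivatives of the
  metric do not enter, as they are multiplied by \<open>V p = 0\<close>.\<close>

lemma conformal_differentiated:
  assumes p: "p \<in> S" "V p = 0"
  shows "dird (\<lambda>r. b r w t) p (dird V p u)
      + b p (dird (\<lambda>q. dird V q w) p u) t + dird (\<lambda>r. b r (dird V p w) t) p u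
      + b p w (dird (\<lambda>q. dird V q t) p u) + dird (\<lambda>r. b r w (dird V p t)) p u
    = dird \<Phi> p u * b p w t + \<Phi> p * dird (\<lambda>r. b r w t) p u"
proof -
  have db: "(\<lambda>r. b r w t) differentiable at q" if "q \<in> S" for w t q
    by (rule smooth_on_imp_differentiable[OF b(1) that])
  have lin: "b q w (\<Sum>k\<in>UNIV. x $ k *\<^sub>R axis k 1) = (\<Sum>k\<in>UNIV. x $ k * b q w (axis k 1))" if "q \<in> S" for q w x
    by (simp add: linear_sum[OF b(2)[OF that]] linear_scale[OF b(2)[OF that]])
  have exp2: "b q w x = (\<Sum>k\<in>UNIV. x $ k * b q w (axis k 1))" if "q \<in> S" for q w x
    using lin[OF that, of w x] by (simp only: vec_axis_sum[symmetric])
  have exp1: "b q x t = (\<Sum>k\<in>UNIV. x $ k * b q (axis k 1) t)" if "q \<in> S" for q x t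
    using exp2[OF that, of t x] by (simp add: b(3)[OF that])
  have dexp2: "dird (\<lambda>r. b r w x) p u = (\<Sum>k\<in>UNIV. x $ k * dird (\<lambda>r. b r w (axis k 1)) p u)" for w x u
  proof -
    have "((\<lambda>r. \<Sum>k\<in>UNIV. x $ k * b r w (axis k 1)) has_derivative
        (\<lambda>u. \<Sum>k\<in>UNIV. x $ k * dird (\<lambda>r. b r w (axis k 1)) p u)) (at p)"
      by (intro has_derivative_sum has_derivative_mult_right dird_has_derivative db p)
    then have "((\<lambda>r. b r w x) has_derivative
        (\<lambda>u. \<Sum>k\<in>UNIV. x $ k * dird (\<lambda>r. b r w (axis k 1)) p u)) (at p)"
      by (rule has_derivative_transform_within_open[OF _ S p(1)]) (simp add: exp2)
    then show ?thesis by (rule dird_eqI)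
  qed
  have dexp1: "dird (\<lambda>r. b r x t) p u = (\<Sum>k\<in>UNIV. x $ k * dird (\<lambda>r. b r (axis k 1) t) p u)" for t x u
  proof -
    have sw: "dird (\<lambda>r. b r t x) p u = dird (\<lambda>r. b r x t) p u" for t x
      by (rule dird_transform(2)[OF S p(1) _ db[OF p(1)]]) (rule b(3))
    show ?thesis using dexp2[of t x u] by (simp add: sw)
  qed
  define D where "D w = (\<lambda>q. dird V q w)" for w
  have dD: "((\<lambda>q. D w q $ k) has_derivative (\<lambda>u. dird (D w) p u $ k)) (at p)" for w k
    unfolding D_def
    by (rule bounded_linear.has_derivative[OF bounded_linear_vec_nth dird_has_derivative])
      (rule smooth_on_imp_differentiable[OF smooth_on_dird[OF V] p(1)])
  have dV: "((\<lambda>q. V q $ k) has_derivative (\<lambda>u. dird V p u $ k)) (at p)" for k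
    by (rule bounded_linear.has_derivative[OF bounded_linear_vec_nth
        dird_has_derivative[OF V_differentiable[OF p(1)]]])
  \<comment> \<open>The conformal equation, expanded in components so that the product rule applies.\<close>
  define F where "F q = (\<Sum>k\<in>UNIV. V q $ k * dird (\<lambda>r. b r w t) q (axis k 1))
    + (\<Sum>k\<in>UNIV. D w q $ k * b q (axis k 1) t) + (\<Sum>k\<in>UNIV. D t q $ k * b q w (axis k 1))
    - \<Phi> q * b q w t" for q
  have F0: "F q = 0" if "q \<in> S" for q
  proof -
    have "(\<Sum>k\<in>UNIV. V q $ k * dird (\<lambda>r. b r w t) q (axis k 1)) = dird (\<lambda>r. b r w t) q (V q)"
      using dird_axis_sum[OF db[OF that], of w t "V q"] by simp
    then show ?thesis
      using conformal[OF that, of w t] exp1[OF that, of "D w q" t] exp2[OF that, of w "D t q"]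
      by (simp add: F_def D_def)
  qed
  have "(F has_derivative (\<lambda>u.
      (\<Sum>k\<in>UNIV. V p $ k * dird (\<lambda>q. dird (\<lambda>r. b r w t) q (axis k 1)) p u + dird V p u $ k * dird (\<lambda>r. b r w t) p (axis k 1))
    + (\<Sum>k\<in>UNIV. D w p $ k * dird (\<lambda>r. b r (axis k 1) t) p u + dird (D w) p u $ k * b p (axis k 1) t)
    + (\<Sum>k\<in>UNIV. D t p $ k * dird (\<lambda>r. b r w (axis k 1)) p u + dird (D t) p u $ k * b p w (axis k 1))
    - (\<Phi> p * dird (\<lambda>r. b r w t) p u + dird \<Phi> p u * b p w t))) (at p)"
    unfolding F_def[abs_def]
    by (intro has_derivative_diff has_derivative_add has_derivative_sum has_derivative_mult dV dD
        dird_has_derivative db p smooth_on_imp_differentiable[OF \<Phi>]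
        smooth_on_imp_differentiable[OF smooth_on_dird[OF b(1)]])
  moreover have "(F has_derivative (\<lambda>u. 0)) (at p)"
    by (rule has_derivative_transform_within_open[OF has_derivative_const[of 0] S p(1)]) (simp add: F0)
  ultimately have "(\<Sum>k\<in>UNIV. V p $ k * dird (\<lambda>q. dird (\<lambda>r. b r w t) q (axis k 1)) p u + dird V p u $ k * dird (\<lambda>r. b r w t) p (axis k 1))
    + (\<Sum>k\<in>UNIV. D w p $ k * dird (\<lambda>r. b r (axis k 1) t) p u + dird (D w) p u $ k * b p (axis k 1) t)
    + (\<Sum>k\<in>UNIV. D t p $ k * dird (\<lambda>r. b r w (axis k 1)) p u + dird (D t) p u $ k * b p w (axis k 1))
    - (\<Phi> p * dird (\<lambda>r. b r w t) p u + dird \<Phi> p u * b p w t) = 0"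
    using has_derivative_unique by (metis (no_types, lifting))
  moreover have "dird (\<lambda>r. b r w t) p (dird V p u) = (\<Sum>k\<in>UNIV. dird V p u $ k * dird (\<lambda>r. b r w t) p (axis k 1))"
    using dird_axis_sum[OF db[OF p(1)], of w t "dird V p u"] by simp
  moreover have "D w p = dird V p w" "D t p = dird V p t" by (simp_all add: D_def)
  ultimately show ?thesis
    using exp1[OF p(1), of "dird (D w) p u" t] exp2[OF p(1), of w "dird (D t) p u"]
      dexp1[of "dird V p w" t u] dexp2[of w "dird V p t" u]
    by (simp add: p(2) sum.distrib D_def[symmetric])
qed

text \<open>In terms of a torsion-free metric connection \<open>\<Gamma>\<close> at \<open>p\<close>, the left-hand side below is the
  covariant derivative of \<open>\<nabla>V\<close> in the direction \<open>u\<close>.  It is symmetric in \<open>u\<close> and \<open>w\<close> because \<open>V\<close>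
  vanishes at \<open>p\<close>, which removes the curvature term.\<close>

lemma covariant_second_derivative:
  assumes p: "p \<in> S" "V p = 0"
    and \<Gamma>: "\<And>w. linear (\<Gamma> w)" "\<And>w s. \<Gamma> w s = \<Gamma> s w"
      "\<And>w t u. dird (\<lambda>r. b r w t) p u = b p (\<Gamma> w u) t + b p w (\<Gamma> t u)"
  shows "2 * b p (dird (\<lambda>q. dird V q w) p u + \<Gamma> w (dird V p u) + \<Gamma> u (dird V p w) - dird V p (\<Gamma> u w)) t
    = dird \<Phi> p u * b p w t + dird \<Phi> p w * b p u t - dird \<Phi> p t * b p u w"
proof -
  define C where "C u w = dird (\<lambda>q. dird V q w) p u + \<Gamma> w (dird V p u) + \<Gamma> u (dird V p w) - dird V p (\<Gamma> u w)" for u w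
  have l2: "linear (b p w)" for w by (rule b(2)[OF p(1)])
  have "(\<lambda>w. b p w t) = b p t" for t by (rule ext) (rule b(3)[OF p(1)])
  then have l1: "linear (\<lambda>w. b p w t)" for t using l2 by simp
  have "dird V p 0 = 0"
    using linear_0[OF dird_linear[OF V_differentiable[OF p(1)]]] .
  have E: "b p (dird V p w) t + b p w (dird V p t) = \<Phi> p * b p w t" for w t
  proof -
    have "dird (\<lambda>r. b r w t) p (V p) = 0"
      using linear_0[OF dird_linear[OF smooth_on_imp_differentiable[OF b(1) p(1)]]] by (simp add: p(2))
    then show ?thesis using conformal[OF p(1), of w t] by simp
  qed
  have sym: "C u w = C w u" for u w
    by (simp add: C_def second_dird_symmetric[OF p(1), of w u] \<Gamma>(2)[of u w])
  have "b p (C u w) t + b p (C u t) w = dird \<Phi> p u * b p w t" for u w t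
  proof -
    have "\<Phi> p * b p (\<Gamma> w u) t = b p (dird V p (\<Gamma> w u)) t + b p (\<Gamma> w u) (dird V p t)"
      "\<Phi> p * b p w (\<Gamma> t u) = b p (dird V p w) (\<Gamma> t u) + b p w (dird V p (\<Gamma> t u))"
      using E by simp_all
    moreover have "b p (C u t) w = b p w (C u t)" by (rule b(3)[OF p(1)])
    ultimately show ?thesis
      using conformal_differentiated[OF p, of w t u]
      unfolding C_def
      by (simp add: linear_add[OF l1] linear_diff[OF l1] linear_add[OF l2] linear_diff[OF l2] \<Gamma>(3)
          \<Gamma>(2)[of u] distrib_left)
  qed
  from koszul_solve[of "\<lambda>u w. b p (C u w)" "dird \<Phi> p" "b p", OF _ this b(3)[OF p(1)]] sym
  show ?thesis unfolding C_def by simp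
qed

lemma trace_resolvent_second_derivative:
  assumes p: "p \<in> S" "V p = 0" and nd: "\<And>w. (\<And>t. b p w t = 0) \<Longrightarrow> w = 0"
    and \<Gamma>: "\<And>w. linear (\<Gamma> w)" "\<And>w s. \<Gamma> w s = \<Gamma> s w"
      "\<And>w t u. dird (\<lambda>r. b r w t) p u = b p (\<Gamma> w u) t + b p w (\<Gamma> t u)"
    and u: "jac_matrix (\<lambda>i q. V q $ i) p *v u = 0"
    and R: "R ** (mat \<tau> - jac_matrix (\<lambda>i q. V q $ i) p) = mat 1" and \<tau>: "\<tau> \<noteq> 0" "\<tau> \<noteq> \<Phi> p"
  shows "2 * trace (R ** (\<chi> i j. dird (\<lambda>q. jac_matrix (\<lambda>i q. V q $ i) q $ i $ j) p u)) =
    dird \<Phi> p u * (trace R + 1 / \<tau> - 1 / (\<tau> - \<Phi> p))"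
proof (rule trace_resolvent_conformal[where b = "b p" and \<alpha> = "dird \<Phi> p" and G = "matrix (\<Gamma> u)" and u = u, OF _ _ nd _ _ _ u R \<tau>])
  let ?J = "jac_matrix (\<lambda>i q. V q $ i)"
  let ?H = "\<chi> i j. dird (\<lambda>q. ?J q $ i $ j) p u"
  have J: "?J q *v w = dird V q w" if "q \<in> S" for q w
    by (rule jac_matrix_component_mult[OF V_differentiable[OF that]])
  have dD: "(\<lambda>q. dird V q w) differentiable at p" for w
    by (rule smooth_on_imp_differentiable[OF smooth_on_dird[OF V] p(1)])
  have H: "?H *v w = dird (\<lambda>q. dird V q w) p u" for w
  proof -
    have "(?H *v w) $ i = dird (\<lambda>q. dird V q w) p u $ i" for i
    proof -
      have dJ: "(\<lambda>q. ?J q $ i $ j) differentiable at p" for j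
      proof (rule smooth_on_imp_differentiable[OF _ p(1)])
        show "smooth_on (\<lambda>q. ?J q $ i $ j) S"
          using V by (simp add: jac_matrix_def smooth_on_components[OF S] smooth_on_dird)
      qed
      have "((\<lambda>q. \<Sum>j\<in>UNIV. ?J q $ i $ j * w $ j) has_derivative (\<lambda>u. \<Sum>j\<in>UNIV. dird (\<lambda>q. ?J q $ i $ j) p u * w $ j)) (at p)"
        by (intro has_derivative_sum has_derivative_mult_left dird_has_derivative dJ)
      then have "((\<lambda>q. dird V q w $ i) has_derivative (\<lambda>u. \<Sum>j\<in>UNIV. dird (\<lambda>q. ?J q $ i $ j) p u * w $ j)) (at p)"
        by (rule has_derivative_transform_within_open[OF _ S p(1)])
          (simp add: J[symmetric] matrix_vector_mult_def)
      then have "dird (\<lambda>q. dird V q w $ i) p u = (?H *v w) $ i"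
        by (simp add: dird_eqI matrix_vector_mult_def)
      then show ?thesis by (simp add: dird_component(2)[OF dD])
    qed
    then show ?thesis by (simp add: vec_eq_iff)
  qed
  have l\<Gamma>: "matrix (\<Gamma> u) *v w = \<Gamma> u w" for w
    by (rule matrix_works) (simp add: linear_matrix_vector_mul_eq \<Gamma>(1))
  have Vu: "dird V p u = 0" using u J[OF p(1)] by simp
  show "linear (b p w)" for w by (rule b(2)[OF p(1)])
  show "b p w t = b p t w" for w t by (rule b(3)[OF p(1)])
  show "linear (dird \<Phi> p)" by (rule dird_linear[OF smooth_on_imp_differentiable[OF \<Phi> p(1)]])
  show "b p (?J p *v w) t + b p w (?J p *v t) = \<Phi> p * b p w t" for w t
  proof -
    have "dird (\<lambda>r. b r w t) p (V p) = 0"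
      using linear_0[OF dird_linear[OF smooth_on_imp_differentiable[OF b(1) p(1)]]] by (simp add: p(2))
    then show ?thesis using conformal[OF p(1), of w t] by (simp add: J p(1))
  qed
  show "2 * b p ((?H + matrix (\<Gamma> u) ** ?J p - ?J p ** matrix (\<Gamma> u)) *v w) t =
      dird \<Phi> p u * b p w t + dird \<Phi> p w * b p u t - dird \<Phi> p t * b p u w" for w t
    using covariant_second_derivative[OF p \<Gamma>, of w u t] linear_0[OF \<Gamma>(1)[of w]]
    by (simp add: matrix_vector_mult_diff_rdistrib matrix_vector_mult_add_rdistrib
        matrix_vector_mul_assoc[symmetric] H l\<Gamma> J p(1) Vu)
qed

end


section \<open>Conformal fields in a chart\<close>

lemma vector_field_on_subset:
  "vector_field_on A U X \<Longrightarrow> U' \<subseteq> U \<Longrightarrow> vector_field_on A U' X"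
  unfolding vector_field_on_def by (meson Int_mono image_mono smooth_on_subset subset_iff subset_refl)

context
  fixes M :: "'a topology" and A :: "('a, 'n::finite) chart set"
  assumes man: "smooth_manifold M A"
begin

lemma chart_coordinate:
  assumes "c \<in> A" "p \<in> cmap c ` cdom c"
  shows "cinv c p \<in> cdom c" "cmap c (cinv c p) = p"
  using assms by (auto simp: cinv_cmap[OF man])

text \<open>In another chart \<open>d\<close> the components of this field are the derivative in the direction \<open>w\<close> of the
  transition map from \<open>c\<close> to \<open>d\<close>, composed with the transition map back, hence smooth.\<close>

lemma vector_field_on_coord_vector:
  assumes c: "c \<in> A"
  shows "vector_field_on A (cdom c) (\<lambda>x. coord_vector A c x w)"
  unfolding vector_field_on_def
proof (intro conjI ballI)
  show "coord_vector A c x w \<in> tangent_space A x" if "x \<in> cdom c" for x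
    by (rule coord_vector_in_tangent_space[OF man c that])
next
  fix d assume d: "d \<in> A"
  let ?S = "cmap d ` (cdom c \<inter> cdom d)" and ?T = "cmap c ` (cdom c \<inter> cdom d)"
  have oS: "open ?S"
    using open_overlap[OF man d chart_openin[OF man c] d] by (simp add: Int_assoc)
  have oT: "open ?T"
    using open_overlap[OF man c chart_openin[OF man c] d] by simp
  have "smooth_on (\<lambda>p. coord_vector A c (cinv d p) w d $ i) ?S" for i
  proof (rule smooth_on_cong[OF oS])
    have "smooth_on (\<lambda>q. dird (transition c d) q w) ?T"
      by (rule smooth_on_dird[OF transition_smooth[OF man c d]])
    then have "smooth_on (\<lambda>q. dird (transition c d) q w $ i) ?T"
      by (rule smooth_on_components[OF oT, THEN iffD1, rule_format])
    moreover have "smooth_on (transition d c) ?S"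
      using transition_smooth[OF man d c] by (simp add: Int_commute)
    moreover have "transition d c ` ?S \<subseteq> ?T"
      using c d by (auto simp: transition_def cinv_cmap[OF man])
    ultimately show "smooth_on (\<lambda>p. dird (transition c d) (transition d c p) w $ i) ?S"
      by (intro smooth_on_compose[OF oS])
  next
    show "dird (transition c d) (transition d c p) w $ i = coord_vector A c (cinv d p) w d $ i"
      if "p \<in> ?S" for p
      using that d by (auto simp: coord_vector_def transition_def cinv_cmap[OF man])
  qed
  then show "smooth_on (\<lambda>p. coord_vector A c (cinv d p) w d) ?S"
    by (intro smooth_on_components[OF oS, THEN iffD2] allI)
qed

lemma lie_bracket_coord_vector:
  assumes c: "c \<in> A" and x: "x \<in> cdom c"
  shows "lie_bracket A (\<lambda>x. coord_vector A c x w) Y x c = dird (\<lambda>p. Y (cinv c p) c) (cmap c x) w"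
proof -
  have "dird (\<lambda>p. coord_vector A c (cinv c p) w c) (cmap c x) z = dird (\<lambda>p. w) (cmap c x) z" for z
  proof (rule dird_transform(2)[OF chart_open[OF man c]])
    show "w = coord_vector A c (cinv c p) w c" if "p \<in> cmap c ` cdom c" for p
      using chart_coordinate(1)[OF c that] by (simp add: coord_vector_self[OF man c])
  qed (use x in simp_all)
  then show ?thesis
    using c x by (simp add: lie_bracket_def coord_vector_self[OF man c x] frechet_derivative_const)
qed

context
  fixes g :: "'a \<Rightarrow> ('a, 'n) tangent \<Rightarrow> ('a, 'n) tangent \<Rightarrow> real"
    and nabla :: "('a \<Rightarrow> ('a, 'n) tangent) \<Rightarrow> 'a \<Rightarrow> ('a, 'n) tangent \<Rightarrow> ('a, 'n) tangent"
    and v :: "'a \<Rightarrow> ('a, 'n) tangent" and \<phi> :: "'a \<Rightarrow> real"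
    and c :: "('a, 'n) chart"
  assumes metric: "pseudo_riemannian_metric M A g"
    and lc: "levi_civita_connection M A g nabla"
    and conf: "conformal_vector_field M A g v \<phi>"
    and c: "c \<in> A"
begin

definition metric_coeff :: "real ^ 'n \<Rightarrow> real ^ 'n \<Rightarrow> real ^ 'n \<Rightarrow> real" where
  "metric_coeff p w t = g (cinv c p) (coord_vector A c (cinv c p) w) (coord_vector A c (cinv c p) t)"

text \<open>The Christoffel symbols as a bilinear map: the derivative in the direction \<open>s\<close> of the
  coordinate field with components \<open>w\<close>.\<close>

definition christoffel :: "'a \<Rightarrow> real ^ 'n \<Rightarrow> real ^ 'n \<Rightarrow> real ^ 'n" where
  "christoffel x w s = nabla (\<lambda>x. coord_vector A c x w) x (coord_vector A c x s) c"

definition field_coeff :: "real ^ 'n \<Rightarrow> real ^ 'n" where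
  "field_coeff p = v (cinv c p) c"

definition nabla_coeff :: "'a \<Rightarrow> real ^ 'n \<Rightarrow> real ^ 'n" where
  "nabla_coeff x w = nabla v x (coord_vector A c x w) c"

abbreviation (input) "X w \<equiv> (\<lambda>x. coord_vector A c x w)"

lemma oc: "openin M (cdom c)" and oS: "open (cmap c ` cdom c)"
  by (rule chart_openin[OF man c], rule chart_open[OF man c])

lemmas X_field = vector_field_on_coord_vector[OF c]
lemmas X_tangent = coord_vector_in_tangent_space[OF man c]
lemmas X_self = coord_vector_self[OF man c]
lemmas X_component = coord_vector_component[OF man c]
lemmas X_linear = coord_vector_linear[OF man c]

lemma v_field: "vector_field_on A (cdom c) v"
  using conf vector_field_on_subset openin_subset[OF oc] unfolding conformal_vector_field_def by blast

lemma affine: "affine_connection M A nabla"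
  using lc unfolding levi_civita_connection_def by (rule conjunct1)

lemmas affine_at = affine[unfolded affine_connection_def, THEN spec[where x = "cdom c"], THEN spec,
    THEN mp, OF oc, THEN mp]

lemma nabla_endomorphism:
  assumes "vector_field_on A (cdom c) Y" "x \<in> cdom c"
  shows "tangent_endomorphism A x (nabla Y x)"
  by (rule affine_at[OF assms(1), THEN conjunct1, rule_format, OF assms(2)])

lemma nabla_field:
  assumes "vector_field_on A (cdom c) Y" "vector_field_on A (cdom c) Z"
  shows "vector_field_on A (cdom c) (\<lambda>x. nabla Y x (Z x))"
  by (rule affine_at[OF assms(1), THEN conjunct2, THEN conjunct1, THEN spec, THEN mp, OF assms(2)])

lemma nabla_tangent:
  assumes "vector_field_on A (cdom c) Y" "x \<in> cdom c" "\<xi> \<in> tangent_space A x"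
  shows "nabla Y x \<xi> \<in> tangent_space A x"
  using nabla_endomorphism[OF assms(1,2)] assms(3) unfolding tangent_endomorphism_def by blast

lemma nabla_linear:
  assumes Y: "vector_field_on A (cdom c) Y" and x: "x \<in> cdom c"
  shows "linear (\<lambda>s. nabla Y x (coord_vector A c x s) c)"
proof (rule linearI)
  fix s t r
  show "nabla Y x (coord_vector A c x (s + t)) c = nabla Y x (coord_vector A c x s) c + nabla Y x (coord_vector A c x t) c"
    using nabla_endomorphism[OF Y x] X_tangent[OF x]
    by (simp add: X_linear[OF x] tangent_endomorphism_def) (simp add: tadd_def)
  show "nabla Y x (coord_vector A c x (r *\<^sub>R s)) c = r *\<^sub>R nabla Y x (coord_vector A c x s) c"
    using nabla_endomorphism[OF Y x] X_tangent[OF x]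
    by (simp add: X_linear[OF x] tangent_endomorphism_def) (simp add: tscale_def)
qed

lemma torsion_free:
  assumes "vector_field_on A (cdom c) Y" "vector_field_on A (cdom c) Z" "x \<in> cdom c"
  shows "nabla Z x (Y x) = tadd (nabla Y x (Z x)) (lie_bracket A Y Z x)"
  by (rule lc[unfolded levi_civita_connection_def, THEN conjunct2, THEN conjunct1, THEN spec, THEN spec,
        THEN spec, THEN mp, OF oc, THEN mp, OF assms(1), THEN mp, OF assms(2), THEN bspec, OF assms(3)])

lemma metric_compatible:
  assumes "vector_field_on A (cdom c) Y" "vector_field_on A (cdom c) Z" "x \<in> cdom c" "\<xi> \<in> tangent_space A x"
  shows "dirderiv A (\<lambda>y. g y (Y y) (Z y)) x \<xi> = g x (nabla Y x \<xi>) (Z x) + g x (Y x) (nabla Z x \<xi>)"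
  by (rule lc[unfolded levi_civita_connection_def, THEN conjunct2, THEN conjunct2, THEN spec, THEN spec,
        THEN spec, THEN mp, OF oc, THEN mp, OF assms(1), THEN mp, OF assms(2), THEN bspec, OF assms(3),
        THEN bspec, OF assms(4)])

lemma metric_smooth: "smooth_function_on A (cdom c) (\<lambda>x. g x (X w x) (X t x))"
  by (rule metric[unfolded pseudo_riemannian_metric_def, THEN conjunct2, THEN spec, THEN spec, THEN spec,
        THEN mp, OF oc, THEN mp, OF X_field, THEN mp, OF X_field])

lemma
  assumes "x \<in> cdom c"
  shows metric_sym: "\<xi> \<in> tangent_space A x \<Longrightarrow> \<eta> \<in> tangent_space A x \<Longrightarrow> g x \<xi> \<eta> = g x \<eta> \<xi>"
    and metric_add: "\<xi> \<in> tangent_space A x \<Longrightarrow> \<eta> \<in> tangent_space A x \<Longrightarrow> \<zeta> \<in> tangent_space A x \<Longrightarrow>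
      g x (tadd \<xi> \<eta>) \<zeta> = g x \<xi> \<zeta> + g x \<eta> \<zeta>"
    and metric_scale: "\<xi> \<in> tangent_space A x \<Longrightarrow> \<eta> \<in> tangent_space A x \<Longrightarrow> g x (tscale r \<xi>) \<eta> = r * g x \<xi> \<eta>"
    and metric_nondegenerate: "\<xi> \<in> tangent_space A x \<Longrightarrow> (\<And>\<eta>. \<eta> \<in> tangent_space A x \<Longrightarrow> g x \<xi> \<eta> = 0) \<Longrightarrow> \<xi> = tzero"
proof -
  have "x \<in> topspace M" using openin_subset[OF oc] assms by blast
  then have *: "(\<forall>\<xi>\<in>tangent_space A x. \<forall>\<eta>\<in>tangent_space A x. g x \<xi> \<eta> = g x \<eta> \<xi>) \<and>
        (\<forall>\<xi>\<in>tangent_space A x. \<forall>\<eta>\<in>tangent_space A x. \<forall>\<zeta>\<in>tangent_space A x.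
           g x (tadd \<xi> \<eta>) \<zeta> = g x \<xi> \<zeta> + g x \<eta> \<zeta>) \<and>
        (\<forall>r. \<forall>\<xi>\<in>tangent_space A x. \<forall>\<eta>\<in>tangent_space A x. g x (tscale r \<xi>) \<eta> = r * g x \<xi> \<eta>) \<and>
        (\<forall>\<xi>\<in>tangent_space A x. (\<forall>\<eta>\<in>tangent_space A x. g x \<xi> \<eta> = 0) \<longrightarrow> \<xi> = tzero)"
    by (rule metric[unfolded pseudo_riemannian_metric_def, THEN conjunct1, THEN bspec])
  show "\<xi> \<in> tangent_space A x \<Longrightarrow> \<eta> \<in> tangent_space A x \<Longrightarrow> g x \<xi> \<eta> = g x \<eta> \<xi>"
    using * by blast
  show "\<xi> \<in> tangent_space A x \<Longrightarrow> \<eta> \<in> tangent_space A x \<Longrightarrow> \<zeta> \<in> tangent_space A x \<Longrightarrow>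
      g x (tadd \<xi> \<eta>) \<zeta> = g x \<xi> \<zeta> + g x \<eta> \<zeta>"
    using * by blast
  show "\<xi> \<in> tangent_space A x \<Longrightarrow> \<eta> \<in> tangent_space A x \<Longrightarrow> g x (tscale r \<xi>) \<eta> = r * g x \<xi> \<eta>"
    using * by blast
  show "\<xi> \<in> tangent_space A x \<Longrightarrow> (\<And>\<eta>. \<eta> \<in> tangent_space A x \<Longrightarrow> g x \<xi> \<eta> = 0) \<Longrightarrow> \<xi> = tzero"
    using * by blast
qed

lemma metric_coeff_chart: "x \<in> cdom c \<Longrightarrow> metric_coeff (cmap c x) w t = g x (X w x) (X t x)"
  by (simp add: metric_coeff_def cinv_cmap[OF man c])

lemma metric_coeff_smooth: "smooth_on (\<lambda>p. metric_coeff p w t) (cmap c ` cdom c)"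
  using metric_smooth[of w t] c unfolding smooth_function_on_def metric_coeff_def by (fastforce simp: o_def)

lemma metric_coeff_sym: "p \<in> cmap c ` cdom c \<Longrightarrow> metric_coeff p w t = metric_coeff p t w"
  unfolding metric_coeff_def using chart_coordinate(1)[OF c] by (intro metric_sym X_tangent) auto

lemma metric_coeff_linear: "p \<in> cmap c ` cdom c \<Longrightarrow> linear (metric_coeff p w)"
proof -
  assume p: "p \<in> cmap c ` cdom c"
  have x: "cinv c p \<in> cdom c" by (rule chart_coordinate(1)[OF c p])
  have "linear (\<lambda>t. metric_coeff p t w)"
    by (rule linearI)
      (simp_all add: metric_coeff_def X_linear[OF x] metric_add[OF x] metric_scale[OF x] X_tangent[OF x])
  then show ?thesis by (simp add: metric_coeff_sym[OF p, of _ w])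
qed

lemma metric_coeff_nondegenerate:
  assumes p: "p \<in> cmap c ` cdom c" and w: "\<And>t. metric_coeff p w t = 0"
  shows "w = 0"
proof -
  have x: "cinv c p \<in> cdom c" by (rule chart_coordinate(1)[OF c p])
  have "X w (cinv c p) = tzero"
  proof (rule metric_nondegenerate[OF x X_tangent[OF x]])
    fix \<eta> assume "\<eta> \<in> tangent_space A (cinv c p)"
    then have "\<eta> = X (\<eta> c) (cinv c p)" using X_component[OF x] by simp
    then show "g (cinv c p) (X w (cinv c p)) \<eta> = 0"
      using w[of "\<eta> c"] unfolding metric_coeff_def by simp
  qed
  then show "w = 0" using X_self[OF x, of w] by (simp add: tzero_def)
qed

lemma dird_metric_coeff:
  assumes x: "x \<in> cdom c"
  shows "dird (\<lambda>q. metric_coeff q w t) (cmap c x) u =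
    metric_coeff (cmap c x) (christoffel x w u) t + metric_coeff (cmap c x) w (christoffel x t u)"
proof -
  have N: "nabla (X w) x (X u x) = X (christoffel x w u) x" for w
    unfolding christoffel_def
    by (rule X_component[OF x, symmetric]) (rule nabla_tangent[OF X_field x X_tangent[OF x]])
  have "dirderiv A (\<lambda>y. g y (X w y) (X t y)) x (X u x) = dird (\<lambda>q. metric_coeff q w t) (cmap c x) u"
    using dirderiv_chart[OF man metric_smooth oc x X_tangent[OF x] c x, of w t u]
    by (simp add: X_self[OF x] metric_coeff_def o_def)
  then show ?thesis
    using metric_compatible[OF X_field X_field x X_tangent[OF x], of w t u]
    by (simp add: N metric_coeff_chart[OF x])
qed

lemma christoffel_sym: "x \<in> cdom c \<Longrightarrow> christoffel x w s = christoffel x s w"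
proof -
  assume x: "x \<in> cdom c"
  have "dird (\<lambda>p. X w (cinv c p) c) (cmap c x) s = dird (\<lambda>p. w) (cmap c x) s"
    by (rule dird_transform(2)[OF oS])
      (use x in \<open>auto simp: cinv_cmap[OF man c] X_self\<close>)
  then show ?thesis
    using torsion_free[OF X_field[of s] X_field[of w] x]
    by (simp add: christoffel_def tadd_def lie_bracket_coord_vector[OF c x] frechet_derivative_const)
qed

lemma field_coeff_smooth: "smooth_on field_coeff (cmap c ` cdom c)"
  using v_field c unfolding vector_field_on_def field_coeff_def by fastforce

lemma field_coeff_chart: "x \<in> cdom c \<Longrightarrow> X (field_coeff (cmap c x)) x = v x"
  using v_field X_component[of x "v x"]
  by (simp add: field_coeff_def cinv_cmap[OF man c] vector_field_on_def)

lemma field_coeff_zero_iff: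
  assumes x: "x \<in> cdom c"
  shows "field_coeff (cmap c x) = 0 \<longleftrightarrow> v x = tzero"
proof
  assume "field_coeff (cmap c x) = 0"
  then have "v x = X 0 x" using field_coeff_chart[OF x] by simp
  also have "X 0 x = tzero"
    using X_linear(2)[OF x, of 0 0] by (simp add: tscale_def tzero_def)
  finally show "v x = tzero" .
next
  assume "v x = tzero"
  then show "field_coeff (cmap c x) = 0"
    by (simp add: field_coeff_def cinv_cmap[OF man c x] tzero_def)
qed

text \<open>Torsion-freeness, with the coordinate fields being constant in the chart.\<close>

lemma nabla_coeff_eq:
  assumes x: "x \<in> cdom c"
  shows "nabla_coeff x w = dird field_coeff (cmap c x) w + christoffel x w (field_coeff (cmap c x))"
proof -
  have "nabla_coeff x w = lie_bracket A (X w) v x c + christoffel x w (field_coeff (cmap c x))"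
    using torsion_free[OF X_field[of w] v_field x]
    by (simp add: nabla_coeff_def tadd_def christoffel_def field_coeff_chart[OF x])
  then show ?thesis
    by (simp add: lie_bracket_coord_vector[OF c x] field_coeff_def[abs_def])
qed

text \<open>The equation \<open>\<L>\<^sub>v g = \<phi> g\<close> says that the symmetric part of \<open>\<nabla>v\<close> is \<open>\<phi> / 2\<close>: torsion-freeness
  expresses the brackets in \<open>\<L>\<^sub>v g\<close> by covariant derivatives, and those of the coordinate fields
  cancel against the derivative of the metric coefficients.\<close>

lemma conformal_nabla:
  assumes x: "x \<in> cdom c"
  shows "metric_coeff (cmap c x) (nabla_coeff x w) t + metric_coeff (cmap c x) w (nabla_coeff x t)
    = \<phi> x * metric_coeff (cmap c x) w t"
proof -
  let ?b = "metric_coeff (cmap c x)"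
  have p: "cmap c x \<in> cmap c ` cdom c" using x by blast
  have vx: "v x \<in> tangent_space A x" using v_field x by (simp add: vector_field_on_def)
  have L: "lie_bracket A v (X w) x = X (christoffel x w (field_coeff (cmap c x)) - nabla_coeff x w) x" for w
  proof -
    have "nabla (X w) x (v x) = X (christoffel x w (field_coeff (cmap c x))) x"
      unfolding christoffel_def field_coeff_chart[OF x]
      by (rule X_component[OF x, symmetric]) (rule nabla_tangent[OF X_field x vx])
    moreover have "nabla v x (X w x) = X (nabla_coeff x w) x"
      unfolding nabla_coeff_def
      by (rule X_component[OF x, symmetric]) (rule nabla_tangent[OF v_field x X_tangent[OF x]])
    ultimately have e: "X (christoffel x w (field_coeff (cmap c x))) x = tadd (X (nabla_coeff x w) x) (lie_bracket A v (X w) x)"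
      using torsion_free[OF v_field X_field[of w] x] by simp
    have "X (christoffel x w (field_coeff (cmap c x)) - nabla_coeff x w + nabla_coeff x w) x
        = tadd (X (christoffel x w (field_coeff (cmap c x)) - nabla_coeff x w) x) (X (nabla_coeff x w) x)"
      by (rule X_linear(1)[OF x])
    with e show ?thesis by (simp add: tadd_def fun_eq_iff)
  qed
  have lin: "linear (?b w)" for w by (rule metric_coeff_linear[OF p])
  have diff2: "?b w (s - s') = ?b w s - ?b w s'" for w s s' by (rule linear_diff[OF lin])
  have diff1: "?b (s - s') w = ?b s w - ?b s' w" for w s s'
    using diff2[of w s s'] by (simp add: metric_coeff_sym[OF p, of _ w])
  have "lie_derivative_metric A v g (X w) (X t) x = \<phi> x * g x (X w x) (X t x)"
    by (rule conf[unfolded conformal_vector_field_def, THEN conjunct2, THEN spec, THEN spec, THEN spec,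
          THEN mp, OF oc, THEN mp, OF X_field, THEN mp, OF X_field, THEN bspec, OF x])
  moreover have "dirderiv A (\<lambda>y. g y (X w y) (X t y)) x (v x) = dird (\<lambda>q. metric_coeff q w t) (cmap c x) (field_coeff (cmap c x))"
    using dirderiv_chart[OF man metric_smooth oc x vx c x, of w t]
    by (simp add: field_coeff_def cinv_cmap[OF man c x] metric_coeff_def o_def)
  ultimately show ?thesis
    unfolding lie_derivative_metric_def L
    by (simp add: metric_coeff_chart[OF x, symmetric] dird_metric_coeff[OF x] diff1 diff2)
qed

lemma endo_matrix_nabla: "endo_matrix A c x (nabla v x) = matrix (nabla_coeff x)"
  by (simp add: endo_matrix_def nabla_coeff_def[abs_def])

lemma conformal_factor:
  assumes x: "x \<in> cdom c"
  shows "\<phi> x = 2 / real CARD('n) * trace (matrix (nabla_coeff x))"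
proof -
  have p: "cmap c x \<in> cmap c ` cdom c" using x by blast
  have "linear (nabla_coeff x)"
    unfolding nabla_coeff_def[abs_def] by (rule nabla_linear[OF v_field x])
  then have "matrix (nabla_coeff x) *v w = nabla_coeff x w" for w
    by (intro matrix_works) (simp add: linear_matrix_vector_mul_eq)
  then have "2 * trace (matrix (nabla_coeff x)) = real CARD('n) * \<phi> x"
    by (intro trace_conformal[OF metric_coeff_linear[OF p] metric_coeff_sym[OF p]
          metric_coeff_nondegenerate[OF p]]) (simp_all add: conformal_nabla[OF x])
  then show ?thesis by (simp add: field_simps)
qed

lemma conformal_factor_divergence:
  assumes x: "x \<in> cdom c"
  shows "\<phi> x = 2 / real CARD('n) * divergence A nabla v x"
  using conformal_factor[OF x] endo_trace_chart[OF man nabla_endomorphism[OF v_field x] c x]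
  by (simp add: divergence_def endo_matrix_nabla)

text \<open>Smoothness of \<open>\<phi>\<close> follows from that of \<open>\<nabla>v\<close>, of which it is a multiple of the trace.\<close>

lemma conformal_factor_smooth: "smooth_on (\<lambda>p. \<phi> (cinv c p)) (cmap c ` cdom c)"
proof (rule smooth_on_cong[OF oS])
  have "smooth_on (\<lambda>p. nabla_coeff (cinv c p) w) (cmap c ` cdom c)" for w
    using nabla_field[OF v_field X_field[of w]] c
    unfolding vector_field_on_def nabla_coeff_def by fastforce
  then have "smooth_on (\<lambda>p. nabla_coeff (cinv c p) w $ i) (cmap c ` cdom c)" for w i
    by (rule smooth_on_components[OF oS, THEN iffD1, rule_format])
  then show "smooth_on (\<lambda>p. 2 / real CARD('n) * (\<Sum>i\<in>UNIV. nabla_coeff (cinv c p) (axis i 1) $ i)) (cmap c ` cdom c)"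
    by (intro smooth_on_mult smooth_on_const smooth_on_sum oS)
  show "2 / real CARD('n) * (\<Sum>i\<in>UNIV. nabla_coeff (cinv c p) (axis i 1) $ i) = \<phi> (cinv c p)"
    if "p \<in> cmap c ` cdom c" for p
    using conformal_factor[OF chart_coordinate(1)[OF c that]] by (simp add: trace_def matrix_def)
qed

lemma field_coeff_conformal:
  assumes p: "p \<in> cmap c ` cdom c"
  shows "dird (\<lambda>q. metric_coeff q w t) p (field_coeff p) + metric_coeff p (dird field_coeff p w) t
    + metric_coeff p w (dird field_coeff p t) = \<phi> (cinv c p) * metric_coeff p w t"
proof -
  have x: "cinv c p \<in> cdom c" "cmap c (cinv c p) = p" by (rule chart_coordinate[OF c p])+
  have lin: "linear (metric_coeff p w)" for w by (rule metric_coeff_linear[OF p])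
  have add2: "metric_coeff p w (s + s') = metric_coeff p w s + metric_coeff p w s'" for w s s' by (rule linear_add[OF lin])
  have add1: "metric_coeff p (s + s') w = metric_coeff p s w + metric_coeff p s' w" for w s s'
    using add2[of w s s'] by (simp add: metric_coeff_sym[OF p, of _ w])
  show ?thesis
    using conformal_nabla[OF x(1), of w t] dird_metric_coeff[OF x(1), of w t "field_coeff p"]
    by (simp add: x(2) nabla_coeff_eq[OF x(1)] add1 add2)
qed

text \<open>At a zero of \<open>v\<close> the Christoffel symbols do not contribute, and \<open>\<nabla>v\<close> is the ordinary derivative of
  the components of \<open>v\<close>.\<close>

lemma jac_field_coeff_zero:
  assumes x: "x \<in> cdom c" "v x = tzero"
  shows "endo_charpoly A x (nabla v x) = matrix_charpoly (jac_matrix (\<lambda>i q. field_coeff q $ i) (cmap c x))"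
proof -
  have p: "cmap c x \<in> cmap c ` cdom c" using x by blast
  have "christoffel x w (field_coeff (cmap c x)) = 0" for w
    using linear_0[OF nabla_linear[OF X_field x(1)], of w] field_coeff_zero_iff[OF x(1)] x(2)
    by (simp add: christoffel_def)
  then have "nabla_coeff x w = jac_matrix (\<lambda>i q. field_coeff q $ i) (cmap c x) *v w" for w
    by (simp add: nabla_coeff_eq[OF x(1)]
        jac_matrix_component_mult[OF smooth_on_imp_differentiable[OF field_coeff_smooth p]])
  then have "nabla_coeff x = (*v) (jac_matrix (\<lambda>i q. field_coeff q $ i) (cmap c x))" by blast
  then show ?thesis
    using endo_charpoly_chart[OF man nabla_endomorphism[OF v_field x(1)] c x(1)]
    by (simp add: endo_matrix_nabla)
qed

lemma negligible_values_on_zeros_chart: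
  shows "negligible (\<phi> ` (zero_set M v \<inter> cdom c))"
    and "negligible ((\<lambda>x. coeff (endo_charpoly A x (nabla v x)) k) ` (zero_set M v \<inter> cdom c))"
proof -
  let ?S = "cmap c ` cdom c" and ?J = "jac_matrix (\<lambda>i q. field_coeff q $ i)"
  have variation: "2 * trace (R ** (\<chi> i j. dird (\<lambda>q. ?J q $ i $ j) p u)) =
      dird (\<lambda>p. \<phi> (cinv c p)) p u * (trace R + 1 / t - 1 / (t - \<phi> (cinv c p)))"
    if "p \<in> ?S" "field_coeff p = 0" "?J p *v u = 0" "R ** (mat t - ?J p) = mat 1" "t \<noteq> 0" "t \<noteq> \<phi> (cinv c p)"
    for p u t R
  proof (rule trace_resolvent_second_derivative[OF oS field_coeff_smooth conformal_factor_smooth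
        metric_coeff_smooth metric_coeff_linear metric_coeff_sym field_coeff_conformal that(1,2)
        metric_coeff_nondegenerate[OF that(1)] _ _ _ that(3-6)])
    have x: "cinv c p \<in> cdom c" "cmap c (cinv c p) = p" by (rule chart_coordinate[OF c that(1)])+
    show "linear (christoffel (cinv c p) w)" for w
      unfolding christoffel_def[abs_def] by (rule nabla_linear[OF X_field x(1)])
    show "christoffel (cinv c p) w s = christoffel (cinv c p) s w" for w s
      by (rule christoffel_sym[OF x(1)])
    show "dird (\<lambda>r. metric_coeff r w t) p u =
        metric_coeff p (christoffel (cinv c p) w u) t + metric_coeff p w (christoffel (cinv c p) t u)" for w t u
      using dird_metric_coeff[OF x(1), of w t u] by (simp add: x(2))
  qed
  have zeros: "{p \<in> ?S. field_coeff p = 0} = cmap c ` (zero_set M v \<inter> cdom c)"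
  proof -
    have "{p \<in> ?S. field_coeff p = 0} = cmap c ` {x \<in> cdom c. field_coeff (cmap c x) = 0}" by blast
    also have "{x \<in> cdom c. field_coeff (cmap c x) = 0} = {x \<in> cdom c. v x = tzero}"
      by (rule Collect_cong) (simp only: field_coeff_zero_iff cong: conj_cong)
    also have "\<dots> = zero_set M v \<inter> cdom c"
      using openin_subset[OF oc] unfolding zero_set_def by blast
    finally show ?thesis .
  qed
  have "negligible ((\<lambda>p. \<phi> (cinv c p)) ` {p \<in> ?S. field_coeff p = 0})"
    by (rule negligible_values_at_zeros(1)[where V = field_coeff and \<Phi> = "\<lambda>p. \<phi> (cinv c p)" and S = ?S])
      (rule oS field_coeff_smooth conformal_factor_smooth variation; assumption?)+
  then have neg1: "negligible ((\<lambda>x. \<phi> (cinv c (cmap c x))) ` (zero_set M v \<inter> cdom c))"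
    unfolding zeros image_image .
  have "negligible ((\<lambda>p. coeff (matrix_charpoly (?J p)) k) ` {p \<in> ?S. field_coeff p = 0})"
    by (rule negligible_values_at_zeros(2)[where V = field_coeff and \<Phi> = "\<lambda>p. \<phi> (cinv c p)" and S = ?S])
      (rule oS field_coeff_smooth conformal_factor_smooth variation; assumption?)+
  then have neg2: "negligible ((\<lambda>x. coeff (matrix_charpoly (?J (cmap c x))) k) ` (zero_set M v \<inter> cdom c))"
    unfolding zeros image_image .
  have "(\<lambda>x. \<phi> (cinv c (cmap c x))) ` (zero_set M v \<inter> cdom c) = \<phi> ` (zero_set M v \<inter> cdom c)"
  proof (rule image_cong[OF refl])
    fix x assume "x \<in> zero_set M v \<inter> cdom c"
    then have "cinv c (cmap c x) = x" using cinv_cmap[OF man c] by blast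
    then show "\<phi> (cinv c (cmap c x)) = \<phi> x" by (rule arg_cong)
  qed
  then show "negligible (\<phi> ` (zero_set M v \<inter> cdom c))"
    using neg1 by (simp only:)
  have "(\<lambda>x. coeff (matrix_charpoly (?J (cmap c x))) k) ` (zero_set M v \<inter> cdom c) =
      (\<lambda>x. coeff (endo_charpoly A x (nabla v x)) k) ` (zero_set M v \<inter> cdom c)"
  proof (rule image_cong[OF refl])
    fix x assume "x \<in> zero_set M v \<inter> cdom c"
    then have "x \<in> cdom c" "v x = tzero" by (auto simp: zero_set_def)
    then show "coeff (matrix_charpoly (?J (cmap c x))) k = coeff (endo_charpoly A x (nabla v x)) k"
      by (simp only: jac_field_coeff_zero)
  qed
  then show "negligible ((\<lambda>x. coeff (endo_charpoly A x (nabla v x)) k) ` (zero_set M v \<inter> cdom c))"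
    using neg2 by (simp only:)
qed

lemma continuous_in_chart:
  shows "\<exists>f. continuous_on (cmap c ` cdom c) f \<and> (\<forall>x\<in>zero_set M v \<inter> cdom c. \<phi> x = f (cmap c x))"
    and "\<exists>f. continuous_on (cmap c ` cdom c) f \<and>
      (\<forall>x\<in>zero_set M v \<inter> cdom c. coeff (endo_charpoly A x (nabla v x)) k = f (cmap c x))"
proof -
  show "\<exists>f. continuous_on (cmap c ` cdom c) f \<and> (\<forall>x\<in>zero_set M v \<inter> cdom c. \<phi> x = f (cmap c x))"
    using smooth_on_continuous_on[OF conformal_factor_smooth]
    by (intro exI[of _ "\<lambda>p. \<phi> (cinv c p)"]) (simp add: cinv_cmap[OF man c])
  have "smooth_on (\<lambda>p. jac_matrix (\<lambda>i q. field_coeff q $ i) p $ i $ j) (cmap c ` cdom c)" for i j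
    using field_coeff_smooth by (simp add: jac_matrix_def smooth_on_components[OF oS] smooth_on_dird)
  then have "continuous_on (cmap c ` cdom c)
      (\<lambda>p. coeff (matrix_charpoly (jac_matrix (\<lambda>i q. field_coeff q $ i) p)) k)"
    by (intro smooth_on_continuous_on smooth_on_coeff_matrix_charpoly oS)
  then show "\<exists>f. continuous_on (cmap c ` cdom c) f \<and>
      (\<forall>x\<in>zero_set M v \<inter> cdom c. coeff (endo_charpoly A x (nabla v x)) k = f (cmap c x))"
    by (intro exI[of _ "\<lambda>p. coeff (matrix_charpoly (jac_matrix (\<lambda>i q. field_coeff q $ i) p)) k"] conjI)
      (simp_all add: jac_field_coeff_zero zero_set_def)
qed

end

section \<open>Constancy on connected components\<close>

text \<open>A component of a general set \<open>Z\<close> may contain no nonconstant curve, so differentiating along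
  curves would not suffice; but a connected set of real numbers that is negligible has at most one element.
  Countably many charts cover the manifold.\<close>

lemma constant_on_component_of_negligible:
  fixes F :: "'a \<Rightarrow> real"
  assumes Z: "Z \<subseteq> topspace M"
    and cont: "\<And>c. c \<in> A \<Longrightarrow> \<exists>f. continuous_on (cmap c ` cdom c) f \<and> (\<forall>x\<in>Z \<inter> cdom c. F x = f (cmap c x))"
    and neg: "\<And>c. c \<in> A \<Longrightarrow> negligible (F ` (Z \<inter> cdom c))"
    and C: "C \<in> connected_components_of (subtopology M Z)"
  shows "F constant_on C"
proof -
  have CZ: "C \<subseteq> Z"
    using connected_components_of_subset[OF C] by auto
  have cover: "(\<Union>c\<in>A. cdom c) = topspace M"
    using man unfolding smooth_manifold_def by blast
  have "continuous_map (subtopology M Z) euclideanreal F"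
    unfolding continuous_map_def
  proof (intro conjI allI impI)
    fix U :: "real set" assume U: "openin euclideanreal U"
    show "openin (subtopology M Z) {x \<in> topspace (subtopology M Z). F x \<in> U}"
    proof (subst openin_subopen, intro ballI)
      fix x assume x: "x \<in> {x \<in> topspace (subtopology M Z). F x \<in> U}"
      then have xZ: "x \<in> Z" "F x \<in> U" by auto
      then obtain c where c: "c \<in> A" "x \<in> cdom c" using cover Z by blast
      obtain f where f: "continuous_on (cmap c ` cdom c) f" "\<And>y. y \<in> Z \<inter> cdom c \<Longrightarrow> F y = f (cmap c y)"
        using cont[OF c(1)] by blast
      have "continuous_map (subtopology M (cdom c)) (top_of_set (cmap c ` cdom c)) (cmap c)"
        using chart_homeo[OF man c(1)] homeomorphic_imp_continuous_map by blast
      then have "continuous_map (subtopology M (cdom c)) euclideanreal (f \<circ> cmap c)"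
        by (rule continuous_map_compose) (use f(1) in simp)
      then have "openin (subtopology M (cdom c)) {y \<in> topspace (subtopology M (cdom c)). (f \<circ> cmap c) y \<in> U}"
        using U openin_continuous_map_preimage by blast
      then have W: "openin M {y \<in> topspace (subtopology M (cdom c)). (f \<circ> cmap c) y \<in> U}"
        using openin_trans_full chart_openin[OF man c(1)] by blast
      let ?T = "{y \<in> topspace (subtopology M (cdom c)). (f \<circ> cmap c) y \<in> U} \<inter> Z"
      have "openin (subtopology M Z) ?T"
        using W by (auto simp: openin_subtopology)
      moreover have "x \<in> ?T" using xZ c f(2)[of x] Z by auto
      moreover have "?T \<subseteq> {x \<in> topspace (subtopology M Z). F x \<in> U}" using f(2) by auto
      ultimately show "\<exists>T. openin (subtopology M Z) T \<and> x \<in> T \<and> T \<subseteq> {x \<in> topspace (subtopology M Z). F x \<in> U}"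
        by blast
    qed
  qed simp
  moreover have "connectedin (subtopology M Z) C"
    using C by (rule connectedin_connected_components_of)
  ultimately have conn: "connected (F ` C)"
    using connectedin_continuous_map_image by fastforce
  have "second_countable M" using man unfolding smooth_manifold_def by blast
  then have "Lindelof_space M" by (rule second_countable_imp_Lindelof_space)
  then obtain \<V> where \<V>: "countable \<V>" "\<V> \<subseteq> cdom ` A" "\<Union>\<V> = topspace M"
    using Lindelof_spaceD[of M "cdom ` A"] cover chart_openin[OF man] by (metis imageE)
  have "negligible (\<Union>V\<in>\<V>. F ` (Z \<inter> V))"
    using \<V> neg by (intro negligible_countable_Union) auto
  moreover have "F ` C \<subseteq> (\<Union>V\<in>\<V>. F ` (Z \<inter> V))"
  proof
    fix y assume "y \<in> F ` C"
    then obtain x where x: "x \<in> Z" "y = F x" using CZ by blast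
    then have "x \<in> \<Union>\<V>" using Z unfolding \<V>(3) by blast
    then show "y \<in> (\<Union>V\<in>\<V>. F ` (Z \<inter> V))" using x by blast
  qed
  ultimately have nC: "negligible (F ` C)" using negligible_subset by blast
  have "F x = F y" if "x \<in> C" "y \<in> C" "F x \<le> F y" for x y
  proof -
    have "cbox (F x) (F y) \<subseteq> F ` C"
      using connected_contains_Icc[OF conn] that by auto
    then have "negligible (cbox (F x) (F y))" using nC negligible_subset by blast
    then have "box (F x) (F y) = {}" using negligible_interval by blast
    then show ?thesis using that(3) by auto
  qed
  then have "F x = F y" if "x \<in> C" "y \<in> C" for x y
    using that by (metis linear)
  then show ?thesis unfolding constant_on_def by blast
qed

end

theorem theorem4p2:
  fixes M :: "'a topology"
    and A :: "('a, 'n::finite) chart set"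
    and g :: "'a \<Rightarrow> ('a, 'n) tangent \<Rightarrow> ('a, 'n) tangent \<Rightarrow> real"
    and nabla :: "('a \<Rightarrow> ('a, 'n) tangent) \<Rightarrow> 'a \<Rightarrow> ('a, 'n) tangent \<Rightarrow> ('a, 'n) tangent"
    and v :: "'a \<Rightarrow> ('a, 'n) tangent"
    and \<phi> :: "'a \<Rightarrow> real"
  assumes "smooth_manifold M A"
    and "CARD('n) \<ge> 3"
    and "pseudo_riemannian_metric M A g"
    and "levi_civita_connection M A g nabla"
    and "conformal_vector_field M A g v \<phi>"
  shows "(\<forall>x\<in>topspace M. \<phi> x = 2 / real CARD('n) * divergence A nabla v x) \<and>
    (\<forall>C \<in> connected_components_of (subtopology M (zero_set M v)).
       (\<lambda>x. endo_charpoly A x (nabla v x)) constant_on C \<and> \<phi> constant_on C)"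
proof (intro conjI ballI)
  fix x assume "x \<in> topspace M"
  moreover have "(\<Union>c\<in>A. cdom c) = topspace M"
    using assms(1) unfolding smooth_manifold_def by blast
  ultimately obtain c where "c \<in> A" "x \<in> cdom c" by blast
  then show "\<phi> x = 2 / real CARD('n) * divergence A nabla v x"
    by (rule conformal_factor_divergence[OF assms(1,3-5)])
next
  fix C assume C: "C \<in> connected_components_of (subtopology M (zero_set M v))"
  have Z: "zero_set M v \<subseteq> topspace M" by (auto simp: zero_set_def)
  show "\<phi> constant_on C"
    by (rule constant_on_component_of_negligible[OF assms(1) Z
          continuous_in_chart(1)[OF assms(1,3-5)] negligible_values_on_zeros_chart(1)[OF assms(1,3-5)] C])
  have coeffs: "(\<lambda>x. coeff (endo_charpoly A x (nabla v x)) k) constant_on C" for k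
    by (rule constant_on_component_of_negligible[OF assms(1) Z
          continuous_in_chart(2)[OF assms(1,3-5)] negligible_values_on_zeros_chart(2)[OF assms(1,3-5)] C])
  have "endo_charpoly A x (nabla v x) = endo_charpoly A y (nabla v y)" if "x \<in> C" "y \<in> C" for x y
  proof (rule poly_eqI)
    fix k
    obtain a where "\<And>z. z \<in> C \<Longrightarrow> coeff (endo_charpoly A z (nabla v z)) k = a"
      using coeffs[of k] unfolding constant_on_def by blast
    then show "coeff (endo_charpoly A x (nabla v x)) k = coeff (endo_charpoly A y (nabla v y)) k"
      using that by simp
  qed
  then show "(\<lambda>x. endo_charpoly A x (nabla v x)) constant_on C"
    unfolding constant_on_def by blast
qed

end
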